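(* Let $T$ be a complete theory eliminating imaginaries, and let $M\models T$ be atomic and strongly $\omega$-homogeneous over a set of parameters $A\subseteq M$. Let $G$ be an $A$-definable group. Let $A\subseteq B\subseteq C\subseteq M$, where $B$ and $C$ are normal extensions of $A$ in $M$, $B=\operatorname{dcl}(B)$ and $C=\operatorname{dcl}(C)$, such that every elementary permutation of $B$ fixing $A$ pointwise and every elementary permutation of $C$ fixing $A$ pointwise extends to an automorphism of $M$, and such that $M$ is atomic and strongly $\omega$-homogeneous over $B$ and over $C$. Then the short exact sequence of groups $$1\to \operatorname{Aut}(C/B)\xrightarrow{\ \iota\ }\operatorname{Aut}(C/A)\xrightarrow{\ \pi\ }\operatorname{Aut}(B/A)\to 1$$ ($\iota$ the inclusion, $\pi$ the restriction) induces a short exact sequence of pointed sets $$1\to \mathrm{H}^1_{\mathrm{def}}(B/A,G(B))\xrightarrow{\ \pi^1\ }\mathrm{H}^1_{\mathrm{def}}(C/A,G(C))\xrightarrow{\ \iota^1\ }\mathrm{H}^1_{\mathrm{def}}(C/B,G(C))^{\operatorname{Aut}(B/A)}.$$ That is: precomposition of cocycles, $\varphi\mapsto\varphi\circ\pi$ and $\varphi\mapsto\varphi\circ\iota$, induces well-defined maps of pointed sets $\pi^1$ and $\iota^1$ on cohomology; $\pi^1$ is injective; the image of $\iota^1$ is contained in the set of fixed points of the transform action of $\operatorname{Aut}(B/A)$ on $\mathrm{H}^1_{\mathrm{def}}(C/B,G(C))$; and the image of $\pi^1$ equals the kernel of $\iota^1$ (the preimage of the basepoint).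
   Context: $M$ is atomic over $A$ if the type over $A$ of every finite tuple from $M$ is isolated. $M$ is strongly $\omega$-homogeneous over $A$ if for any two finite tuples from $M$ with the same type over $A$ there is an automorphism of $M$ fixing $A$ pointwise and taking one to the other. A set $B$ with $A\subseteq B\subseteq M$ is a normal extension of $A$ in $M$ if for every finite tuple $\bar b$ from $B$, every realization of $\operatorname{tp}(\bar b/A)$ in $M$ is contained in $B$. For parameter sets $K\subseteq L\subseteq M$, $\operatorname{Aut}(L/K)$ is the group of permutations of $L$ that are elementary (in the sense of $M$) and fix $K$ pointwise. $G(L)$ denotes the set of elements of $G(M)$ all of whose coordinates lie in $L$; it is a subgroup of $G(M)$ when $K\subseteq L=\operatorname{dcl}(L)$ and $G$ is $K$-definable. Let $(K,L)$ be one of $(A,B)$, $(A,C)$, $(B,C)$. A definable (right) cocycle from $\operatorname{Aut}(L/K)$ to $G(L)$ is a function $\varphi:\operatorname{Aut}(L/K)\to G(L)$ such that (i) $\varphi(\sigma\tau)=\varphi(\sigma)\,\sigma(\varphi(\tau))$ for all $\sigma,\tau\in \operatorname{Aut}(L/K)$, and (ii) there are a $K$-definable function $h(\bar x,\bar y)$ and a finite tuple $\bar a$ from $L$ with $\varphi(\sigma)=h(\bar a,\sigma(\bar a))$ for all $\sigma\in \operatorname{Aut}(L/K)$. The set of these is $\mathrm{Z}^1_{\mathrm{def}}(L/K,G(L))$, pointed by the cocycle constantly equal to the identity. Cocycles $\varphi,\psi$ are cohomologous if there is $b\in G(L)$ with $\varphi(\sigma)=b^{-1}\psi(\sigma)\sigma(b)$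 for all $\sigma$; this is an equivalence relation, and $\mathrm{H}^1_{\mathrm{def}}(L/K,G(L))$ is the quotient pointed set, with basepoint the class of the constant cocycle. Transform action: for $\sigma\in \operatorname{Aut}(C/A)$ and $\varphi\in \mathrm{Z}^1_{\mathrm{def}}(C/B,G(C))$, the transform $\sigma(\varphi)$ is the cocycle $\tau\mapsto \sigma(\varphi(\sigma^{-1}\tau\sigma))$, $\tau\in \operatorname{Aut}(C/B)$. On cohomology classes this depends only on the restriction of $\sigma$ to $B$, and so gives an action of $\operatorname{Aut}(B/A)$ on $\mathrm{H}^1_{\mathrm{def}}(C/B,G(C))$ (choose any lift to $\operatorname{Aut}(C/A)$ of a given element of $\operatorname{Aut}(B/A)$); the superscript $\operatorname{Aut}(B/A)$ denotes its set of fixed points. *)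

theory Defs
  imports "HOL-Algebra.Exact_Sequence" "HOL-Algebra.Group_Action"
begin

section \<open>First-order logic\<close>

text \<open>A language is a set of function symbols and a set of relation symbols, each tagged with its
  arity.  Terms and formulas are raw syntax; \<open>tm_wf\<close> and \<open>fm_wf\<close> single out those of the language.
  Variables are de Bruijn indices: \<open>fm_wf \<L> n \<phi>\<close> says that \<open>\<phi>\<close> is an \<open>\<L>\<close>-formula in the free
  variables \<open>0, \<dots>, n - 1\<close>, and it is evaluated at a list of length \<open>n\<close>, whose head is the value of
  variable \<open>0\<close>.\<close>

record ('f, 'p) lang =
  funs :: "('f \<times> nat) set"
  rels :: "('p \<times> nat) set"

datatype 'f tm = Vr nat | Fn 'f "'f tm list"

datatype ('f, 'p) fm =
    Eql "'f tm" "'f tm"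
  | Rl 'p "'f tm list"
  | Ng "('f, 'p) fm"
  | Cnj "('f, 'p) fm" "('f, 'p) fm"
  | Exs "('f, 'p) fm"

fun tm_wf :: "('f, 'p) lang \<Rightarrow> nat \<Rightarrow> 'f tm \<Rightarrow> bool" where
  "tm_wf \<L> n (Vr i) \<longleftrightarrow> i < n"
| "tm_wf \<L> n (Fn f ts) \<longleftrightarrow> (f, length ts) \<in> funs \<L> \<and> (\<forall>t\<in>set ts. tm_wf \<L> n t)"

fun fm_wf :: "('f, 'p) lang \<Rightarrow> nat \<Rightarrow> ('f, 'p) fm \<Rightarrow> bool" where
  "fm_wf \<L> n (Eql s t) \<longleftrightarrow> tm_wf \<L> n s \<and> tm_wf \<L> n t"
| "fm_wf \<L> n (Rl p ts) \<longleftrightarrow> (p, length ts) \<in> rels \<L> \<and> (\<forall>t\<in>set ts. tm_wf \<L> n t)"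
| "fm_wf \<L> n (Ng \<phi>) \<longleftrightarrow> fm_wf \<L> n \<phi>"
| "fm_wf \<L> n (Cnj \<phi> \<psi>) \<longleftrightarrow> fm_wf \<L> n \<phi> \<and> fm_wf \<L> n \<psi>"
| "fm_wf \<L> n (Exs \<phi>) \<longleftrightarrow> fm_wf \<L> (Suc n) \<phi>"

record ('f, 'p, 'a) struct =
  univ :: "'a set"
  fint :: "'f \<Rightarrow> 'a list \<Rightarrow> 'a"
  rint :: "'p \<Rightarrow> 'a list \<Rightarrow> bool"

definition tuples :: "'a set \<Rightarrow> nat \<Rightarrow> 'a list set" where
  "tuples X n = {xs. length xs = n \<and> set xs \<subseteq> X}"

definition is_struct :: "('f, 'p) lang \<Rightarrow> ('f, 'p, 'a) struct \<Rightarrow> bool" where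
  "is_struct \<L> M \<longleftrightarrow> univ M \<noteq> {} \<and>
     (\<forall>(f, n)\<in>funs \<L>. \<forall>xs\<in>tuples (univ M) n. fint M f xs \<in> univ M)"

fun eval :: "('f, 'p, 'a) struct \<Rightarrow> 'a list \<Rightarrow> 'f tm \<Rightarrow> 'a" where
  "eval M e (Vr i) = e ! i"
| "eval M e (Fn f ts) = fint M f (map (eval M e) ts)"

fun sat :: "('f, 'p, 'a) struct \<Rightarrow> 'a list \<Rightarrow> ('f, 'p) fm \<Rightarrow> bool" where
  "sat M e (Eql s t) \<longleftrightarrow> eval M e s = eval M e t"
| "sat M e (Rl p ts) \<longleftrightarrow> rint M p (map (eval M e) ts)"
| "sat M e (Ng \<phi>) \<longleftrightarrow> \<not> sat M e \<phi>"
| "sat M e (Cnj \<phi> \<psi>) \<longleftrightarrow> sat M e \<phi> \<and> sat M e \<psi>"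
| "sat M e (Exs \<phi>) \<longleftrightarrow> (\<exists>x\<in>univ M. sat M (x # e) \<phi>)"

section \<open>Theories\<close>

definition is_theory :: "('f, 'p) lang \<Rightarrow> ('f, 'p) fm set \<Rightarrow> bool" where
  "is_theory \<L> T \<longleftrightarrow> (\<forall>\<phi>\<in>T. fm_wf \<L> 0 \<phi>)"

definition is_model :: "('f, 'p) lang \<Rightarrow> ('f, 'p, 'a) struct \<Rightarrow> ('f, 'p) fm set \<Rightarrow> bool" where
  "is_model \<L> M T \<longleftrightarrow> is_struct \<L> M \<and> (\<forall>\<phi>\<in>T. sat M [] \<phi>)"

text \<open>HOL cannot quantify over the universes of all models.  In the next two definitions the models
  range over all structures whose universe is a nonempty subset of the type of formulas.  This type
  is infinite and has at least as many elements as there are formulas of the language, so by the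
  downward Loewenheim-Skolem theorem every model has an elementary substructure isomorphic to one of
  these (which may be chosen to contain any given finite tuple), and the definitions agree with the
  ones quantifying over all models.\<close>

definition entails :: "('f, 'p) lang \<Rightarrow> ('f, 'p) fm set \<Rightarrow> ('f, 'p) fm \<Rightarrow> bool" where
  "entails \<L> T \<phi> \<longleftrightarrow>
     (\<forall>N :: ('f, 'p, ('f, 'p) fm) struct. is_model \<L> N T \<longrightarrow> sat N [] \<phi>)"

definition complete_theory :: "('f, 'p) lang \<Rightarrow> ('f, 'p) fm set \<Rightarrow> bool" where
  "complete_theory \<L> T \<longleftrightarrow> is_theory \<L> T \<and>
     (\<exists>N :: ('f, 'p, ('f, 'p) fm) struct. is_model \<L> N T) \<and>
     (\<forall>\<phi>. fm_wf \<L> 0 \<phi> \<longrightarrow> entails \<L> T \<phi> \<or> entails \<L> T (Ng \<phi>))"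

text \<open>Elimination of imaginaries as in Hodges, Model Theory, 4.4: every class of a \<open>\<emptyset>\<close>-definable
  equivalence relation on tuples is defined by some formula \<open>\<psi>(x, b)\<close> with \<open>b\<close> uniquely determined
  by \<open>\<psi>\<close> and the class.  Equivalently, every imaginary is interdefinable with a real tuple.\<close>

definition struct_elim_imag :: "('f, 'p) lang \<Rightarrow> ('f, 'p, 'a) struct \<Rightarrow> bool" where
  "struct_elim_imag \<L> N \<longleftrightarrow> (\<forall>n \<theta>. fm_wf \<L> (n + n) \<theta> \<longrightarrow>
     equiv (tuples (univ N) n)
       {(x, y). x \<in> tuples (univ N) n \<and> y \<in> tuples (univ N) n \<and> sat N (x @ y) \<theta>} \<longrightarrow>
     (\<forall>a\<in>tuples (univ N) n. \<exists>m \<psi>. fm_wf \<L> (n + m) \<psi> \<and>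
        (\<exists>!b. b \<in> tuples (univ N) m \<and>
           {x \<in> tuples (univ N) n. sat N (x @ b) \<psi>} = {x \<in> tuples (univ N) n. sat N (a @ x) \<theta>})))"

definition elim_imaginaries :: "('f, 'p) lang \<Rightarrow> ('f, 'p) fm set \<Rightarrow> bool" where
  "elim_imaginaries \<L> T \<longleftrightarrow>
     (\<forall>N :: ('f, 'p, ('f, 'p) fm) struct. is_model \<L> N T \<longrightarrow> struct_elim_imag \<L> N)"

section \<open>Definability, types and automorphisms\<close>

definition definable ::
    "('f, 'p) lang \<Rightarrow> ('f, 'p, 'a) struct \<Rightarrow> 'a set \<Rightarrow> nat \<Rightarrow> 'a list set \<Rightarrow> bool" where
  "definable \<L> M K n D \<longleftrightarrow> (\<exists>\<phi> c. set c \<subseteq> K \<and> fm_wf \<L> (n + length c) \<phi> \<and>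
     D = {xs \<in> tuples (univ M) n. sat M (xs @ c) \<phi>})"

text \<open>\<open>definable_fun \<L> M K p q D h\<close>: \<open>h\<close> is a \<open>K\<close>-definable (possibly partial) function from \<open>p\<close>-tuples
  to \<open>q\<close>-tuples with domain \<open>D\<close>; its values outside \<open>D\<close> are irrelevant.\<close>

definition definable_fun ::
    "('f, 'p) lang \<Rightarrow> ('f, 'p, 'a) struct \<Rightarrow> 'a set \<Rightarrow> nat \<Rightarrow> nat \<Rightarrow>
     'a list set \<Rightarrow> ('a list \<Rightarrow> 'a list) \<Rightarrow> bool" where
  "definable_fun \<L> M K p q D h \<longleftrightarrow> D \<subseteq> tuples (univ M) p \<and> h \<in> D \<rightarrow> tuples (univ M) q \<and>
     definable \<L> M K (p + q) {xs @ h xs | xs. xs \<in> D}"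

definition dcl :: "('f, 'p) lang \<Rightarrow> ('f, 'p, 'a) struct \<Rightarrow> 'a set \<Rightarrow> 'a set" where
  "dcl \<L> M K = {b \<in> univ M. definable \<L> M K 1 {[b]}}"

text \<open>The pair \<open>(\<phi>, c)\<close> stands for the formula \<open>\<phi>(x, c)\<close> with parameters \<open>c\<close>.\<close>

definition tp ::
    "('f, 'p) lang \<Rightarrow> ('f, 'p, 'a) struct \<Rightarrow> 'a set \<Rightarrow> 'a list \<Rightarrow> (('f, 'p) fm \<times> 'a list) set" where
  "tp \<L> M K xs = {(\<phi>, c). set c \<subseteq> K \<and> fm_wf \<L> (length xs + length c) \<phi> \<and> sat M (xs @ c) \<phi>}"

definition isolated_tp ::
    "('f, 'p) lang \<Rightarrow> ('f, 'p, 'a) struct \<Rightarrow> 'a set \<Rightarrow> 'a list \<Rightarrow> bool" where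
  "isolated_tp \<L> M K xs \<longleftrightarrow> (\<exists>(\<theta>, d)\<in>tp \<L> M K xs. \<forall>(\<phi>, c)\<in>tp \<L> M K xs.
     \<forall>ys\<in>tuples (univ M) (length xs). sat M (ys @ d) \<theta> \<longrightarrow> sat M (ys @ c) \<phi>)"

definition atomic_over :: "('f, 'p) lang \<Rightarrow> ('f, 'p, 'a) struct \<Rightarrow> 'a set \<Rightarrow> bool" where
  "atomic_over \<L> M K \<longleftrightarrow> (\<forall>xs. set xs \<subseteq> univ M \<longrightarrow> isolated_tp \<L> M K xs)"

definition automorphism ::
    "('f, 'p) lang \<Rightarrow> ('f, 'p, 'a) struct \<Rightarrow> ('a \<Rightarrow> 'a) \<Rightarrow> bool" where
  "automorphism \<L> M g \<longleftrightarrow> bij_betw g (univ M) (univ M) \<and>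
     (\<forall>(f, n)\<in>funs \<L>. \<forall>xs\<in>tuples (univ M) n. g (fint M f xs) = fint M f (map g xs)) \<and>
     (\<forall>(p, n)\<in>rels \<L>. \<forall>xs\<in>tuples (univ M) n. rint M p xs \<longleftrightarrow> rint M p (map g xs))"

definition strongly_omega_homogeneous_over ::
    "('f, 'p) lang \<Rightarrow> ('f, 'p, 'a) struct \<Rightarrow> 'a set \<Rightarrow> bool" where
  "strongly_omega_homogeneous_over \<L> M K \<longleftrightarrow>
     (\<forall>xs ys. set xs \<subseteq> univ M \<longrightarrow> set ys \<subseteq> univ M \<longrightarrow> length xs = length ys \<longrightarrow>
        tp \<L> M K xs = tp \<L> M K ys \<longrightarrow>
        (\<exists>g. automorphism \<L> M g \<and> (\<forall>x\<in>K. g x = x) \<and> map g xs = ys))"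

definition normal_extension ::
    "('f, 'p) lang \<Rightarrow> ('f, 'p, 'a) struct \<Rightarrow> 'a set \<Rightarrow> 'a set \<Rightarrow> bool" where
  "normal_extension \<L> M A B \<longleftrightarrow> A \<subseteq> B \<and> B \<subseteq> univ M \<and>
     (\<forall>xs ys. set xs \<subseteq> B \<longrightarrow> set ys \<subseteq> univ M \<longrightarrow> length xs = length ys \<longrightarrow>
        tp \<L> M A ys = tp \<L> M A xs \<longrightarrow> set ys \<subseteq> B)"

definition elementary_perm ::
    "('f, 'p) lang \<Rightarrow> ('f, 'p, 'a) struct \<Rightarrow> 'a set \<Rightarrow> ('a \<Rightarrow> 'a) \<Rightarrow> bool" where
  "elementary_perm \<L> M E \<sigma> \<longleftrightarrow> bij_betw \<sigma> E E \<and>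
     (\<forall>xs \<phi>. set xs \<subseteq> E \<longrightarrow> fm_wf \<L> (length xs) \<phi> \<longrightarrow> (sat M xs \<phi> \<longleftrightarrow> sat M (map \<sigma> xs) \<phi>))"

text \<open>\<open>Aut_grp \<L> M E K\<close> is \<open>Aut(E/K)\<close>.  As in \<^const>\<open>BijGroup\<close>, its elements are extensional
  functions on \<open>E\<close> and its product is composition.\<close>

definition Aut_grp ::
    "('f, 'p) lang \<Rightarrow> ('f, 'p, 'a) struct \<Rightarrow> 'a set \<Rightarrow> 'a set \<Rightarrow> ('a \<Rightarrow> 'a) monoid" where
  "Aut_grp \<L> M E K = BijGroup E
     \<lparr>carrier := {\<sigma> \<in> Bij E. elementary_perm \<L> M E \<sigma> \<and> (\<forall>x\<in>K. \<sigma> x = x)}\<rparr>"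

definition perms_extend ::
    "('f, 'p) lang \<Rightarrow> ('f, 'p, 'a) struct \<Rightarrow> 'a set \<Rightarrow> 'a set \<Rightarrow> bool" where
  "perms_extend \<L> M E K \<longleftrightarrow> (\<forall>\<sigma>\<in>carrier (Aut_grp \<L> M E K).
     \<exists>g. automorphism \<L> M g \<and> (\<forall>x\<in>E. g x = \<sigma> x))"

section \<open>Definable cohomology\<close>

definition definable_group ::
    "('f, 'p) lang \<Rightarrow> ('f, 'p, 'a) struct \<Rightarrow> 'a set \<Rightarrow> nat \<Rightarrow> 'a list monoid \<Rightarrow> bool" where
  "definable_group \<L> M K n G \<longleftrightarrow> group G \<and> definable \<L> M K n (carrier G) \<and>
     definable \<L> M K (n + n + n)
       {x @ y @ (x \<otimes>\<^bsub>G\<^esub> y) | x y. x \<in> carrier G \<and> y \<in> carrier G}"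

definition points :: "'a list monoid \<Rightarrow> 'a set \<Rightarrow> 'a list set" where
  "points G E = {g \<in> carrier G. set g \<subseteq> E}"

text \<open>In the following, \<open>n\<close> is the length of the tuples that make up \<open>G\<close>, and the arguments \<open>E K\<close>
  stand for \<open>E/K\<close>.  Cochains are extensional functions on \<open>Aut(E/K)\<close>.\<close>

definition Z1 ::
    "('f, 'p) lang \<Rightarrow> ('f, 'p, 'a) struct \<Rightarrow> nat \<Rightarrow> 'a list monoid \<Rightarrow> 'a set \<Rightarrow> 'a set \<Rightarrow>
     (('a \<Rightarrow> 'a) \<Rightarrow> 'a list) set" where
  "Z1 \<L> M n G E K = {\<phi> \<in> carrier (Aut_grp \<L> M E K) \<rightarrow>\<^sub>E points G E.
     (\<forall>\<sigma>\<in>carrier (Aut_grp \<L> M E K). \<forall>\<tau>\<in>carrier (Aut_grp \<L> M E K).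
        \<phi> (\<sigma> \<otimes>\<^bsub>Aut_grp \<L> M E K\<^esub> \<tau>) = \<phi> \<sigma> \<otimes>\<^bsub>G\<^esub> map \<sigma> (\<phi> \<tau>)) \<and>
     (\<exists>D h a. set a \<subseteq> E \<and> definable_fun \<L> M K (length a + length a) n D h \<and>
        (\<forall>\<sigma>\<in>carrier (Aut_grp \<L> M E K). a @ map \<sigma> a \<in> D \<and> \<phi> \<sigma> = h (a @ map \<sigma> a)))}"

definition trivial_cocycle ::
    "('f, 'p) lang \<Rightarrow> ('f, 'p, 'a) struct \<Rightarrow> 'a list monoid \<Rightarrow> 'a set \<Rightarrow> 'a set \<Rightarrow>
     ('a \<Rightarrow> 'a) \<Rightarrow> 'a list" where
  "trivial_cocycle \<L> M G E K = (\<lambda>\<sigma>\<in>carrier (Aut_grp \<L> M E K). \<one>\<^bsub>G\<^esub>)"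

definition cohomologous ::
    "('f, 'p) lang \<Rightarrow> ('f, 'p, 'a) struct \<Rightarrow> nat \<Rightarrow> 'a list monoid \<Rightarrow> 'a set \<Rightarrow> 'a set \<Rightarrow>
     ((('a \<Rightarrow> 'a) \<Rightarrow> 'a list) \<times> (('a \<Rightarrow> 'a) \<Rightarrow> 'a list)) set" where
  "cohomologous \<L> M n G E K = {(\<phi>, \<psi>). \<phi> \<in> Z1 \<L> M n G E K \<and> \<psi> \<in> Z1 \<L> M n G E K \<and>
     (\<exists>b\<in>points G E. \<forall>\<sigma>\<in>carrier (Aut_grp \<L> M E K).
        \<phi> \<sigma> = inv\<^bsub>G\<^esub> b \<otimes>\<^bsub>G\<^esub> \<psi> \<sigma> \<otimes>\<^bsub>G\<^esub> map \<sigma> b)}"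

definition H1 ::
    "('f, 'p) lang \<Rightarrow> ('f, 'p, 'a) struct \<Rightarrow> nat \<Rightarrow> 'a list monoid \<Rightarrow> 'a set \<Rightarrow> 'a set \<Rightarrow>
     (('a \<Rightarrow> 'a) \<Rightarrow> 'a list) set set" where
  "H1 \<L> M n G E K = Z1 \<L> M n G E K // cohomologous \<L> M n G E K"

definition H1_base ::
    "('f, 'p) lang \<Rightarrow> ('f, 'p, 'a) struct \<Rightarrow> nat \<Rightarrow> 'a list monoid \<Rightarrow> 'a set \<Rightarrow> 'a set \<Rightarrow>
     (('a \<Rightarrow> 'a) \<Rightarrow> 'a list) set" where
  "H1_base \<L> M n G E K = cohomologous \<L> M n G E K `` {trivial_cocycle \<L> M G E K}"

text \<open>The map on classes induced by a map \<open>F\<close> on cocycles with values in the cocycles of \<open>E/K\<close>;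
  meaningful if \<open>F\<close> respects the relation of being cohomologous, in which case the union is over
  equal sets.\<close>

definition on_classes ::
    "('f, 'p) lang \<Rightarrow> ('f, 'p, 'a) struct \<Rightarrow> nat \<Rightarrow> 'a list monoid \<Rightarrow> 'a set \<Rightarrow> 'a set \<Rightarrow>
     ((('a \<Rightarrow> 'a) \<Rightarrow> 'a list) \<Rightarrow> (('a \<Rightarrow> 'a) \<Rightarrow> 'a list)) \<Rightarrow>
     (('a \<Rightarrow> 'a) \<Rightarrow> 'a list) set \<Rightarrow> (('a \<Rightarrow> 'a) \<Rightarrow> 'a list) set" where
  "on_classes \<L> M n G E K F X = (\<Union>\<phi>\<in>X. cohomologous \<L> M n G E K `` {F \<phi>})"

text \<open>Precomposition with the restriction \<open>\<pi> : Aut(C/A) \<rightarrow> Aut(B/A)\<close>, and with the inclusion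
  \<open>\<iota> : Aut(C/B) \<rightarrow> Aut(C/A)\<close>.\<close>

definition precomp_restr ::
    "('f, 'p) lang \<Rightarrow> ('f, 'p, 'a) struct \<Rightarrow> 'a set \<Rightarrow> 'a set \<Rightarrow> 'a set \<Rightarrow>
     (('a \<Rightarrow> 'a) \<Rightarrow> 'a list) \<Rightarrow> (('a \<Rightarrow> 'a) \<Rightarrow> 'a list)" where
  "precomp_restr \<L> M A B C \<phi> = compose (carrier (Aut_grp \<L> M C A)) \<phi> (\<lambda>\<sigma>. restrict \<sigma> B)"

definition precomp_incl ::
    "('f, 'p) lang \<Rightarrow> ('f, 'p, 'a) struct \<Rightarrow> 'a set \<Rightarrow> 'a set \<Rightarrow>
     (('a \<Rightarrow> 'a) \<Rightarrow> 'a list) \<Rightarrow> (('a \<Rightarrow> 'a) \<Rightarrow> 'a list)" where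
  "precomp_incl \<L> M B C \<phi> = compose (carrier (Aut_grp \<L> M C B)) \<phi> (\<lambda>\<sigma>. \<sigma>)"

definition pi1 ::
    "('f, 'p) lang \<Rightarrow> ('f, 'p, 'a) struct \<Rightarrow> nat \<Rightarrow> 'a list monoid \<Rightarrow> 'a set \<Rightarrow> 'a set \<Rightarrow> 'a set \<Rightarrow>
     (('a \<Rightarrow> 'a) \<Rightarrow> 'a list) set \<Rightarrow> (('a \<Rightarrow> 'a) \<Rightarrow> 'a list) set" where
  "pi1 \<L> M n G A B C = on_classes \<L> M n G C A (precomp_restr \<L> M A B C)"

definition iota1 ::
    "('f, 'p) lang \<Rightarrow> ('f, 'p, 'a) struct \<Rightarrow> nat \<Rightarrow> 'a list monoid \<Rightarrow> 'a set \<Rightarrow> 'a set \<Rightarrow>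
     (('a \<Rightarrow> 'a) \<Rightarrow> 'a list) set \<Rightarrow> (('a \<Rightarrow> 'a) \<Rightarrow> 'a list) set" where
  "iota1 \<L> M n G B C = on_classes \<L> M n G C B (precomp_incl \<L> M B C)"

definition transform ::
    "('f, 'p) lang \<Rightarrow> ('f, 'p, 'a) struct \<Rightarrow> 'a set \<Rightarrow> 'a set \<Rightarrow> 'a set \<Rightarrow>
     ('a \<Rightarrow> 'a) \<Rightarrow> (('a \<Rightarrow> 'a) \<Rightarrow> 'a list) \<Rightarrow> (('a \<Rightarrow> 'a) \<Rightarrow> 'a list)" where
  "transform \<L> M A B C \<sigma> \<phi> = (\<lambda>\<tau>\<in>carrier (Aut_grp \<L> M C B).
     map \<sigma> (\<phi> (inv\<^bsub>Aut_grp \<L> M C A\<^esub> \<sigma> \<otimes>\<^bsub>Aut_grp \<L> M C A\<^esub> \<tau> \<otimes>\<^bsub>Aut_grp \<L> M C A\<^esub> \<sigma>)))"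

text \<open>The action of \<open>Aut(B/A)\<close> on classes.  Instead of choosing a lift of \<open>\<rho>\<close> to \<open>Aut(C/A)\<close> the
  union over all lifts is taken; all of them give the same class.\<close>

definition H1_action ::
    "('f, 'p) lang \<Rightarrow> ('f, 'p, 'a) struct \<Rightarrow> nat \<Rightarrow> 'a list monoid \<Rightarrow> 'a set \<Rightarrow> 'a set \<Rightarrow> 'a set \<Rightarrow>
     ('a \<Rightarrow> 'a) \<Rightarrow> (('a \<Rightarrow> 'a) \<Rightarrow> 'a list) set \<Rightarrow> (('a \<Rightarrow> 'a) \<Rightarrow> 'a list) set" where
  "H1_action \<L> M n G A B C \<rho> = (\<lambda>X\<in>H1 \<L> M n G C B.
     \<Union>\<sigma>\<in>{\<sigma> \<in> carrier (Aut_grp \<L> M C A). restrict \<sigma> B = \<rho>}.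
       on_classes \<L> M n G C B (transform \<L> M A B C \<sigma>) X)"

definition H1_fixed ::
    "('f, 'p) lang \<Rightarrow> ('f, 'p, 'a) struct \<Rightarrow> nat \<Rightarrow> 'a list monoid \<Rightarrow> 'a set \<Rightarrow> 'a set \<Rightarrow> 'a set \<Rightarrow>
     (('a \<Rightarrow> 'a) \<Rightarrow> 'a list) set set" where
  "H1_fixed \<L> M n G A B C = {X \<in> H1 \<L> M n G C B.
     \<forall>\<rho>\<in>carrier (Aut_grp \<L> M B A). H1_action \<L> M n G A B C \<rho> X = X}"

end

theory Submission
  imports Defs
begin

text \<open>
  The proof is that of the inflation-restriction sequence of nonabelian group cohomology, with two
  additions from model theory.

  The first is a Galois correspondence.  If \<open>M\<close> is atomic and strongly homogeneous over \<open>E\<close>, the orbit of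
  a finite tuple under the automorphisms of \<open>M\<close> over \<open>E\<close> is defined by one formula over \<open>E\<close>
  (\<open>isolating_formula\<close>), and so everything fixed by these automorphisms lies in \<open>dcl(E)\<close>.  By normality
  and extendability of elementary permutations, the groups \<open>Aut(E/K)\<close> consist of the restrictions of
  automorphisms of \<open>M\<close> over \<open>K\<close>.  This gives the exact sequence of groups, shows that the points \<open>G(E)\<close> form
  a group, and identifies \<open>G(B)\<close> with the fixed points of \<open>Aut(C/B)\<close> in \<open>G(C)\<close>.

  The algebra is then the classical one.  For \<open>\<phi>\<close> in \<open>Z^1(C/A)\<close> and \<open>\<sigma>\<close> in \<open>Aut(C/A)\<close>, the element
  \<open>\<phi>(\<sigma>)\<close> shows that the restriction of \<open>\<phi>\<close> to \<open>Aut(C/B)\<close> is cohomologous to its transform by \<open>\<sigma>\<close>; the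
  same computation for \<open>\<sigma>\<close> in \<open>Aut(C/B)\<close> makes the transform an action of \<open>Aut(B/A)\<close> on classes.  If \<open>b\<close>
  shows that two inflated cocycles are cohomologous, then \<open>b\<close> is fixed by \<open>Aut(C/B)\<close>, hence lies in
  \<open>G(B)\<close>; so \<open>\<pi>\<^sup>1\<close> is injective (\<open>infl_coh_reflect\<close>).  A cocycle whose restriction to \<open>Aut(C/B)\<close> is
  cohomologically trivial is cohomologous to one that is trivial there, and this one is inflated from a
  function on \<open>Aut(B/A)\<close>.

  The second addition is that this function is definable (\<open>descend_cocycle\<close>).  If \<open>\<psi>(\<sigma>)\<close> is a definable
  function of \<open>c\<close> and \<open>\<sigma>(c)\<close> with \<open>c\<close> in \<open>C\<close> and depends only on the restriction of \<open>\<sigma>\<close> to \<open>B\<close>, let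
  \<open>\<theta>(x, d)\<close> isolate the type of \<open>c\<close> over \<open>B\<close>.  The value stays the same when \<open>c\<close> and \<open>\<sigma>(c)\<close> are replaced by
  any solutions of \<open>\<theta>(x, d)\<close> and \<open>\<theta>(x, \<sigma>(d))\<close>.  So it is determined by \<open>d\<close> and \<open>\<sigma>(d)\<close>, definably, and \<open>d\<close>
  lies in \<open>B\<close>.
\<close>

section \<open>Definable relations\<close>

primrec ren_tm :: "(nat \<Rightarrow> nat) \<Rightarrow> 'f tm \<Rightarrow> 'f tm" where
  "ren_tm f (Vr i) = Vr (f i)"
| "ren_tm f (Fn g ts) = Fn g (map (ren_tm f) ts)"

text \<open>The substitution \<open>f\<close> acts on free variables only: below a quantifier the bound variable \<open>0\<close> stays
  put and the others are shifted, which avoids capture.\<close>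
primrec ren_fm :: "(nat \<Rightarrow> nat) \<Rightarrow> ('f, 'p) fm \<Rightarrow> ('f, 'p) fm" where
  "ren_fm f (Eql s t) = Eql (ren_tm f s) (ren_tm f t)"
| "ren_fm f (Rl p ts) = Rl p (map (ren_tm f) ts)"
| "ren_fm f (Ng \<phi>) = Ng (ren_fm f \<phi>)"
| "ren_fm f (Cnj \<phi> \<psi>) = Cnj (ren_fm f \<phi>) (ren_fm f \<psi>)"
| "ren_fm f (Exs \<phi>) = Exs (ren_fm (case_nat 0 (\<lambda>i. Suc (f i))) \<phi>)"

lemma tm_wf_ren: "tm_wf \<L> n t \<Longrightarrow> (\<And>i. i < n \<Longrightarrow> f i < m) \<Longrightarrow> tm_wf \<L> m (ren_tm f t)"
  by (induction t) auto

lemma fm_wf_ren: "fm_wf \<L> n \<phi> \<Longrightarrow> (\<And>i. i < n \<Longrightarrow> f i < m) \<Longrightarrow> fm_wf \<L> m (ren_fm f \<phi>)"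
  by (induction \<phi> arbitrary: n m f) (auto intro: tm_wf_ren split: nat.split)

lemma eval_ren:
  "tm_wf \<L> n t \<Longrightarrow> (\<And>i. i < n \<Longrightarrow> e' ! i = e ! f i) \<Longrightarrow> eval M e (ren_tm f t) = eval M e' t"
  by (induction t) (auto simp: o_def cong: map_cong)

lemma sat_ren:
  "fm_wf \<L> n \<phi> \<Longrightarrow> (\<And>i. i < n \<Longrightarrow> e' ! i = e ! f i) \<Longrightarrow> sat M e (ren_fm f \<phi>) \<longleftrightarrow> sat M e' \<phi>"
proof (induction \<phi> arbitrary: n e e' f)
  case (Eql s t)
  then show ?case
    using eval_ren[where t = s and M = M] eval_ren[where t = t and M = M] by (metis fm_wf.simps(1) ren_fm.simps(1) sat.simps(1))
next
  case (Cnj \<phi> \<psi>)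
  then show ?case
    by (metis fm_wf.simps(4) ren_fm.simps(4) sat.simps(4))
next
  case (Rl p ts)
  then have "map (eval M e) (map (ren_tm f) ts) = map (eval M e') ts"
    by (auto intro: eval_ren)
  then show ?case
    by (simp del: map_map)
next
  case (Exs \<phi>)
  have "sat M (x # e) (ren_fm (case_nat 0 (\<lambda>i. Suc (f i))) \<phi>) \<longleftrightarrow> sat M (x # e') \<phi>" for x
    using Exs.prems by (intro Exs.IH[of "Suc n"]) (auto split: nat.split)
  then show ?case
    by simp
qed (auto simp: eval_ren)

lemma sat_Exs_pow: "sat M e ((Exs ^^ l) \<phi>) \<longleftrightarrow> (\<exists>b\<in>tuples (univ M) l. sat M (b @ e) \<phi>)"
proof (induction l arbitrary: e)
  case (Suc l)
  have "sat M e ((Exs ^^ Suc l) \<phi>) \<longleftrightarrow>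
      (\<exists>x\<in>univ M. \<exists>b\<in>tuples (univ M) l. sat M ((b @ [x]) @ e) \<phi>)"
    by (simp add: Suc.IH)
  also have "\<dots> \<longleftrightarrow> (\<exists>b\<in>tuples (univ M) (Suc l). sat M (b @ e) \<phi>)" (is "?L \<longleftrightarrow> ?R")
  proof
    assume ?L
    then obtain x b where "x \<in> univ M" "b \<in> tuples (univ M) l" "sat M ((b @ [x]) @ e) \<phi>"
      by blast
    then show ?R
      by (intro bexI[of _ "b @ [x]"]) (auto simp: tuples_def)
  next
    assume ?R
    then obtain b where b: "b \<in> tuples (univ M) (Suc l)" "sat M (b @ e) \<phi>"
      by blast
    then have "b = butlast b @ [last b]"
      by (auto simp: tuples_def intro!: append_butlast_last_id[symmetric])
    moreover from this b have "last b \<in> univ M" "butlast b \<in> tuples (univ M) l"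
      by (auto simp: tuples_def dest: in_set_butlastD) (metis UnCI in_mono list.set_intros(1) set_append)
    ultimately show ?L
      using b(2) by metis
  qed
  finally show ?case .
qed (auto simp: tuples_def)

lemma fm_wf_Exs_pow: "fm_wf \<L> n ((Exs ^^ l) \<phi>) \<longleftrightarrow> fm_wf \<L> (l + n) \<phi>"
  by (induction l arbitrary: n) auto

definition blocks :: "'a set \<Rightarrow> nat list \<Rightarrow> 'a list list set" where
  "blocks X ls = {bs. map length bs = ls \<and> (\<forall>b\<in>set bs. set b \<subseteq> X)}"

text \<open>Definability of a relation between several tuples, whose lengths are listed in \<open>ls\<close>.  Keeping the
  tuples apart instead of working with their concatenation turns substitution and exchange of
  variables into operations on lists of tuples, so that definitions by formulas with quantifiers
  over tuples can be read off from the closure properties below.\<close>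
definition definable_rel ::
    "('f, 'p) lang \<Rightarrow> ('f, 'p, 'a) struct \<Rightarrow> 'a set \<Rightarrow> nat list \<Rightarrow> ('a list list \<Rightarrow> bool) \<Rightarrow> bool" where
  "definable_rel \<L> M K ls P \<longleftrightarrow> (\<exists>\<phi> c. set c \<subseteq> K \<and> fm_wf \<L> (sum_list ls + length c) \<phi> \<and>
     (\<forall>bs\<in>blocks (univ M) ls. P bs \<longleftrightarrow> sat M (concat bs @ c) \<phi>))"

lemma blocks_Nil [simp]: "bs \<in> blocks X [] \<longleftrightarrow> bs = []"
  by (auto simp: blocks_def)

lemma blocks_Cons:
  "bs \<in> blocks X (l # ls) \<longleftrightarrow> (\<exists>b bs'. bs = b # bs' \<and> b \<in> tuples X l \<and> bs' \<in> blocks X ls)"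
  by (cases bs) (auto simp: blocks_def tuples_def)

lemma length_concat_blocks: "bs \<in> blocks X ls \<Longrightarrow> length (concat bs) = sum_list ls"
  by (auto simp: blocks_def length_concat)

lemma concat_blocks: "concat ` blocks X ls = tuples X (sum_list ls)"
proof (induction ls)
  case (Cons l ls)
  show ?case
  proof (intro subset_antisym subsetI)
    fix v assume v: "v \<in> tuples X (sum_list (l # ls))"
    then have "drop l v \<in> tuples X (sum_list ls)"
      by (auto simp: tuples_def dest: in_set_dropD)
    then obtain bs where "bs \<in> blocks X ls" "drop l v = concat bs"
      using Cons.IH by (metis imageE)
    moreover from v have "take l v \<in> tuples X l"
      by (auto simp: tuples_def dest: in_set_takeD)
    moreover have "v = take l v @ drop l v"
      by simp
    ultimately show "v \<in> concat ` blocks X (l # ls)"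
      by (intro image_eqI[of _ _ "take l v # bs"]) (simp_all add: blocks_Cons)
  qed (force simp: blocks_def tuples_def length_concat)
qed (auto simp: tuples_def)

lemma definable_rel_mono: "definable_rel \<L> M K ls P \<Longrightarrow> K \<subseteq> K' \<Longrightarrow> definable_rel \<L> M K' ls P"
  unfolding definable_rel_def by (meson subset_trans)

lemma definable_mono: "definable \<L> M K n D \<Longrightarrow> K \<subseteq> K' \<Longrightarrow> definable \<L> M K' n D"
  unfolding definable_def by (elim exE conjE, intro exI conjI) auto

lemma definable_rel_of_set:
  assumes "definable \<L> M K (sum_list ls) D"
  shows "definable_rel \<L> M K ls (\<lambda>bs. concat bs \<in> D)"
proof -
  obtain \<phi> c where "set c \<subseteq> K" "fm_wf \<L> (sum_list ls + length c) \<phi>"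
     "D = {xs \<in> tuples (univ M) (sum_list ls). sat M (xs @ c) \<phi>}"
    using assms by (auto simp: definable_def)
  then show ?thesis
    unfolding definable_rel_def
    by (intro exI[of _ \<phi>] exI[of _ c]) (use concat_blocks[of "univ M" ls] in blast)
qed

lemma definable_of_rel:
  assumes "definable_rel \<L> M K ls P"
  shows "definable \<L> M K (sum_list ls) (concat ` {bs \<in> blocks (univ M) ls. P bs})"
proof -
  obtain \<phi> c where \<phi>: "set c \<subseteq> K" "fm_wf \<L> (sum_list ls + length c) \<phi>"
     "\<And>bs. bs \<in> blocks (univ M) ls \<Longrightarrow> P bs \<longleftrightarrow> sat M (concat bs @ c) \<phi>"
    using assms by (auto simp: definable_rel_def)
  then have "concat ` {bs \<in> blocks (univ M) ls. P bs} = {xs \<in> tuples (univ M) (sum_list ls). sat M (xs @ c) \<phi>}"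
    unfolding concat_blocks[symmetric] by auto
  with \<phi>(1,2) show ?thesis
    unfolding definable_def by blast
qed

lemma definable_rel_cong:
  "definable_rel \<L> M K ls P \<Longrightarrow> (\<And>bs. bs \<in> blocks (univ M) ls \<Longrightarrow> P bs \<longleftrightarrow> Q bs) \<Longrightarrow>
   definable_rel \<L> M K ls Q"
  unfolding definable_rel_def by auto

lemma definable_rel_Not:
  assumes "definable_rel \<L> M K ls P"
  shows "definable_rel \<L> M K ls (\<lambda>bs. \<not> P bs)"
proof -
  obtain \<phi> c where "set c \<subseteq> K" "fm_wf \<L> (sum_list ls + length c) \<phi>"
     "\<forall>bs\<in>blocks (univ M) ls. P bs \<longleftrightarrow> sat M (concat bs @ c) \<phi>"
    using assms by (auto simp: definable_rel_def)
  then show ?thesis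
    unfolding definable_rel_def by (intro exI[of _ "Ng \<phi>"] exI[of _ c]) auto
qed

text \<open>The parameters of the two formulas are put side by side, which moves those of the second.\<close>
lemma definable_rel_And:
  assumes "definable_rel \<L> M K ls P" "definable_rel \<L> M K ls Q"
  shows "definable_rel \<L> M K ls (\<lambda>bs. P bs \<and> Q bs)"
proof -
  let ?N = "sum_list ls"
  obtain \<phi> c where \<phi>: "set c \<subseteq> K" "fm_wf \<L> (?N + length c) \<phi>"
     "\<And>bs. bs \<in> blocks (univ M) ls \<Longrightarrow> P bs \<longleftrightarrow> sat M (concat bs @ c) \<phi>"
    using assms(1) by (auto simp: definable_rel_def)
  obtain \<psi> d where \<psi>: "set d \<subseteq> K" "fm_wf \<L> (?N + length d) \<psi>"
     "\<And>bs. bs \<in> blocks (univ M) ls \<Longrightarrow> Q bs \<longleftrightarrow> sat M (concat bs @ d) \<psi>"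
    using assms(2) by (auto simp: definable_rel_def)
  let ?\<phi> = "ren_fm (\<lambda>i. i) \<phi>" and ?\<psi> = "ren_fm (\<lambda>i. if i < ?N then i else i + length c) \<psi>"
  have "sat M (concat bs @ c @ d) ?\<phi> \<longleftrightarrow> P bs" "sat M (concat bs @ c @ d) ?\<psi> \<longleftrightarrow> Q bs"
    if "bs \<in> blocks (univ M) ls" for bs
    using that length_concat_blocks[OF that] \<phi> \<psi>
    by (auto intro!: sat_ren[OF \<phi>(2)] sat_ren[OF \<psi>(2)] simp: nth_append)
  moreover have "fm_wf \<L> (?N + length (c @ d)) ?\<phi>" "fm_wf \<L> (?N + length (c @ d)) ?\<psi>"
    by (auto intro: fm_wf_ren[OF \<phi>(2)] fm_wf_ren[OF \<psi>(2)])
  ultimately show ?thesis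
    unfolding definable_rel_def using \<phi>(1) \<psi>(1)
    by (intro exI[of _ "Cnj ?\<phi> ?\<psi>"] exI[of _ "c @ d"]) auto
qed

lemma definable_rel_Ex:
  assumes "definable_rel \<L> M K (l # ls) P"
  shows "definable_rel \<L> M K ls (\<lambda>bs. \<exists>b\<in>tuples (univ M) l. P (b # bs))"
proof -
  obtain \<phi> c where "set c \<subseteq> K" "fm_wf \<L> (sum_list (l # ls) + length c) \<phi>"
     "\<And>bs. bs \<in> blocks (univ M) (l # ls) \<Longrightarrow> P bs \<longleftrightarrow> sat M (concat bs @ c) \<phi>"
    using assms by (auto simp: definable_rel_def)
  then show ?thesis
    unfolding definable_rel_def
    by (intro exI[of _ "(Exs ^^ l) \<phi>"] exI[of _ c])
      (auto simp: sat_Exs_pow fm_wf_Exs_pow blocks_Cons add.assoc)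
qed

lemma nth_concat_blocks:
  assumes "i < length bs" "j < length (bs ! i)"
  shows "concat bs ! (sum_list (map length (take i bs)) + j) = bs ! i ! j"
proof -
  have "concat bs = concat (take i bs) @ bs ! i @ concat (drop (Suc i) bs)"
    by (metis assms(1) id_take_nth_drop concat.simps(2) concat_append)
  then show ?thesis
    using assms by (simp add: nth_append length_concat[symmetric])
qed

text \<open>Tuples may be permuted, repeated and added as dummies: position \<open>k\<close> of the concatenation of the
  selected tuples is position \<open>I ! k\<close> of the concatenation of all of them, and the formula is renamed
  along \<open>I\<close>.\<close>
lemma definable_rel_reindex:
  assumes P: "definable_rel \<L> M K (map ((!) ls) js) P" and js: "\<And>j. j \<in> set js \<Longrightarrow> j < length ls"
  shows "definable_rel \<L> M K ls (\<lambda>bs. P (map ((!) bs) js))"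
proof -
  let ?N = "sum_list ls" and ?ks = "map ((!) ls) js"
  let ?I = "concat (map (\<lambda>i. map (\<lambda>j. sum_list (take i ls) + j) [0..<ls ! i]) js)"
  obtain \<phi> c where \<phi>: "set c \<subseteq> K" "fm_wf \<L> (sum_list ?ks + length c) \<phi>"
     "\<And>bs. bs \<in> blocks (univ M) ?ks \<Longrightarrow> P bs \<longleftrightarrow> sat M (concat bs @ c) \<phi>"
    using P by (auto simp: definable_rel_def)
  let ?f = "\<lambda>i. if i < sum_list ?ks then ?I ! i else ?N + (i - sum_list ?ks)"
  have lenI: "length ?I = sum_list ?ks"
    by (simp add: length_concat o_def)
  have I: "map ((!) (concat bs)) ?I = concat (map ((!) bs) js)" if bs: "bs \<in> blocks (univ M) ls" for bs
  proof -
    have ls: "ls = map length bs"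
      using bs by (auto simp: blocks_def)
    have "map ((!) (concat bs)) (map (\<lambda>j. sum_list (take i ls) + j) [0..<ls ! i]) = bs ! i"
      if "i \<in> set js" for i
    proof (rule nth_equalityI)
      show "length (map ((!) (concat bs)) (map (\<lambda>j. sum_list (take i ls) + j) [0..<ls ! i])) = length (bs ! i)"
        using js[OF that] by (simp add: ls)
    next
      fix k assume "k < length (map ((!) (concat bs)) (map (\<lambda>j. sum_list (take i ls) + j) [0..<ls ! i]))"
      then show "map ((!) (concat bs)) (map (\<lambda>j. sum_list (take i ls) + j) [0..<ls ! i]) ! k = bs ! i ! k"
        using js[OF that] by (simp add: ls take_map nth_concat_blocks)
    qed
    then show ?thesis
      by (simp add: map_concat o_def cong: map_cong)
  qed
  have Ilt: "?I ! i < ?N" if "i < sum_list ?ks" for i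
  proof -
    have "?I ! i \<in> set ?I"
      using that unfolding lenI[symmetric] by (rule nth_mem)
    moreover have "\<exists>k\<in>set js. \<exists>j<ls ! k. v = sum_list (take k ls) + j" if v: "v \<in> set ?I" for v
    proof -
      obtain k where "k \<in> set js" "v \<in> (\<lambda>j. sum_list (take k ls) + j) ` {..<ls ! k}"
        using v by (auto simp: atLeast0LessThan)
      then show ?thesis
        by blast
    qed
    ultimately obtain k j where kj: "k \<in> set js" "j < ls ! k" "?I ! i = sum_list (take k ls) + j"
      by blast
    have "ls = take k ls @ ls ! k # drop (Suc k) ls"
      using js[OF kj(1)] by (rule id_take_nth_drop)
    then have "?N = sum_list (take k ls) + ls ! k + sum_list (drop (Suc k) ls)"
      by (metis add.assoc sum_list.Cons sum_list.append)
    with kj show ?thesis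
      by simp
  qed
  have "P (map ((!) bs) js) \<longleftrightarrow> sat M (concat bs @ c) (ren_fm ?f \<phi>)" if bs: "bs \<in> blocks (univ M) ls" for bs
  proof -
    have sub: "map ((!) bs) js \<in> blocks (univ M) ?ks"
      using bs js by (fastforce simp: blocks_def)
    have "(concat (map ((!) bs) js) @ c) ! i = (concat bs @ c) ! ?f i" if "i < sum_list ?ks + length c" for i
    proof (cases "i < sum_list ?ks")
      case True
      have "concat (map ((!) bs) js) ! i = map ((!) (concat bs)) ?I ! i"
        by (simp only: I[OF bs])
      also have "\<dots> = concat bs ! (?I ! i)"
        using True lenI by simp
      finally show ?thesis
        using True Ilt[OF True] length_concat_blocks[OF sub] length_concat_blocks[OF bs]
        by (simp add: nth_append)
    next
      case False
      then have "(concat (map ((!) bs) js) @ c) ! i = c ! (i - sum_list ?ks)"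
        using length_concat_blocks[OF sub] by (simp add: nth_append)
      with False show ?thesis
        using nth_append_length_plus[of "concat bs" c "i - sum_list ?ks"]
        by (simp only: length_concat_blocks[OF bs] if_False)
    qed
    then have "sat M (concat bs @ c) (ren_fm ?f \<phi>) \<longleftrightarrow> sat M (concat (map ((!) bs) js) @ c) \<phi>"
      by (rule sat_ren[OF \<phi>(2)])
    with \<phi>(3)[OF sub] show ?thesis
      by simp
  qed
  moreover have "fm_wf \<L> (?N + length c) (ren_fm ?f \<phi>)"
    by (rule fm_wf_ren[OF \<phi>(2)]) (auto intro: trans_less_add1[OF Ilt])
  ultimately show ?thesis
    unfolding definable_rel_def using \<phi>(1) by blast
qed

section \<open>Automorphisms, types and fixed points\<close>

lemma eval_automorphism:
  assumes "is_struct \<L> M" "automorphism \<L> M g" "set e \<subseteq> univ M"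
  shows "tm_wf \<L> (length e) t \<Longrightarrow> eval M e t \<in> univ M \<and> eval M (map g e) t = g (eval M e t)"
proof (induction t)
  case (Vr i)
  then show ?case
    using assms(3) by (auto simp: subset_iff)
next
  case (Fn f ts)
  then have ts: "map (eval M e) ts \<in> tuples (univ M) (length ts)"
    and eq: "map (eval M (map g e)) ts = map g (map (eval M e) ts)"
    by (auto simp: tuples_def)
  have "(f, length ts) \<in> funs \<L>"
    using Fn by simp
  with assms(1,2) ts have "fint M f (map (eval M e) ts) \<in> univ M"
    "g (fint M f (map (eval M e) ts)) = fint M f (map g (map (eval M e) ts))"
    unfolding is_struct_def automorphism_def by fast+
  then show ?case
    using eq by (simp del: map_map)
qed

lemma sat_automorphism:
  assumes "is_struct \<L> M" "automorphism \<L> M g"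
  shows "fm_wf \<L> (length e) \<phi> \<Longrightarrow> set e \<subseteq> univ M \<Longrightarrow> sat M (map g e) \<phi> \<longleftrightarrow> sat M e \<phi>"
proof (induction \<phi> arbitrary: e)
  case (Eql s t)
  have "inj_on g (univ M)"
    using assms(2) by (auto simp: automorphism_def bij_betw_def)
  then show ?case
    using Eql eval_automorphism[OF assms Eql(2)] by (auto simp: inj_on_eq_iff)
next
  case (Rl p ts)
  then have ts: "map (eval M e) ts \<in> tuples (univ M) (length ts)"
    and eq: "map (eval M (map g e)) ts = map g (map (eval M e) ts)"
    using eval_automorphism[OF assms Rl(2)] by (auto simp: tuples_def)
  have "(p, length ts) \<in> rels \<L>"
    using Rl by simp
  with assms(2) ts have "rint M p (map (eval M e) ts) \<longleftrightarrow> rint M p (map g (map (eval M e) ts))"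
    unfolding automorphism_def by fast
  then show ?case
    using eq by (simp del: map_map)
next
  case (Exs \<phi>)
  have img: "univ M = g ` univ M"
    using assms(2) by (auto simp: automorphism_def bij_betw_def)
  have "sat M (map g e) (Exs \<phi>) \<longleftrightarrow> (\<exists>x\<in>g ` univ M. sat M (x # map g e) \<phi>)"
    by (simp flip: img)
  also have "\<dots> \<longleftrightarrow> (\<exists>x\<in>univ M. sat M (x # e) \<phi>)"
    using Exs.IH[of "_ # e"] Exs.prems by auto
  finally show ?case
    by simp
qed auto

definition fix_auts :: "('f, 'p) lang \<Rightarrow> ('f, 'p, 'a) struct \<Rightarrow> 'a set \<Rightarrow> ('a \<Rightarrow> 'a) set" where
  "fix_auts \<L> M K = {g. automorphism \<L> M g \<and> (\<forall>x\<in>K. g x = x)}"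

lemma fix_auts_antimono: "K \<subseteq> K' \<Longrightarrow> fix_auts \<L> M K' \<subseteq> fix_auts \<L> M K"
  by (auto simp: fix_auts_def)

lemma fix_auts_bij: "g \<in> fix_auts \<L> M K \<Longrightarrow> bij_betw g (univ M) (univ M)"
  by (simp add: fix_auts_def automorphism_def)

lemma map_fix_auts_id: "g \<in> fix_auts \<L> M K \<Longrightarrow> set c \<subseteq> K \<Longrightarrow> map g c = c"
  by (auto simp: fix_auts_def intro: map_idI)

lemma map_tuples: "bij_betw g X X \<Longrightarrow> xs \<in> tuples X n \<Longrightarrow> map g xs \<in> tuples X n"
  by (auto simp: tuples_def bij_betw_def)

lemma fix_auts_id: "(\<lambda>x. x) \<in> fix_auts \<L> M K"
  by (auto simp: fix_auts_def automorphism_def bij_betw_def)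

lemma fix_auts_comp:
  assumes "is_struct \<L> M" "g \<in> fix_auts \<L> M K" "h \<in> fix_auts \<L> M K"
  shows "(\<lambda>x. g (h x)) \<in> fix_auts \<L> M K"
proof -
  have g: "automorphism \<L> M g" and h: "automorphism \<L> M h"
    using assms by (auto simp: fix_auts_def)
  have hU: "map h xs \<in> tuples (univ M) n" if "xs \<in> tuples (univ M) n" for xs n
    using map_tuples[OF fix_auts_bij[OF assms(3)] that] .
  have "g (h (fint M f xs)) = fint M f (map (\<lambda>x. g (h x)) xs)"
    if "(f, n) \<in> funs \<L>" "xs \<in> tuples (univ M) n" for f n xs
  proof -
    have "h (fint M f xs) = fint M f (map h xs)"
      using that h unfolding automorphism_def by fast
    moreover have "g (fint M f (map h xs)) = fint M f (map g (map h xs))"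
      using that(1) hU[OF that(2)] g unfolding automorphism_def by fast
    ultimately show ?thesis
      by (simp add: o_def)
  qed
  moreover have "rint M p xs \<longleftrightarrow> rint M p (map (\<lambda>x. g (h x)) xs)"
    if "(p, n) \<in> rels \<L>" "xs \<in> tuples (univ M) n" for p n xs
  proof -
    have "rint M p xs \<longleftrightarrow> rint M p (map h xs)"
      using that h unfolding automorphism_def by fast
    moreover have "rint M p (map h xs) \<longleftrightarrow> rint M p (map g (map h xs))"
      using that(1) hU[OF that(2)] g unfolding automorphism_def by fast
    ultimately show ?thesis
      by (simp add: o_def)
  qed
  moreover have "bij_betw (\<lambda>x. g (h x)) (univ M) (univ M)"
    using bij_betw_trans[OF fix_auts_bij[OF assms(3)] fix_auts_bij[OF assms(2)]] by (simp add: o_def)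
  ultimately show ?thesis
    using assms(2,3) unfolding fix_auts_def automorphism_def by auto
qed

lemma fix_auts_inv:
  assumes "is_struct \<L> M" "K \<subseteq> univ M" "g \<in> fix_auts \<L> M K"
  shows "inv_into (univ M) g \<in> fix_auts \<L> M K"
proof -
  let ?i = "inv_into (univ M) g"
  have g: "automorphism \<L> M g" and bij: "bij_betw g (univ M) (univ M)"
    using assms by (auto simp: fix_auts_def automorphism_def)
  have ibij: "bij_betw ?i (univ M) (univ M)"
    by (rule bij_betw_inv_into[OF bij])
  have inv: "map g (map ?i xs) = xs" if "xs \<in> tuples (univ M) n" for xs n
    using that bij_betw_inv_into_right[OF bij] by (auto simp: tuples_def subset_iff intro!: map_idI)
  have iU: "map ?i xs \<in> tuples (univ M) n" if "xs \<in> tuples (univ M) n" for xs n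
    using map_tuples[OF ibij that] .
  have "?i (fint M f xs) = fint M f (map ?i xs)"
    if f: "(f, n) \<in> funs \<L>" and xs: "xs \<in> tuples (univ M) n" for f n xs
  proof -
    have "g (fint M f (map ?i xs)) = fint M f (map g (map ?i xs))"
      using f iU[OF xs] g unfolding automorphism_def by fast
    then have "g (fint M f (map ?i xs)) = fint M f xs"
      by (simp only: inv[OF xs])
    moreover have "fint M f (map ?i xs) \<in> univ M"
      using f iU[OF xs] assms(1) unfolding is_struct_def by fast
    ultimately show ?thesis
      using bij_betw_inv_into_left[OF bij] by metis
  qed
  moreover have "rint M p xs \<longleftrightarrow> rint M p (map ?i xs)"
    if p: "(p, n) \<in> rels \<L>" and xs: "xs \<in> tuples (univ M) n" for p n xs
  proof -
    have "rint M p (map ?i xs) \<longleftrightarrow> rint M p (map g (map ?i xs))"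
      using p iU[OF xs] g unfolding automorphism_def by fast
    then show ?thesis
      by (simp only: inv[OF xs])
  qed
  moreover have "?i x = x" if "x \<in> K" for x
    using that assms(2,3) bij_betw_inv_into_left[OF bij, of x] by (auto simp: fix_auts_def)
  ultimately show ?thesis
    using ibij unfolding fix_auts_def automorphism_def by auto
qed

lemma sat_fix_auts:
  assumes "is_struct \<L> M" "g \<in> fix_auts \<L> M K" "K \<subseteq> univ M" "set xs \<subseteq> univ M" "set c \<subseteq> K"
    "fm_wf \<L> (length xs + length c) \<phi>"
  shows "sat M (map g xs @ c) \<phi> \<longleftrightarrow> sat M (xs @ c) \<phi>"
proof -
  have "map g xs @ c = map g (xs @ c)"
    using map_fix_auts_id[OF assms(2,5)] by simp
  moreover have "sat M (map g (xs @ c)) \<phi> \<longleftrightarrow> sat M (xs @ c) \<phi>"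
    using assms by (intro sat_automorphism) (auto simp: fix_auts_def)
  ultimately show ?thesis
    by simp
qed

lemma definable_invariant:
  assumes "is_struct \<L> M" "g \<in> fix_auts \<L> M K" "K \<subseteq> univ M" "definable \<L> M K n D" "xs \<in> tuples (univ M) n"
  shows "map g xs \<in> D \<longleftrightarrow> xs \<in> D"
proof -
  obtain \<phi> c where \<phi>: "set c \<subseteq> K" "fm_wf \<L> (n + length c) \<phi>"
     "D = {xs \<in> tuples (univ M) n. sat M (xs @ c) \<phi>}"
    using assms(4) by (auto simp: definable_def)
  then show ?thesis
    using sat_fix_auts[OF assms(1,2,3), of xs c \<phi>] assms(5) map_tuples[OF fix_auts_bij[OF assms(2)] assms(5)]
    by (auto simp: tuples_def)
qed

text \<open>An automorphism moves the parameters of a definition along with the set, and may therefore be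
  applied to definable sets whenever it preserves the parameter set as a whole.  This is what makes
  transforms of definable cocycles definable.\<close>
lemma definable_image:
  assumes "is_struct \<L> M" "automorphism \<L> M g" "g ` K \<subseteq> K" "K \<subseteq> univ M" "definable \<L> M K n D"
  shows "definable \<L> M K n (map g ` D)"
proof -
  obtain \<phi> c where \<phi>: "set c \<subseteq> K" "fm_wf \<L> (n + length c) \<phi>"
     and D: "D = {xs \<in> tuples (univ M) n. sat M (xs @ c) \<phi>}"
    using assms(5) by (auto simp: definable_def)
  have bij: "bij_betw g (univ M) (univ M)"
    using assms(2) by (simp add: automorphism_def)
  have sat: "sat M (map g xs @ map g c) \<phi> \<longleftrightarrow> sat M (xs @ c) \<phi>" if "xs \<in> tuples (univ M) n" for xs
    using sat_automorphism[OF assms(1,2), of "xs @ c" \<phi>] that \<phi> assms(4) by (auto simp: tuples_def)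
  have "map g ` D = {xs \<in> tuples (univ M) n. sat M (xs @ map g c) \<phi>}"
  proof (intro subset_antisym subsetI)
    fix xs assume "xs \<in> {xs \<in> tuples (univ M) n. sat M (xs @ map g c) \<phi>}"
    then have xs: "xs \<in> tuples (univ M) n" "sat M (xs @ map g c) \<phi>"
      by auto
    let ?ys = "map (inv_into (univ M) g) xs"
    have "map g ?ys = xs"
      using xs bij_betw_inv_into_right[OF bij] by (auto simp: tuples_def subset_iff intro!: map_idI)
    moreover have "?ys \<in> tuples (univ M) n"
      using map_tuples[OF bij_betw_inv_into[OF bij] xs(1)] .
    ultimately show "xs \<in> map g ` D"
      using xs(2) sat[of ?ys] by (intro image_eqI[of _ _ ?ys]) (auto simp only: D mem_Collect_eq)
  qed (auto simp: D sat map_tuples[OF bij])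
  then show ?thesis
    using \<phi> assms(3) unfolding definable_def
    by (intro exI[of _ \<phi>] exI[of _ "map g c"]) (auto simp: image_subset_iff)
qed

lemma tp_fix_auts:
  assumes "is_struct \<L> M" "g \<in> fix_auts \<L> M K" "K \<subseteq> univ M" "set xs \<subseteq> univ M"
  shows "tp \<L> M K (map g xs) = tp \<L> M K xs"
  using sat_fix_auts[OF assms(1-4)] by (auto simp: tp_def)

text \<open>The solutions of an isolating formula have the same type as \<open>xs\<close>, and homogeneity moves \<open>xs\<close> to each
  of them.  So the orbit of \<open>xs\<close> under the automorphisms over \<open>K\<close> is defined by one formula over \<open>K\<close>.\<close>
lemma isolating_formula:
  assumes "atomic_over \<L> M K" "strongly_omega_homogeneous_over \<L> M K" "set xs \<subseteq> univ M"
  obtains \<theta> d where "set d \<subseteq> K" "fm_wf \<L> (length xs + length d) \<theta>" "sat M (xs @ d) \<theta>"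
    "\<And>ys. ys \<in> tuples (univ M) (length xs) \<Longrightarrow> sat M (ys @ d) \<theta> \<Longrightarrow> \<exists>g\<in>fix_auts \<L> M K. map g xs = ys"
proof -
  obtain \<theta> d where \<theta>: "(\<theta>, d) \<in> tp \<L> M K xs"
    and iso: "\<And>\<phi> c ys. (\<phi>, c) \<in> tp \<L> M K xs \<Longrightarrow> ys \<in> tuples (univ M) (length xs) \<Longrightarrow>
      sat M (ys @ d) \<theta> \<Longrightarrow> sat M (ys @ c) \<phi>"
    using assms(1,3) unfolding atomic_over_def isolated_tp_def by blast
  have "\<exists>g\<in>fix_auts \<L> M K. map g xs = ys"
    if ys: "ys \<in> tuples (univ M) (length xs)" "sat M (ys @ d) \<theta>" for ys
  proof -
    have len: "length ys = length xs"
      using ys by (simp add: tuples_def)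
    have "sat M (ys @ c) \<phi> \<longleftrightarrow> sat M (xs @ c) \<phi>"
      if "set c \<subseteq> K" "fm_wf \<L> (length xs + length c) \<phi>" for \<phi> c
      using iso[of \<phi> c, OF _ ys] iso[of "Ng \<phi>" c, OF _ ys] that by (auto simp: tp_def)
    then have "tp \<L> M K xs = tp \<L> M K ys"
      by (auto simp: tp_def len)
    moreover have "set ys \<subseteq> univ M"
      using ys by (simp add: tuples_def)
    ultimately show ?thesis
      using assms(2)[unfolded strongly_omega_homogeneous_over_def, rule_format, of xs ys] assms(3) len
      by (auto simp: fix_auts_def)
  qed
  with \<theta> show thesis
    by (intro that[of d \<theta>]) (auto simp: tp_def)
qed

text \<open>The Galois correspondence: a fixed element is alone in its orbit, and the orbit is definable.\<close>
lemma dcl_if_fixed: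
  assumes "atomic_over \<L> M K" "strongly_omega_homogeneous_over \<L> M K" "x \<in> univ M"
    and fixed: "\<And>g. g \<in> fix_auts \<L> M K \<Longrightarrow> g x = x"
  shows "x \<in> dcl \<L> M K"
proof -
  have x: "set [x] \<subseteq> univ M"
    using assms(3) by simp
  obtain d \<theta> where \<theta>: "set d \<subseteq> K" "fm_wf \<L> (length [x] + length d) \<theta>" "sat M ([x] @ d) \<theta>"
    "\<And>ys. ys \<in> tuples (univ M) (length [x]) \<Longrightarrow> sat M (ys @ d) \<theta> \<Longrightarrow> \<exists>g\<in>fix_auts \<L> M K. map g [x] = ys"
    by (rule isolating_formula[OF assms(1,2) x]) (rule that)
  have "{[x]} = {ys \<in> tuples (univ M) 1. sat M (ys @ d) \<theta>}"
  proof (intro subset_antisym subsetI)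
    fix ys assume "ys \<in> {ys \<in> tuples (univ M) 1. sat M (ys @ d) \<theta>}"
    then obtain g where "g \<in> fix_auts \<L> M K" "map g [x] = ys"
      using \<theta>(4)[of ys] by auto
    with fixed show "ys \<in> {[x]}"
      by auto
  qed (use \<theta>(3) assms(3) in \<open>auto simp: tuples_def\<close>)
  then have "definable \<L> M K 1 {[x]}"
    unfolding definable_def using \<theta>(1,2) by (intro exI[of _ \<theta>] exI[of _ d]) auto
  with assms(3) show ?thesis
    by (simp add: dcl_def)
qed

text \<open>Automorphisms over \<open>A\<close> preserve types over \<open>A\<close>, so they map \<open>E\<close> into itself; so do their inverses.\<close>
lemma normal_extension_bij:
  assumes "is_struct \<L> M" "normal_extension \<L> M A E" "g \<in> fix_auts \<L> M A"
  shows "bij_betw g E E"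
proof -
  have E: "A \<subseteq> E" "E \<subseteq> univ M"
    using assms(2) by (auto simp: normal_extension_def)
  have closed: "h x \<in> E" if h: "h \<in> fix_auts \<L> M A" and x: "x \<in> E" for h x
  proof -
    have "tp \<L> M A (map h [x]) = tp \<L> M A [x]"
      using E x by (intro tp_fix_auts[OF assms(1) h]) auto
    moreover have "h x \<in> univ M"
      using fix_auts_bij[OF h] x E by (auto simp: bij_betw_def)
    ultimately have "set [h x] \<subseteq> E"
      using assms(2) x unfolding normal_extension_def
      by (metis empty_set empty_subsetI insert_subset length_map list.map(1,2) list.simps(15))
    then show ?thesis
      by simp
  qed
  have bij: "bij_betw g (univ M) (univ M)"
    by (rule fix_auts_bij[OF assms(3)])
  have "E \<subseteq> g ` E"
  proof
    fix x assume x: "x \<in> E"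
    have "inv_into (univ M) g \<in> fix_auts \<L> M A"
      using E by (intro fix_auts_inv assms) auto
    from closed[OF this x] have "inv_into (univ M) g x \<in> E" .
    moreover have "x = g (inv_into (univ M) g x)"
      using bij_betw_inv_into_right[OF bij, of x] E x by auto
    ultimately show "x \<in> g ` E"
      by (rule rev_image_eqI)
  qed
  moreover have "g ` E \<subseteq> E"
    using closed[OF assms(3)] by auto
  moreover have "inj_on g E"
    using bij E by (auto simp: bij_betw_def intro: inj_on_subset)
  ultimately show ?thesis
    by (auto simp: bij_betw_def)
qed

section \<open>The Galois group of an extension and its action on points\<close>

text \<open>The extension \<open>E/K\<close> inside \<open>M\<close>.  The third set \<open>A\<close> is the base over which \<open>G\<close> is defined and \<open>E\<close> is
  normal; it differs from \<open>K\<close> when \<open>E/K\<close> is the upper step of a tower over \<open>A\<close>.\<close>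
locale galois_extension =
  fixes \<L> :: "('f, 'p) lang" and M :: "('f, 'p, 'a) struct"
    and n :: nat and G :: "'a list monoid" and A K E :: "'a set"
  assumes struct: "is_struct \<L> M"
    and subsets: "A \<subseteq> K" "K \<subseteq> E" "E \<subseteq> univ M"
    and normal: "normal_extension \<L> M A E"
    and extend: "perms_extend \<L> M E A"
    and atomic: "atomic_over \<L> M E" and homogeneous: "strongly_omega_homogeneous_over \<L> M E"
    and dcl_closed: "E = dcl \<L> M E"
    and definable_group: "definable_group \<L> M A n G"
begin

abbreviation "\<Gamma> \<equiv> Aut_grp \<L> M E K"

sublocale G: group G
  using definable_group by (simp add: definable_group_def)

lemma carrier_G: "carrier G \<subseteq> tuples (univ M) n"
  using definable_group by (auto simp: definable_group_def definable_def)

lemma fix_auts_bij_E: "g \<in> fix_auts \<L> M K \<Longrightarrow> bij_betw g E E"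
  using normal_extension_bij[OF struct normal] fix_auts_antimono[OF subsets(1), of \<L> M] by blast

lemma restrict_in_Aut: "g \<in> fix_auts \<L> M K \<Longrightarrow> restrict g E \<in> carrier \<Gamma>"
proof -
  assume g: "g \<in> fix_auts \<L> M K"
  have E: "bij_betw (restrict g E) E E"
    using fix_auts_bij_E[OF g] by (simp cong: bij_betw_cong)
  have "sat M (map (restrict g E) xs) \<phi> \<longleftrightarrow> sat M xs \<phi>"
    if xs: "set xs \<subseteq> E" "fm_wf \<L> (length xs) \<phi>" for xs \<phi>
  proof -
    have "map (restrict g E) xs = map g xs"
      using xs by auto
    moreover have "sat M (map g xs) \<phi> \<longleftrightarrow> sat M xs \<phi>"
      using xs subsets g by (intro sat_automorphism[OF struct]) (auto simp: fix_auts_def)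
    ultimately show ?thesis
      by (simp del: map_eq_conv)
  qed
  then show ?thesis
    using E g subsets by (auto simp: Aut_grp_def elementary_perm_def Bij_def fix_auts_def)
qed

text \<open>An elementary permutation over \<open>K\<close> is one over \<open>A\<close>, so it extends, and every extension fixes \<open>K\<close>.
  Together with \<open>restrict_in_Aut\<close> this reduces questions on \<open>Aut(E/K)\<close> to automorphisms of \<open>M\<close>.\<close>
lemma Aut_lift:
  assumes "\<sigma> \<in> carrier \<Gamma>"
  obtains g where "g \<in> fix_auts \<L> M K" "\<sigma> = restrict g E"
proof -
  have "\<sigma> \<in> carrier (Aut_grp \<L> M E A)"
    using assms subsets by (auto simp: Aut_grp_def)
  then obtain g where g: "automorphism \<L> M g" "\<forall>x\<in>E. g x = \<sigma> x"
    using extend unfolding perms_extend_def by blast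
  have "g \<in> fix_auts \<L> M K"
    using assms g subsets by (auto simp: Aut_grp_def fix_auts_def)
  moreover have "\<sigma> = restrict g E"
    using assms g by (auto simp: Aut_grp_def Bij_def extensional_def restrict_def)
  ultimately show thesis
    by (rule that)
qed

lemma Aut_Bij: "\<sigma> \<in> carrier \<Gamma> \<Longrightarrow> \<sigma> \<in> Bij E"
  by (simp add: Aut_grp_def)

lemma Aut_closed: "\<sigma> \<in> carrier \<Gamma> \<Longrightarrow> x \<in> E \<Longrightarrow> \<sigma> x \<in> E"
  using Aut_Bij by (auto simp: Bij_def bij_betw_def)

lemma Aut_bij: "\<sigma> \<in> carrier \<Gamma> \<Longrightarrow> bij_betw \<sigma> E E"
  using Aut_Bij by (auto simp: Bij_def)

lemma Aut_ext: "\<sigma> \<in> carrier \<Gamma> \<Longrightarrow> \<tau> \<in> carrier \<Gamma> \<Longrightarrow> (\<And>x. x \<in> E \<Longrightarrow> \<sigma> x = \<tau> x) \<Longrightarrow> \<sigma> = \<tau>"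
  by (metis Aut_Bij Bij_imp_extensional extensionalityI)

lemma subgroup_Aut: "subgroup (carrier \<Gamma>) (BijGroup E)"
proof (rule group.subgroupI[OF group_BijGroup])
  show "carrier \<Gamma> \<subseteq> carrier (BijGroup E)"
    by (auto simp: BijGroup_def Aut_Bij)
  show "carrier \<Gamma> \<noteq> {}"
    using restrict_in_Aut[OF fix_auts_id] by blast
next
  fix \<sigma> assume \<sigma>: "\<sigma> \<in> carrier \<Gamma>"
  then obtain g where g: "g \<in> fix_auts \<L> M K" "\<sigma> = restrict g E"
    by (rule Aut_lift)
  let ?i = "inv_into (univ M) g"
  have "inv_into E \<sigma> x = ?i x" if x: "x \<in> E" for x
  proof -
    obtain y where y: "y \<in> E" "x = \<sigma> y"
      using Aut_bij[OF \<sigma>] x by (auto simp: bij_betw_def)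
    have "inv_into E \<sigma> x = y"
      unfolding y(2) by (rule bij_betw_inv_into_left[OF Aut_bij[OF \<sigma>] y(1)])
    moreover have "x = g y"
      using y g by simp
    then have "?i x = y"
      using y subsets bij_betw_inv_into_left[OF fix_auts_bij[OF g(1)], of y] by auto
    ultimately show ?thesis
      by simp
  qed
  then have "inv\<^bsub>BijGroup E\<^esub> \<sigma> = restrict ?i E"
    by (auto simp: inv_BijGroup[OF Aut_Bij[OF \<sigma>]])
  moreover have "?i \<in> fix_auts \<L> M K"
    using subsets by (intro fix_auts_inv[OF struct _ g(1)]) auto
  ultimately show "inv\<^bsub>BijGroup E\<^esub> \<sigma> \<in> carrier \<Gamma>"
    using restrict_in_Aut by simp
next
  fix \<sigma> \<tau> assume \<sigma>: "\<sigma> \<in> carrier \<Gamma>" and \<tau>: "\<tau> \<in> carrier \<Gamma>"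
  obtain g where g: "g \<in> fix_auts \<L> M K" "\<sigma> = restrict g E"
    using \<sigma> by (rule Aut_lift)
  obtain h where h: "h \<in> fix_auts \<L> M K" "\<tau> = restrict h E"
    using \<tau> by (rule Aut_lift)
  have "\<sigma> \<otimes>\<^bsub>BijGroup E\<^esub> \<tau> = restrict (\<lambda>x. g (h x)) E"
    using \<sigma> \<tau> Aut_closed[OF \<tau>] by (auto simp: BijGroup_def Aut_Bij compose_def g h)
  then show "\<sigma> \<otimes>\<^bsub>BijGroup E\<^esub> \<tau> \<in> carrier \<Gamma>"
    using restrict_in_Aut[OF fix_auts_comp[OF struct g(1) h(1)]] by simp
qed

sublocale Aut: group \<Gamma>
proof -
  have "\<Gamma> = BijGroup E \<lparr>carrier := carrier \<Gamma>\<rparr>"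
    by (simp add: Aut_grp_def BijGroup_def)
  then show "group \<Gamma>"
    using subgroup.subgroup_is_group[OF subgroup_Aut group_BijGroup] by metis
qed

lemma Aut_mult_apply:
  "\<sigma> \<in> carrier \<Gamma> \<Longrightarrow> \<tau> \<in> carrier \<Gamma> \<Longrightarrow> x \<in> E \<Longrightarrow> (\<sigma> \<otimes>\<^bsub>\<Gamma>\<^esub> \<tau>) x = \<sigma> (\<tau> x)"
  by (auto simp: Aut_grp_def BijGroup_def compose_def)

lemma Aut_one_apply: "x \<in> E \<Longrightarrow> \<one>\<^bsub>\<Gamma>\<^esub> x = x"
  by (simp add: Aut_grp_def BijGroup_def)

lemma Aut_inv_apply:
  assumes "\<sigma> \<in> carrier \<Gamma>" "x \<in> E"
  shows "\<sigma> ((inv\<^bsub>\<Gamma>\<^esub> \<sigma>) x) = x" "(inv\<^bsub>\<Gamma>\<^esub> \<sigma>) (\<sigma> x) = x"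
  using Aut_mult_apply[of \<sigma> "inv\<^bsub>\<Gamma>\<^esub> \<sigma>" x] Aut_mult_apply[of "inv\<^bsub>\<Gamma>\<^esub> \<sigma>" \<sigma> x] assms
  by (simp_all add: Aut_one_apply)

lemma fixed_in_E:
  assumes "x \<in> univ M" "\<And>g. g \<in> fix_auts \<L> M E \<Longrightarrow> g x = x"
  shows "x \<in> E"
  using dcl_if_fixed[OF atomic homogeneous assms(1)] assms(2) dcl_closed by simp

text \<open>The graph of the multiplication is defined over \<open>A\<close>, hence invariant.\<close>
lemma fix_auts_hom:
  assumes g: "g \<in> fix_auts \<L> M A"
  shows "map g \<in> hom G G"
proof (rule homI)
  have AM: "A \<subseteq> univ M"
    using subsets by blast
  show closed: "map g x \<in> carrier G" if x: "x \<in> carrier G" for x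
  proof -
    have "definable \<L> M A n (carrier G)"
      using definable_group by (simp add: definable_group_def)
    from definable_invariant[OF struct g AM this] x carrier_G show ?thesis
      by blast
  qed
  fix x y assume x: "x \<in> carrier G" and y: "y \<in> carrier G"
  let ?D = "{x @ y @ (x \<otimes>\<^bsub>G\<^esub> y) | x y. x \<in> carrier G \<and> y \<in> carrier G}"
  have D: "definable \<L> M A (n + n + n) ?D"
    using definable_group by (simp add: definable_group_def)
  have len: "length z = n" "set z \<subseteq> univ M" if "z \<in> carrier G" for z
    using carrier_G that by (auto simp: tuples_def)
  have "x @ y @ (x \<otimes>\<^bsub>G\<^esub> y) \<in> tuples (univ M) (n + n + n)"
    using len x y G.m_closed[OF x y] by (simp add: tuples_def)
  moreover have "x @ y @ (x \<otimes>\<^bsub>G\<^esub> y) \<in> ?D"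
    using x y by blast
  ultimately have "map g (x @ y @ (x \<otimes>\<^bsub>G\<^esub> y)) \<in> ?D"
    using definable_invariant[OF struct g AM D] by blast
  then obtain x' y' where "map g (x @ y @ (x \<otimes>\<^bsub>G\<^esub> y)) = x' @ y' @ (x' \<otimes>\<^bsub>G\<^esub> y')"
    "x' \<in> carrier G" "y' \<in> carrier G"
    by blast
  then show "map g (x \<otimes>\<^bsub>G\<^esub> y) = map g x \<otimes>\<^bsub>G\<^esub> map g y"
    using len x y by simp
qed

lemma fix_auts_group_hom: "g \<in> fix_auts \<L> M A \<Longrightarrow> group_hom G G (map g)"
  using fix_auts_hom by (simp add: group_hom_def group_hom_axioms_def)

lemma points_carrier: "x \<in> points G E \<Longrightarrow> x \<in> carrier G"
  by (simp add: points_def)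

lemma points_set: "x \<in> points G E \<Longrightarrow> set x \<subseteq> E"
  by (simp add: points_def)

text \<open>The converse of the obvious fact that automorphisms over \<open>E\<close> fix the points over \<open>E\<close>.  It gives the
  closure of these points under the group operations without writing down formulas.\<close>
lemma points_if_fixed:
  assumes "x \<in> carrier G" "\<And>g. g \<in> fix_auts \<L> M E \<Longrightarrow> map g x = x"
  shows "x \<in> points G E"
proof -
  have "c \<in> E" if c: "c \<in> set x" for c
  proof (rule fixed_in_E)
    show "c \<in> univ M"
      using assms(1) carrier_G c by (auto simp: tuples_def)
    fix g assume "g \<in> fix_auts \<L> M E"
    from assms(2)[OF this] c show "g c = c"
      by (metis map_eq_conv map_ident)
  qed
  with assms(1) show ?thesis
    by (auto simp: points_def)
qed

sublocale points: subgroup "points G E" G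
proof (rule G.subgroupI)
  have A: "fix_auts \<L> M E \<subseteq> fix_auts \<L> M A"
    using subsets by (intro fix_auts_antimono) auto
  have fixed: "map g x = x" if "g \<in> fix_auts \<L> M E" "x \<in> points G E" for g x
    using that points_set by (auto intro: map_fix_auts_id)
  show "points G E \<subseteq> carrier G"
    by (auto simp: points_def)
  have "\<one>\<^bsub>G\<^esub> \<in> points G E"
    using A by (intro points_if_fixed) (auto intro: group_hom.hom_one[OF fix_auts_group_hom])
  then show "points G E \<noteq> {}"
    by blast
  show "inv\<^bsub>G\<^esub> x \<in> points G E" if x: "x \<in> points G E" for x
  proof (rule points_if_fixed)
    fix g assume g: "g \<in> fix_auts \<L> M E"
    then show "map g (inv\<^bsub>G\<^esub> x) = inv\<^bsub>G\<^esub> x"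
      using A group_hom.hom_inv[OF fix_auts_group_hom points_carrier[OF x]] fixed[OF g x] by auto
  qed (use x points_carrier in auto)
  show "x \<otimes>\<^bsub>G\<^esub> y \<in> points G E" if x: "x \<in> points G E" and y: "y \<in> points G E" for x y
  proof (rule points_if_fixed)
    fix g assume g: "g \<in> fix_auts \<L> M E"
    then show "map g (x \<otimes>\<^bsub>G\<^esub> y) = x \<otimes>\<^bsub>G\<^esub> y"
      using A group_hom.hom_mult[OF fix_auts_group_hom points_carrier[OF x] points_carrier[OF y]]
        fixed[OF g x] fixed[OF g y] by auto
  qed (use x y points_carrier in auto)
qed

lemma act_closed:
  assumes "\<sigma> \<in> carrier \<Gamma>" "x \<in> points G E"
  shows "map \<sigma> x \<in> points G E"
proof -
  obtain g where g: "g \<in> fix_auts \<L> M K" "\<sigma> = restrict g E"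
    using assms(1) by (rule Aut_lift)
  have "map \<sigma> x = map g x"
    using points_set[OF assms(2)] g by auto
  moreover have "map g x \<in> carrier G"
    using g fix_auts_antimono[OF subsets(1)] group_hom.hom_closed[OF fix_auts_group_hom points_carrier[OF assms(2)]]
    by blast
  moreover have "set (map \<sigma> x) \<subseteq> E"
    using Aut_closed[OF assms(1)] points_set[OF assms(2)] by auto
  ultimately show ?thesis
    unfolding points_def by (simp del: map_eq_conv)
qed

lemma act_mult:
  assumes "\<sigma> \<in> carrier \<Gamma>" "x \<in> points G E" "y \<in> points G E"
  shows "map \<sigma> (x \<otimes>\<^bsub>G\<^esub> y) = map \<sigma> x \<otimes>\<^bsub>G\<^esub> map \<sigma> y"
proof -
  obtain g where g: "g \<in> fix_auts \<L> M K" "\<sigma> = restrict g E"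
    using assms(1) by (rule Aut_lift)
  have "map \<sigma> z = map g z" if "z \<in> points G E" for z
    using points_set[OF that] g by auto
  moreover have "map g (x \<otimes>\<^bsub>G\<^esub> y) = map g x \<otimes>\<^bsub>G\<^esub> map g y"
    using g fix_auts_antimono[OF subsets(1)] group_hom.hom_mult[OF fix_auts_group_hom points_carrier[OF assms(2)] points_carrier[OF assms(3)]]
    by blast
  ultimately show ?thesis
    using assms(2,3) by (simp del: map_eq_conv)
qed

lemma act_one: "\<sigma> \<in> carrier \<Gamma> \<Longrightarrow> map \<sigma> \<one>\<^bsub>G\<^esub> = \<one>\<^bsub>G\<^esub>"
  using act_mult[of \<sigma> "\<one>\<^bsub>G\<^esub>" "\<one>\<^bsub>G\<^esub>"] act_closed[of \<sigma> "\<one>\<^bsub>G\<^esub>"] points_carrier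
  by (simp add: G.l_cancel_one')

lemma act_inv:
  assumes "\<sigma> \<in> carrier \<Gamma>" "x \<in> points G E"
  shows "map \<sigma> (inv\<^bsub>G\<^esub> x) = inv\<^bsub>G\<^esub> (map \<sigma> x)"
proof -
  have "map \<sigma> (inv\<^bsub>G\<^esub> x) \<otimes>\<^bsub>G\<^esub> map \<sigma> x = \<one>\<^bsub>G\<^esub>"
    using act_mult[of \<sigma> "inv\<^bsub>G\<^esub> x" x] assms act_one points_carrier by simp
  then show ?thesis
    using assms by (intro G.inv_equality[symmetric]) (auto simp: act_closed points_carrier)
qed

lemma act_comp:
  assumes "\<sigma> \<in> carrier \<Gamma>" "\<tau> \<in> carrier \<Gamma>" "set x \<subseteq> E"
  shows "map (\<sigma> \<otimes>\<^bsub>\<Gamma>\<^esub> \<tau>) x = map \<sigma> (map \<tau> x)"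
  using assms by (auto simp: Aut_mult_apply)

lemma act_id: "set x \<subseteq> E \<Longrightarrow> map \<one>\<^bsub>\<Gamma>\<^esub> x = x"
  by (rule map_idI) (auto simp: Aut_one_apply)

lemma act_cancel:
  assumes "\<sigma> \<in> carrier \<Gamma>" "set x \<subseteq> E"
  shows "map \<sigma> (map (inv\<^bsub>\<Gamma>\<^esub> \<sigma>) x) = x" "map (inv\<^bsub>\<Gamma>\<^esub> \<sigma>) (map \<sigma> x) = x"
  using assms by (auto simp: Aut_inv_apply subset_iff intro!: map_idI)

section \<open>Cocycles\<close>

abbreviation "Z \<equiv> Z1 \<L> M n G E K"
abbreviation "coh \<equiv> cohomologous \<L> M n G E K"

lemma cocycle_points: "\<phi> \<in> Z \<Longrightarrow> \<sigma> \<in> carrier \<Gamma> \<Longrightarrow> \<phi> \<sigma> \<in> points G E"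
  by (auto simp: Z1_def)

lemma cocycle_mult:
  "\<phi> \<in> Z \<Longrightarrow> \<sigma> \<in> carrier \<Gamma> \<Longrightarrow> \<tau> \<in> carrier \<Gamma> \<Longrightarrow> \<phi> (\<sigma> \<otimes>\<^bsub>\<Gamma>\<^esub> \<tau>) = \<phi> \<sigma> \<otimes>\<^bsub>G\<^esub> map \<sigma> (\<phi> \<tau>)"
  by (auto simp: Z1_def)

lemma cocycle_ext:
  "\<phi> \<in> Z \<Longrightarrow> \<psi> \<in> Z \<Longrightarrow> (\<And>\<sigma>. \<sigma> \<in> carrier \<Gamma> \<Longrightarrow> \<phi> \<sigma> = \<psi> \<sigma>) \<Longrightarrow> \<phi> = \<psi>"
  by (auto simp: Z1_def intro: PiE_ext)

lemma cocycle_one: "\<phi> \<in> Z \<Longrightarrow> \<phi> \<one>\<^bsub>\<Gamma>\<^esub> = \<one>\<^bsub>G\<^esub>"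
  using cocycle_mult[of \<phi> "\<one>\<^bsub>\<Gamma>\<^esub>" "\<one>\<^bsub>\<Gamma>\<^esub>"] cocycle_points[of \<phi> "\<one>\<^bsub>\<Gamma>\<^esub>"] points_carrier points_set
  by (simp add: act_id G.l_cancel_one')

lemma cocycle_inv:
  assumes "\<phi> \<in> Z" "\<sigma> \<in> carrier \<Gamma>"
  shows "map \<sigma> (\<phi> (inv\<^bsub>\<Gamma>\<^esub> \<sigma>)) = inv\<^bsub>G\<^esub> (\<phi> \<sigma>)"
proof -
  have "\<phi> \<sigma> \<otimes>\<^bsub>G\<^esub> map \<sigma> (\<phi> (inv\<^bsub>\<Gamma>\<^esub> \<sigma>)) = \<one>\<^bsub>G\<^esub>"
    using cocycle_mult[OF assms Aut.inv_closed[OF assms(2)]] assms by (simp add: cocycle_one)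
  moreover have "\<phi> \<sigma> \<in> carrier G" "map \<sigma> (\<phi> (inv\<^bsub>\<Gamma>\<^esub> \<sigma>)) \<in> carrier G"
    using assms by (simp_all add: act_closed cocycle_points points_carrier)
  ultimately show ?thesis
    by (metis G.inv_equality G.inv_comm)
qed

text \<open>The element \<open>\<phi>(\<sigma>)\<close> thus shows that the transform of \<open>\<phi>\<close> by \<open>\<sigma>\<close> is cohomologous to \<open>\<phi>\<close>, which gives
  both the action on classes and its fixed points.  For the proof, expand \<open>\<phi>\<close> along
  \<open>\<sigma>^-1 (\<tau> \<sigma>)\<close>.\<close>
lemma cocycle_conj:
  assumes "\<phi> \<in> Z" "\<sigma> \<in> carrier \<Gamma>" "\<tau> \<in> carrier \<Gamma>"
  shows "map \<sigma> (\<phi> (inv\<^bsub>\<Gamma>\<^esub> \<sigma> \<otimes>\<^bsub>\<Gamma>\<^esub> \<tau> \<otimes>\<^bsub>\<Gamma>\<^esub> \<sigma>)) = inv\<^bsub>G\<^esub> (\<phi> \<sigma>) \<otimes>\<^bsub>G\<^esub> \<phi> \<tau> \<otimes>\<^bsub>G\<^esub> map \<tau> (\<phi> \<sigma>)"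
proof -
  let ?i = "inv\<^bsub>\<Gamma>\<^esub> \<sigma>"
  have "\<phi> (?i \<otimes>\<^bsub>\<Gamma>\<^esub> \<tau> \<otimes>\<^bsub>\<Gamma>\<^esub> \<sigma>) = \<phi> ?i \<otimes>\<^bsub>G\<^esub> map ?i (\<phi> (\<tau> \<otimes>\<^bsub>\<Gamma>\<^esub> \<sigma>))"
    using assms by (simp add: Aut.m_assoc cocycle_mult)
  then have "map \<sigma> (\<phi> (?i \<otimes>\<^bsub>\<Gamma>\<^esub> \<tau> \<otimes>\<^bsub>\<Gamma>\<^esub> \<sigma>)) = map \<sigma> (\<phi> ?i) \<otimes>\<^bsub>G\<^esub> map \<sigma> (map ?i (\<phi> (\<tau> \<otimes>\<^bsub>\<Gamma>\<^esub> \<sigma>)))"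
    using act_mult[OF assms(2) cocycle_points[OF assms(1) Aut.inv_closed[OF assms(2)]]
        act_closed[OF Aut.inv_closed[OF assms(2)] cocycle_points[OF assms(1) Aut.m_closed[OF assms(3,2)]]]]
    by (simp only:)
  also have "\<dots> = inv\<^bsub>G\<^esub> (\<phi> \<sigma>) \<otimes>\<^bsub>G\<^esub> \<phi> (\<tau> \<otimes>\<^bsub>\<Gamma>\<^esub> \<sigma>)"
    using assms cocycle_points[THEN points_set] by (simp only: cocycle_inv act_cancel Aut.m_closed)
  also have "\<dots> = inv\<^bsub>G\<^esub> (\<phi> \<sigma>) \<otimes>\<^bsub>G\<^esub> (\<phi> \<tau> \<otimes>\<^bsub>G\<^esub> map \<tau> (\<phi> \<sigma>))"
    using assms by (simp only: cocycle_mult)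
  also have "\<dots> = inv\<^bsub>G\<^esub> (\<phi> \<sigma>) \<otimes>\<^bsub>G\<^esub> \<phi> \<tau> \<otimes>\<^bsub>G\<^esub> map \<tau> (\<phi> \<sigma>)"
    using assms by (simp add: G.m_assoc cocycle_points act_closed points_carrier)
  finally show ?thesis .
qed

lemma coh_equiv: "equiv Z coh"
proof (rule equivI)
  show "coh \<subseteq> Z \<times> Z"
    by (auto simp: cohomologous_def)
  show "refl_on Z coh"
  proof (rule refl_onI)
    fix \<phi> assume "\<phi> \<in> Z"
    then show "(\<phi>, \<phi>) \<in> coh"
      unfolding cohomologous_def using cocycle_points points_carrier act_one
      by (auto intro!: bexI[of _ "\<one>\<^bsub>G\<^esub>"])
  qed
  show "sym coh"
  proof (rule symI)
    fix \<phi> \<psi> assume "(\<phi>, \<psi>) \<in> coh"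
    then obtain b where b: "\<phi> \<in> Z" "\<psi> \<in> Z" "b \<in> points G E"
      and eq: "\<And>\<sigma>. \<sigma> \<in> carrier \<Gamma> \<Longrightarrow> \<phi> \<sigma> = inv\<^bsub>G\<^esub> b \<otimes>\<^bsub>G\<^esub> \<psi> \<sigma> \<otimes>\<^bsub>G\<^esub> map \<sigma> b"
      by (auto simp: cohomologous_def)
    have "\<psi> \<sigma> = inv\<^bsub>G\<^esub> (inv\<^bsub>G\<^esub> b) \<otimes>\<^bsub>G\<^esub> \<phi> \<sigma> \<otimes>\<^bsub>G\<^esub> map \<sigma> (inv\<^bsub>G\<^esub> b)" if "\<sigma> \<in> carrier \<Gamma>" for \<sigma>
    proof -
      have c: "b \<in> carrier G" "\<psi> \<sigma> \<in> carrier G" "map \<sigma> b \<in> carrier G"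
        using that b act_closed cocycle_points points_carrier by auto
      show ?thesis
        unfolding eq[OF that] act_inv[OF that b(3)] using c
        by (simp add: G.m_assoc) (simp add: G.m_assoc[symmetric])
    qed
    then show "(\<psi>, \<phi>) \<in> coh"
      unfolding cohomologous_def using b by blast
  qed
  show "trans coh"
  proof (rule transI)
    fix \<phi> \<psi> \<chi> assume "(\<phi>, \<psi>) \<in> coh" "(\<psi>, \<chi>) \<in> coh"
    then obtain b c where b: "\<phi> \<in> Z" "\<psi> \<in> Z" "\<chi> \<in> Z" "b \<in> points G E" "c \<in> points G E"
      and eq: "\<And>\<sigma>. \<sigma> \<in> carrier \<Gamma> \<Longrightarrow> \<phi> \<sigma> = inv\<^bsub>G\<^esub> b \<otimes>\<^bsub>G\<^esub> \<psi> \<sigma> \<otimes>\<^bsub>G\<^esub> map \<sigma> b"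
      and eq': "\<And>\<sigma>. \<sigma> \<in> carrier \<Gamma> \<Longrightarrow> \<psi> \<sigma> = inv\<^bsub>G\<^esub> c \<otimes>\<^bsub>G\<^esub> \<chi> \<sigma> \<otimes>\<^bsub>G\<^esub> map \<sigma> c"
      by (auto simp: cohomologous_def)
    have "\<phi> \<sigma> = inv\<^bsub>G\<^esub> (c \<otimes>\<^bsub>G\<^esub> b) \<otimes>\<^bsub>G\<^esub> \<chi> \<sigma> \<otimes>\<^bsub>G\<^esub> map \<sigma> (c \<otimes>\<^bsub>G\<^esub> b)" if "\<sigma> \<in> carrier \<Gamma>" for \<sigma>
    proof -
      have "b \<in> carrier G" "c \<in> carrier G" "\<chi> \<sigma> \<in> carrier G" "map \<sigma> b \<in> carrier G" "map \<sigma> c \<in> carrier G"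
        using that b act_closed cocycle_points points_carrier by auto
      then show ?thesis
        unfolding eq[OF that] eq'[OF that] act_mult[OF that b(5,4)]
        by (simp add: G.m_assoc G.inv_mult_group)
    qed
    then show "(\<phi>, \<chi>) \<in> coh"
      unfolding cohomologous_def using b by blast
  qed
qed

lemma definable_graph_mult:
  "definable_rel \<L> M A [n, n, n] (\<lambda>bs. bs ! 0 \<in> carrier G \<and> bs ! 1 \<in> carrier G \<and> bs ! 2 = bs ! 0 \<otimes>\<^bsub>G\<^esub> bs ! 1)"
proof (rule definable_rel_cong)
  let ?D = "{x @ y @ (x \<otimes>\<^bsub>G\<^esub> y) | x y. x \<in> carrier G \<and> y \<in> carrier G}"
  show "definable_rel \<L> M A [n, n, n] (\<lambda>bs. concat bs \<in> ?D)"
    using definable_group by (intro definable_rel_of_set) (simp add: definable_group_def add.assoc)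
  fix bs assume "bs \<in> blocks (univ M) [n, n, n]"
  then obtain x y z where bs: "bs = [x, y, z]" and len: "length x = n" "length y = n"
    by (auto simp: blocks_Cons tuples_def)
  have lenG: "length z = n" if "z \<in> carrier G" for z
    using carrier_G that by (auto simp: tuples_def)
  have "x @ y @ z \<in> ?D \<longleftrightarrow> x \<in> carrier G \<and> y \<in> carrier G \<and> z = x \<otimes>\<^bsub>G\<^esub> y"
  proof
    assume "x @ y @ z \<in> ?D"
    then obtain x' y' where "x @ y @ z = x' @ y' @ (x' \<otimes>\<^bsub>G\<^esub> y')" "x' \<in> carrier G" "y' \<in> carrier G"
      by blast
    then show "x \<in> carrier G \<and> y \<in> carrier G \<and> z = x \<otimes>\<^bsub>G\<^esub> y"
      using len lenG by simp
  qed blast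
  then show "concat bs \<in> ?D \<longleftrightarrow> bs ! 0 \<in> carrier G \<and> bs ! 1 \<in> carrier G \<and> bs ! 2 = bs ! 0 \<otimes>\<^bsub>G\<^esub> bs ! 1"
    by (simp add: bs numeral_2_eq_2)
qed

text \<open>The identity is definable over \<open>A\<close> as the only \<open>z\<close> with \<open>z z = z\<close>; the constant cocycle is then
  given by a definable function of the empty tuple.\<close>
lemma trivial_cocycle_Z: "trivial_cocycle \<L> M G E K \<in> Z"
proof -
  have "definable_rel \<L> M A [n] (\<lambda>bs. (\<lambda>bs. bs ! 0 \<in> carrier G \<and> bs ! 1 \<in> carrier G \<and> bs ! 2 = bs ! 0 \<otimes>\<^bsub>G\<^esub> bs ! 1)
      (map ((!) bs) [0, 0, 0]))"
    by (rule definable_rel_reindex) (use definable_graph_mult in simp_all)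
  then have "definable_rel \<L> M A [n] (\<lambda>bs. bs ! 0 = \<one>\<^bsub>G\<^esub>)"
    by (rule definable_rel_cong) (auto simp: G.l_cancel_one' numeral_2_eq_2)
  then have "definable_rel \<L> M K [n] (\<lambda>bs. bs ! 0 = \<one>\<^bsub>G\<^esub>)"
    using subsets(1) by (rule definable_rel_mono)
  from definable_of_rel[OF this]
  have "definable \<L> M K n (concat ` {bs \<in> blocks (univ M) [n]. bs ! 0 = \<one>\<^bsub>G\<^esub>})"
    by simp
  also have "concat ` {bs \<in> blocks (univ M) [n]. bs ! 0 = \<one>\<^bsub>G\<^esub>} = {\<one>\<^bsub>G\<^esub>}"
  proof -
    have "\<one>\<^bsub>G\<^esub> \<in> tuples (univ M) n"
      using carrier_G by auto
    then have "{bs \<in> blocks (univ M) [n]. bs ! 0 = \<one>\<^bsub>G\<^esub>} = {[\<one>\<^bsub>G\<^esub>]}"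
      by (auto simp: blocks_Cons)
    then show ?thesis
      by simp
  qed
  finally have "definable_fun \<L> M K 0 n {[]} (\<lambda>_. \<one>\<^bsub>G\<^esub>)"
    using carrier_G by (auto simp: definable_fun_def tuples_def subset_iff)
  then show ?thesis
    unfolding Z1_def trivial_cocycle_def
    by (auto simp: act_one intro!: exI[of _ "{[]}"] exI[of _ "\<lambda>_. \<one>\<^bsub>G\<^esub>"] exI[of _ "[]"])
qed

end

lemma on_classes_eq:
  assumes "equiv Z r" "equiv (Z1 \<L> M n G E K) (cohomologous \<L> M n G E K)"
    and "\<And>\<phi> \<psi>. (\<phi>, \<psi>) \<in> r \<Longrightarrow> (F \<phi>, F \<psi>) \<in> cohomologous \<L> M n G E K" and "\<phi> \<in> Z"
  shows "on_classes \<L> M n G E K F (r `` {\<phi>}) = cohomologous \<L> M n G E K `` {F \<phi>}"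
  unfolding on_classes_def
  using assms(1) _ assms(4) by (rule UN_equiv_class) (auto intro!: congruentI equiv_class_eq[OF assms(2)] assms(3))

section \<open>Towers of extensions\<close>

locale galois_tower =
  fixes \<L> :: "('f, 'p) lang" and M :: "('f, 'p, 'a) struct"
    and n :: nat and G :: "'a list monoid" and A B C :: "'a set"
  assumes struct: "is_struct \<L> M"
    and ABC: "A \<subseteq> B" "B \<subseteq> C" "C \<subseteq> univ M"
    and group: "definable_group \<L> M A n G"
    and B: "normal_extension \<L> M A B" "B = dcl \<L> M B" "perms_extend \<L> M B A"
      "atomic_over \<L> M B" "strongly_omega_homogeneous_over \<L> M B"
    and C: "normal_extension \<L> M A C" "C = dcl \<L> M C" "perms_extend \<L> M C A"
      "atomic_over \<L> M C" "strongly_omega_homogeneous_over \<L> M C"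
begin

sublocale BA: galois_extension \<L> M n G A A B
  using struct ABC group B by unfold_locales auto

sublocale CA: galois_extension \<L> M n G A A C
  using struct ABC group C by unfold_locales auto

sublocale CB: galois_extension \<L> M n G A B C
  using struct ABC group C by unfold_locales auto

abbreviation "\<pi> \<sigma> \<equiv> restrict \<sigma> B"

lemma CB_mult: "\<sigma> \<otimes>\<^bsub>CB.\<Gamma>\<^esub> \<tau> = \<sigma> \<otimes>\<^bsub>CA.\<Gamma>\<^esub> \<tau>"
  by (simp add: Aut_grp_def)

lemma CB_one: "\<one>\<^bsub>CB.\<Gamma>\<^esub> = \<one>\<^bsub>CA.\<Gamma>\<^esub>"
  by (simp add: Aut_grp_def)

lemma CB_iff: "\<tau> \<in> carrier CB.\<Gamma> \<longleftrightarrow> \<tau> \<in> carrier CA.\<Gamma> \<and> (\<forall>x\<in>B. \<tau> x = x)"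
  using ABC by (auto simp: Aut_grp_def)

lemma CB_CA: "\<tau> \<in> carrier CB.\<Gamma> \<Longrightarrow> \<tau> \<in> carrier CA.\<Gamma>"
  by (simp add: CB_iff)

lemma CB_inv: "\<tau> \<in> carrier CB.\<Gamma> \<Longrightarrow> inv\<^bsub>CB.\<Gamma>\<^esub> \<tau> = inv\<^bsub>CA.\<Gamma>\<^esub> \<tau>"
  using CA.Aut.inv_equality[of "inv\<^bsub>CB.\<Gamma>\<^esub> \<tau>" \<tau>] CB.Aut.l_inv[of \<tau>] CB_CA CB.Aut.inv_closed[of \<tau>]
  by (simp add: CB_mult CB_one)

lemma restr_closed: "\<sigma> \<in> carrier CA.\<Gamma> \<Longrightarrow> \<pi> \<sigma> \<in> carrier BA.\<Gamma>"
proof -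
  assume "\<sigma> \<in> carrier CA.\<Gamma>"
  then obtain g where g: "g \<in> fix_auts \<L> M A" "\<sigma> = restrict g C"
    by (rule CA.Aut_lift)
  then have "\<pi> \<sigma> = restrict g B"
    using ABC by (simp add: Int_absorb1)
  then show ?thesis
    using BA.restrict_in_Aut[OF g(1)] by simp
qed

lemma restr_mult:
  assumes "\<sigma> \<in> carrier CA.\<Gamma>" "\<tau> \<in> carrier CA.\<Gamma>"
  shows "\<pi> (\<sigma> \<otimes>\<^bsub>CA.\<Gamma>\<^esub> \<tau>) = \<pi> \<sigma> \<otimes>\<^bsub>BA.\<Gamma>\<^esub> \<pi> \<tau>"
proof (rule BA.Aut_ext)
  fix x assume x: "x \<in> B"
  moreover have "\<tau> x \<in> B"
    using BA.Aut_closed[OF restr_closed[OF assms(2)] x] x by simp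
  ultimately show "\<pi> (\<sigma> \<otimes>\<^bsub>CA.\<Gamma>\<^esub> \<tau>) x = (\<pi> \<sigma> \<otimes>\<^bsub>BA.\<Gamma>\<^esub> \<pi> \<tau>) x"
    using assms ABC by (simp add: BA.Aut_mult_apply restr_closed CA.Aut_mult_apply subset_iff)
qed (use assms restr_closed in auto)

lemma restr_surj:
  assumes "\<rho> \<in> carrier BA.\<Gamma>"
  obtains \<sigma> where "\<sigma> \<in> carrier CA.\<Gamma>" "\<rho> = \<pi> \<sigma>"
proof -
  obtain g where g: "g \<in> fix_auts \<L> M A" "\<rho> = restrict g B"
    using assms by (rule BA.Aut_lift)
  moreover have "\<pi> (restrict g C) = restrict g B"
    using ABC by (simp add: Int_absorb1)
  ultimately show thesis
    using CA.restrict_in_Aut[OF g(1)] that[of "restrict g C"] by simp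
qed

lemma restr_group_hom: "group_hom CA.\<Gamma> BA.\<Gamma> \<pi>"
  unfolding group_hom_def group_hom_axioms_def
  using restr_closed restr_mult CA.Aut.group_axioms BA.Aut.group_axioms by (auto intro!: homI)

lemma restr_eq_one: "\<sigma> \<in> carrier CA.\<Gamma> \<Longrightarrow> \<pi> \<sigma> = \<one>\<^bsub>BA.\<Gamma>\<^esub> \<longleftrightarrow> \<sigma> \<in> carrier CB.\<Gamma>"
proof
  assume \<sigma>: "\<sigma> \<in> carrier CA.\<Gamma>" and eq: "\<pi> \<sigma> = \<one>\<^bsub>BA.\<Gamma>\<^esub>"
  have "\<sigma> x = x" if "x \<in> B" for x
    using BA.Aut_one_apply[OF that] that unfolding eq[symmetric] by simp
  with \<sigma> show "\<sigma> \<in> carrier CB.\<Gamma>"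
    by (simp add: CB_iff)
next
  assume "\<sigma> \<in> carrier CA.\<Gamma>" "\<sigma> \<in> carrier CB.\<Gamma>"
  then show "\<pi> \<sigma> = \<one>\<^bsub>BA.\<Gamma>\<^esub>"
    by (intro BA.Aut_ext restr_closed BA.Aut.one_closed) (simp_all add: CB_iff BA.Aut_one_apply)
qed

text \<open>Whatever is insensitive to \<open>Aut(C/B)\<close> on the right does not depend on the choice of a lift.\<close>
lemma restr_eqE:
  assumes "\<sigma> \<in> carrier CA.\<Gamma>" "\<sigma>' \<in> carrier CA.\<Gamma>" "\<pi> \<sigma> = \<pi> \<sigma>'"
  obtains \<kappa> where "\<kappa> \<in> carrier CB.\<Gamma>" "\<sigma>' = \<sigma> \<otimes>\<^bsub>CA.\<Gamma>\<^esub> \<kappa>"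
proof -
  interpret group_hom CA.\<Gamma> BA.\<Gamma> \<pi>
    by (rule restr_group_hom)
  let ?\<kappa> = "inv\<^bsub>CA.\<Gamma>\<^esub> \<sigma> \<otimes>\<^bsub>CA.\<Gamma>\<^esub> \<sigma>'"
  have "\<pi> ?\<kappa> = \<one>\<^bsub>BA.\<Gamma>\<^esub>"
    using assms(1,2) restr_closed[OF assms(2)] by (simp add: restr_mult hom_inv assms(3) del: restrict_apply)
  then have "?\<kappa> \<in> carrier CB.\<Gamma>"
    using restr_eq_one[of ?\<kappa>] assms(1,2) by simp
  moreover have "\<sigma>' = \<sigma> \<otimes>\<^bsub>CA.\<Gamma>\<^esub> ?\<kappa>"
    using assms(1,2) by (simp add: CA.Aut.m_assoc[symmetric])
  ultimately show thesis
    by (rule that)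
qed

lemma exact_Aut: "short_exact_sequence BA.\<Gamma> CA.\<Gamma> CB.\<Gamma> \<pi> (\<lambda>\<sigma>. \<sigma>)"
proof -
  interpret group_hom CA.\<Gamma> BA.\<Gamma> \<pi>
    by (rule restr_group_hom)
  have "group_hom CB.\<Gamma> CA.\<Gamma> (\<lambda>\<sigma>. \<sigma>)"
    unfolding group_hom_def group_hom_axioms_def
    using CB_CA CB_mult CA.Aut.group_axioms CB.Aut.group_axioms by (auto intro!: homI)
  moreover have "kernel CA.\<Gamma> BA.\<Gamma> \<pi> = (\<lambda>\<sigma>. \<sigma>) ` carrier CB.\<Gamma>"
    using restr_eq_one CB_CA by (auto simp: kernel_def)
  moreover have "\<pi> ` carrier CA.\<Gamma> = carrier BA.\<Gamma>"
    using restr_closed by (blast elim: restr_surj)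
  ultimately show ?thesis
    unfolding short_exact_sequence_iff
    using homh BA.Aut.group_axioms
    by (simp add: epi_def mon_def group_hom_def group_hom_axioms_def)
qed

lemma conj_CB:
  assumes "\<sigma> \<in> carrier CA.\<Gamma>" "\<tau> \<in> carrier CB.\<Gamma>"
  shows "inv\<^bsub>CA.\<Gamma>\<^esub> \<sigma> \<otimes>\<^bsub>CA.\<Gamma>\<^esub> \<tau> \<otimes>\<^bsub>CA.\<Gamma>\<^esub> \<sigma> \<in> carrier CB.\<Gamma>"
proof -
  interpret group_hom CA.\<Gamma> BA.\<Gamma> \<pi>
    by (rule restr_group_hom)
  have "\<pi> \<tau> = \<one>\<^bsub>BA.\<Gamma>\<^esub>"
    using restr_eq_one assms CB_CA by blast
  then have "\<pi> (inv\<^bsub>CA.\<Gamma>\<^esub> \<sigma> \<otimes>\<^bsub>CA.\<Gamma>\<^esub> \<tau> \<otimes>\<^bsub>CA.\<Gamma>\<^esub> \<sigma>) = \<one>\<^bsub>BA.\<Gamma>\<^esub>"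
    using assms(1) CB_CA[OF assms(2)] restr_closed[OF assms(1)]
    by (simp add: restr_mult hom_inv del: restrict_apply)
  then show ?thesis
    using restr_eq_one[of "inv\<^bsub>CA.\<Gamma>\<^esub> \<sigma> \<otimes>\<^bsub>CA.\<Gamma>\<^esub> \<tau> \<otimes>\<^bsub>CA.\<Gamma>\<^esub> \<sigma>"] assms(1) CB_CA[OF assms(2)] by simp
qed

lemma points_mono: "x \<in> points G B \<Longrightarrow> x \<in> points G C"
  using ABC unfolding points_def by blast

lemma map_restr: "set x \<subseteq> B \<Longrightarrow> map (\<pi> \<sigma>) x = map \<sigma> x"
  by auto

text \<open>Automorphisms of \<open>M\<close> over \<open>B\<close> restrict to elements of \<open>Aut(C/B)\<close>, so they fix \<open>x\<close>, and the Galois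
  correspondence over \<open>B\<close> applies.\<close>
lemma points_descend:
  assumes "x \<in> points G C" "\<And>\<tau>. \<tau> \<in> carrier CB.\<Gamma> \<Longrightarrow> map \<tau> x = x"
  shows "x \<in> points G B"
proof (rule BA.points_if_fixed)
  fix g assume "g \<in> fix_auts \<L> M B"
  from assms(2)[OF CB.restrict_in_Aut[OF this]] have "map (restrict g C) x = x" .
  moreover have "map (restrict g C) x = map g x"
    using CB.points_set[OF assms(1)] by auto
  ultimately show "map g x = x"
    by simp
qed (rule CB.points_carrier[OF assms(1)])

text \<open>In the language of group cohomology these are inflation, restriction and the transform by an
  element of \<open>Aut(C/A)\<close>.\<close>
abbreviation "infl \<equiv> precomp_restr \<L> M A B C"
abbreviation "res \<equiv> precomp_incl \<L> M B C"
abbreviation "tr \<equiv> transform \<L> M A B C"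

lemma infl_apply: "\<sigma> \<in> carrier CA.\<Gamma> \<Longrightarrow> infl \<phi> \<sigma> = \<phi> (\<pi> \<sigma>)"
  by (simp add: precomp_restr_def compose_def)

lemma res_apply: "\<tau> \<in> carrier CB.\<Gamma> \<Longrightarrow> res \<phi> \<tau> = \<phi> \<tau>"
  by (simp add: precomp_incl_def compose_def)

lemma infl_Z: "\<phi> \<in> BA.Z \<Longrightarrow> infl \<phi> \<in> CA.Z"
proof -
  assume \<phi>: "\<phi> \<in> BA.Z"
  obtain D h a where h: "set a \<subseteq> B" "definable_fun \<L> M A (length a + length a) n D h"
    "\<And>\<rho>. \<rho> \<in> carrier BA.\<Gamma> \<Longrightarrow> a @ map \<rho> a \<in> D \<and> \<phi> \<rho> = h (a @ map \<rho> a)"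
    using \<phi> unfolding Z1_def by blast
  have "infl \<phi> \<in> carrier CA.\<Gamma> \<rightarrow>\<^sub>E points G C"
    using \<phi> restr_closed points_mono BA.cocycle_points
    by (auto simp: precomp_restr_def compose_def)
  moreover have "infl \<phi> (\<sigma> \<otimes>\<^bsub>CA.\<Gamma>\<^esub> \<tau>) = infl \<phi> \<sigma> \<otimes>\<^bsub>G\<^esub> map \<sigma> (infl \<phi> \<tau>)"
    if "\<sigma> \<in> carrier CA.\<Gamma>" "\<tau> \<in> carrier CA.\<Gamma>" for \<sigma> \<tau>
  proof -
    have "infl \<phi> (\<sigma> \<otimes>\<^bsub>CA.\<Gamma>\<^esub> \<tau>) = \<phi> (\<pi> \<sigma>) \<otimes>\<^bsub>G\<^esub> map (\<pi> \<sigma>) (\<phi> (\<pi> \<tau>))"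
      using that \<phi> restr_closed by (simp only: infl_apply CA.Aut.m_closed restr_mult BA.cocycle_mult)
    also have "map (\<pi> \<sigma>) (\<phi> (\<pi> \<tau>)) = map \<sigma> (\<phi> (\<pi> \<tau>))"
      using BA.cocycle_points[OF \<phi> restr_closed[OF that(2)]] by (intro map_restr BA.points_set)
    finally show ?thesis
      using that by (simp only: infl_apply)
  qed
  moreover have "a @ map \<sigma> a \<in> D \<and> infl \<phi> \<sigma> = h (a @ map \<sigma> a)" if "\<sigma> \<in> carrier CA.\<Gamma>" for \<sigma>
    using h(3)[OF restr_closed[OF that]] that by (simp only: infl_apply map_restr[OF h(1)])
  moreover have "set a \<subseteq> C"
    using h ABC by blast
  ultimately show ?thesis
    unfolding Z1_def using h(2) by blast
qed

lemma res_Z: "\<phi> \<in> CA.Z \<Longrightarrow> res \<phi> \<in> CB.Z"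
proof -
  assume \<phi>: "\<phi> \<in> CA.Z"
  obtain D h a where h: "set a \<subseteq> C" "definable_fun \<L> M A (length a + length a) n D h"
    "\<And>\<rho>. \<rho> \<in> carrier CA.\<Gamma> \<Longrightarrow> a @ map \<rho> a \<in> D \<and> \<phi> \<rho> = h (a @ map \<rho> a)"
    using \<phi> unfolding Z1_def by blast
  have "res \<phi> \<in> carrier CB.\<Gamma> \<rightarrow>\<^sub>E points G C"
    using \<phi> CB_CA CA.cocycle_points by (auto simp: precomp_incl_def compose_def)
  moreover have "res \<phi> (\<sigma> \<otimes>\<^bsub>CB.\<Gamma>\<^esub> \<tau>) = res \<phi> \<sigma> \<otimes>\<^bsub>G\<^esub> map \<sigma> (res \<phi> \<tau>)"
    if "\<sigma> \<in> carrier CB.\<Gamma>" "\<tau> \<in> carrier CB.\<Gamma>" for \<sigma> \<tau>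
    using CA.cocycle_mult[OF \<phi> CB_CA CB_CA, OF that] CB.Aut.m_closed[OF that] that
    by (simp add: res_apply CB_mult)
  moreover have "a @ map \<sigma> a \<in> D \<and> res \<phi> \<sigma> = h (a @ map \<sigma> a)" if "\<sigma> \<in> carrier CB.\<Gamma>" for \<sigma>
    using h(3)[OF CB_CA[OF that]] that by (simp add: res_apply)
  moreover have "definable_fun \<L> M B (length a + length a) n D h"
    using h(2) ABC(1) definable_mono unfolding definable_fun_def by blast
  ultimately show ?thesis
    unfolding Z1_def using h(1) by blast
qed

lemma tr_apply:
  "\<tau> \<in> carrier CB.\<Gamma> \<Longrightarrow> tr \<sigma> \<phi> \<tau> = map \<sigma> (\<phi> (inv\<^bsub>CA.\<Gamma>\<^esub> \<sigma> \<otimes>\<^bsub>CA.\<Gamma>\<^esub> \<tau> \<otimes>\<^bsub>CA.\<Gamma>\<^esub> \<sigma>))"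
  by (simp add: transform_def)

lemma conj_act:
  assumes "\<sigma> \<in> carrier CA.\<Gamma>" "\<tau> \<in> carrier CA.\<Gamma>" "set x \<subseteq> C"
  shows "map \<sigma> (map (inv\<^bsub>CA.\<Gamma>\<^esub> \<sigma> \<otimes>\<^bsub>CA.\<Gamma>\<^esub> \<tau> \<otimes>\<^bsub>CA.\<Gamma>\<^esub> \<sigma>) x) = map \<tau> (map \<sigma> x)"
proof -
  have "\<sigma> \<otimes>\<^bsub>CA.\<Gamma>\<^esub> (inv\<^bsub>CA.\<Gamma>\<^esub> \<sigma> \<otimes>\<^bsub>CA.\<Gamma>\<^esub> \<tau> \<otimes>\<^bsub>CA.\<Gamma>\<^esub> \<sigma>) = \<tau> \<otimes>\<^bsub>CA.\<Gamma>\<^esub> \<sigma>"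
    using assms by (simp add: CA.Aut.m_assoc[symmetric])
  with CA.act_comp[of \<sigma> "inv\<^bsub>CA.\<Gamma>\<^esub> \<sigma> \<otimes>\<^bsub>CA.\<Gamma>\<^esub> \<tau> \<otimes>\<^bsub>CA.\<Gamma>\<^esub> \<sigma>" x] CA.act_comp[of \<tau> \<sigma> x] assms
  show ?thesis
    by (simp del: map_map map_eq_conv)
qed

text \<open>If \<open>\<phi>\<close> is given by \<open>h\<close> and \<open>a\<close>, its transform is given by the image of \<open>h\<close> under an automorphism of
  \<open>M\<close> extending \<open>\<sigma>\<close> and by the tuple \<open>\<sigma>(a)\<close>; the image is again defined over \<open>B\<close> since \<open>\<sigma>(B) = B\<close>.\<close>
lemma tr_Z:
  assumes \<sigma>: "\<sigma> \<in> carrier CA.\<Gamma>" and \<phi>: "\<phi> \<in> CB.Z"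
  shows "tr \<sigma> \<phi> \<in> CB.Z"
proof -
  let ?c = "\<lambda>\<tau>. inv\<^bsub>CA.\<Gamma>\<^esub> \<sigma> \<otimes>\<^bsub>CA.\<Gamma>\<^esub> \<tau> \<otimes>\<^bsub>CA.\<Gamma>\<^esub> \<sigma>"
  obtain D h a where a: "set a \<subseteq> C" and D: "definable_fun \<L> M B (length a + length a) n D h"
    and h: "\<And>\<tau>. \<tau> \<in> carrier CB.\<Gamma> \<Longrightarrow> a @ map \<tau> a \<in> D \<and> \<phi> \<tau> = h (a @ map \<tau> a)"
    using \<phi> unfolding Z1_def by blast
  obtain g where g: "g \<in> fix_auts \<L> M A" "\<sigma> = restrict g C"
    using \<sigma> by (rule CA.Aut_lift)
  have bij: "bij_betw g (univ M) (univ M)"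
    by (rule fix_auts_bij[OF g(1)])
  have map_g: "map \<sigma> x = map g x" if "set x \<subseteq> C" for x
    using that g by auto
  have inv_g: "map (inv_into (univ M) g) (map g x) = x" if "set x \<subseteq> univ M" for x
    using that bij_betw_inv_into_left[OF bij] by (auto simp: subset_iff intro!: map_idI)
  have D_univ: "set xs \<subseteq> univ M" "length xs = length a + length a" if "xs \<in> D" for xs
    using D that by (auto simp: definable_fun_def tuples_def)
  have "tr \<sigma> \<phi> \<in> carrier CB.\<Gamma> \<rightarrow>\<^sub>E points G C"
  proof (rule PiE_I)
    fix \<tau> assume \<tau>: "\<tau> \<in> carrier CB.\<Gamma>"
    then show "tr \<sigma> \<phi> \<tau> \<in> points G C"
      using CA.act_closed[OF \<sigma> CB.cocycle_points[OF \<phi> conj_CB[OF \<sigma> \<tau>]]] by (simp only: tr_apply)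
  qed (simp add: transform_def)
  moreover have "tr \<sigma> \<phi> (\<tau> \<otimes>\<^bsub>CB.\<Gamma>\<^esub> \<tau>') = tr \<sigma> \<phi> \<tau> \<otimes>\<^bsub>G\<^esub> map \<tau> (tr \<sigma> \<phi> \<tau>')"
    if \<tau>: "\<tau> \<in> carrier CB.\<Gamma>" "\<tau>' \<in> carrier CB.\<Gamma>" for \<tau> \<tau>'
  proof -
    note c = conj_CB[OF \<sigma> \<tau>(1)] conj_CB[OF \<sigma> \<tau>(2)]
    have \<tau>A: "\<tau> \<in> carrier CA.\<Gamma>" "\<tau>' \<in> carrier CA.\<Gamma>"
      using \<tau> CB_CA by auto
    have "?c (\<tau> \<otimes>\<^bsub>CB.\<Gamma>\<^esub> \<tau>') = ?c \<tau> \<otimes>\<^bsub>CB.\<Gamma>\<^esub> ?c \<tau>'"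
    proof -
      have "\<sigma> \<otimes>\<^bsub>CA.\<Gamma>\<^esub> (inv\<^bsub>CA.\<Gamma>\<^esub> \<sigma> \<otimes>\<^bsub>CA.\<Gamma>\<^esub> (\<tau>' \<otimes>\<^bsub>CA.\<Gamma>\<^esub> \<sigma>)) = \<tau>' \<otimes>\<^bsub>CA.\<Gamma>\<^esub> \<sigma>"
        using \<sigma> \<tau>A by (simp add: CA.Aut.m_assoc[symmetric])
      then show ?thesis
        using \<sigma> \<tau>A by (simp add: CB_mult CA.Aut.m_assoc)
    qed
    then have "tr \<sigma> \<phi> (\<tau> \<otimes>\<^bsub>CB.\<Gamma>\<^esub> \<tau>') = map \<sigma> (\<phi> (?c \<tau>) \<otimes>\<^bsub>G\<^esub> map (?c \<tau>) (\<phi> (?c \<tau>')))"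
      using \<tau> c \<phi> by (simp only: tr_apply CB.Aut.m_closed CB.cocycle_mult)
    also have "\<dots> = map \<sigma> (\<phi> (?c \<tau>)) \<otimes>\<^bsub>G\<^esub> map \<sigma> (map (?c \<tau>) (\<phi> (?c \<tau>')))"
      using c \<phi> CB.cocycle_points CB.act_closed by (intro CA.act_mult[OF \<sigma>]) auto
    also have "map \<sigma> (map (?c \<tau>) (\<phi> (?c \<tau>'))) = map \<tau> (map \<sigma> (\<phi> (?c \<tau>')))"
      using CB.cocycle_points[OF \<phi> c(2)] by (intro conj_act[OF \<sigma> \<tau>A(1)] CB.points_set)
    finally show ?thesis
      using \<tau> by (simp only: tr_apply)
  qed
  moreover have "\<exists>D' h' a'. set a' \<subseteq> C \<and> definable_fun \<L> M B (length a' + length a') n D' h' \<and>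
    (\<forall>\<tau>\<in>carrier CB.\<Gamma>. a' @ map \<tau> a' \<in> D' \<and> tr \<sigma> \<phi> \<tau> = h' (a' @ map \<tau> a'))"
  proof (intro exI conjI ballI)
    let ?h = "\<lambda>v. map g (h (map (inv_into (univ M) g) v))"
    show "set (map \<sigma> a) \<subseteq> C"
      using a CA.Aut_closed[OF \<sigma>] by auto
    have "{v @ ?h v | v. v \<in> map g ` D} = map g ` {xs @ h xs | xs. xs \<in> D}"
    proof -
      have "map g xs @ ?h (map g xs) = map g (xs @ h xs)" if "xs \<in> D" for xs
        by (simp only: inv_g[OF D_univ(1)[OF that]] map_append)
      then have "(\<lambda>v. v @ ?h v) ` map g ` D = map g ` (\<lambda>xs. xs @ h xs) ` D"
        by (simp add: image_image del: map_map map_append)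
      then show ?thesis
        unfolding image_def by blast
    qed
    moreover have "definable \<L> M B (length a + length a + n) (map g ` {xs @ h xs | xs. xs \<in> D})"
      using D g ABC BA.fix_auts_bij_E[OF g(1)]
      by (intro definable_image[OF struct]) (auto simp: definable_fun_def fix_auts_def bij_betw_def)
    moreover have "map g ` D \<subseteq> tuples (univ M) (length a + length a)"
      using D map_tuples[OF bij] by (auto simp: definable_fun_def)
    moreover have "?h \<in> map g ` D \<rightarrow> tuples (univ M) n"
    proof
      fix v assume "v \<in> map g ` D"
      then obtain xs where xs: "v = map g xs" "xs \<in> D"
        by blast
      then have "h xs \<in> tuples (univ M) n"
        using D by (auto simp: definable_fun_def)
      then show "?h v \<in> tuples (univ M) n"
        unfolding xs(1) inv_g[OF D_univ(1)[OF xs(2)]] by (rule map_tuples[OF bij])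
    qed
    ultimately show "definable_fun \<L> M B (length (map \<sigma> a) + length (map \<sigma> a)) n (map g ` D) ?h"
      by (simp add: definable_fun_def del: map_map)
    fix \<tau> assume \<tau>: "\<tau> \<in> carrier CB.\<Gamma>"
    note c = conj_CB[OF \<sigma> \<tau>]
    have ca: "set (map (?c \<tau>) a) \<subseteq> C"
      using a CB.Aut_closed[OF c] by auto
    have "map \<sigma> a @ map \<tau> (map \<sigma> a) = map \<sigma> (a @ map (?c \<tau>) a)"
      using conj_act[OF \<sigma> CB_CA[OF \<tau>] a] by (simp del: map_map)
    also have "\<dots> = map g (a @ map (?c \<tau>) a)"
      using a ca by (intro map_g) simp
    finally have eq: "map \<sigma> a @ map \<tau> (map \<sigma> a) = map g (a @ map (?c \<tau>) a)" .
    show "map \<sigma> a @ map \<tau> (map \<sigma> a) \<in> map g ` D"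
      unfolding eq using h[OF c] by (intro imageI) blast
    have "?h (map \<sigma> a @ map \<tau> (map \<sigma> a)) = map g (\<phi> (?c \<tau>))"
      unfolding eq using h[OF c] D_univ by (simp only: inv_g)
    also have "\<dots> = map \<sigma> (\<phi> (?c \<tau>))"
      using CB.cocycle_points[OF \<phi> c] by (intro map_g[symmetric] CB.points_set)
    finally show "tr \<sigma> \<phi> \<tau> = ?h (map \<sigma> a @ map \<tau> (map \<sigma> a))"
      using \<tau> by (simp only: tr_apply)
  qed
  ultimately show ?thesis
    unfolding Z1_def by blast
qed

lemma infl_coh: "(\<phi>, \<psi>) \<in> BA.coh \<Longrightarrow> (infl \<phi>, infl \<psi>) \<in> CA.coh"
proof -
  assume "(\<phi>, \<psi>) \<in> BA.coh"
  then obtain b where b: "\<phi> \<in> BA.Z" "\<psi> \<in> BA.Z" "b \<in> points G B"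
    and eq: "\<And>\<rho>. \<rho> \<in> carrier BA.\<Gamma> \<Longrightarrow> \<phi> \<rho> = inv\<^bsub>G\<^esub> b \<otimes>\<^bsub>G\<^esub> \<psi> \<rho> \<otimes>\<^bsub>G\<^esub> map \<rho> b"
    by (auto simp: cohomologous_def)
  have "infl \<phi> \<sigma> = inv\<^bsub>G\<^esub> b \<otimes>\<^bsub>G\<^esub> infl \<psi> \<sigma> \<otimes>\<^bsub>G\<^esub> map \<sigma> b" if "\<sigma> \<in> carrier CA.\<Gamma>" for \<sigma>
    using eq[OF restr_closed[OF that]] that by (simp only: infl_apply map_restr[OF BA.points_set[OF b(3)]])
  then show ?thesis
    unfolding cohomologous_def using b infl_Z points_mono by blast
qed

lemma res_coh: "(\<phi>, \<psi>) \<in> CA.coh \<Longrightarrow> (res \<phi>, res \<psi>) \<in> CB.coh"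
  unfolding cohomologous_def using res_Z CB_CA by (fastforce simp: res_apply)

lemma tr_coh:
  assumes \<sigma>: "\<sigma> \<in> carrier CA.\<Gamma>" and coh: "(\<phi>, \<psi>) \<in> CB.coh"
  shows "(tr \<sigma> \<phi>, tr \<sigma> \<psi>) \<in> CB.coh"
proof -
  let ?c = "\<lambda>\<tau>. inv\<^bsub>CA.\<Gamma>\<^esub> \<sigma> \<otimes>\<^bsub>CA.\<Gamma>\<^esub> \<tau> \<otimes>\<^bsub>CA.\<Gamma>\<^esub> \<sigma>"
  obtain b where b: "\<phi> \<in> CB.Z" "\<psi> \<in> CB.Z" "b \<in> points G C"
    and eq: "\<And>\<tau>. \<tau> \<in> carrier CB.\<Gamma> \<Longrightarrow> \<phi> \<tau> = inv\<^bsub>G\<^esub> b \<otimes>\<^bsub>G\<^esub> \<psi> \<tau> \<otimes>\<^bsub>G\<^esub> map \<tau> b"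
    using coh by (auto simp: cohomologous_def)
  have "tr \<sigma> \<phi> \<tau> = inv\<^bsub>G\<^esub> (map \<sigma> b) \<otimes>\<^bsub>G\<^esub> tr \<sigma> \<psi> \<tau> \<otimes>\<^bsub>G\<^esub> map \<tau> (map \<sigma> b)" if \<tau>: "\<tau> \<in> carrier CB.\<Gamma>" for \<tau>
  proof -
    note c = conj_CB[OF \<sigma> \<tau>]
    have p: "inv\<^bsub>G\<^esub> b \<in> points G C" "\<psi> (?c \<tau>) \<in> points G C" "map (?c \<tau>) b \<in> points G C"
      using b CB.cocycle_points[OF _ c] CB.act_closed[OF c] by auto
    have "tr \<sigma> \<phi> \<tau> = map \<sigma> (inv\<^bsub>G\<^esub> b \<otimes>\<^bsub>G\<^esub> \<psi> (?c \<tau>) \<otimes>\<^bsub>G\<^esub> map (?c \<tau>) b)"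
      using \<tau> by (simp only: tr_apply eq[OF c])
    also have "\<dots> = map \<sigma> (inv\<^bsub>G\<^esub> b) \<otimes>\<^bsub>G\<^esub> map \<sigma> (\<psi> (?c \<tau>)) \<otimes>\<^bsub>G\<^esub> map \<sigma> (map (?c \<tau>) b)"
      using p \<sigma> by (simp only: CA.act_mult CA.points.m_closed)
    finally show ?thesis
      using \<tau> by (simp only: tr_apply CA.act_inv[OF \<sigma> b(3)] conj_act[OF \<sigma> CB_CA[OF \<tau>] CA.points_set[OF b(3)]])
  qed
  then show ?thesis
    unfolding cohomologous_def using b tr_Z[OF \<sigma>] CA.act_closed[OF \<sigma> b(3)] by blast
qed

text \<open>A cocycle on all of \<open>Aut(C/A)\<close> can be evaluated at \<open>\<sigma>\<close>, and this value links its restriction with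
  the transform.  Hence restrictions have fixed classes.\<close>
lemma tr_res_coh:
  assumes \<sigma>: "\<sigma> \<in> carrier CA.\<Gamma>" and \<phi>: "\<phi> \<in> CA.Z"
  shows "(tr \<sigma> (res \<phi>), res \<phi>) \<in> CB.coh"
proof -
  have "tr \<sigma> (res \<phi>) \<tau> = inv\<^bsub>G\<^esub> (\<phi> \<sigma>) \<otimes>\<^bsub>G\<^esub> res \<phi> \<tau> \<otimes>\<^bsub>G\<^esub> map \<tau> (\<phi> \<sigma>)" if "\<tau> \<in> carrier CB.\<Gamma>" for \<tau>
    using CA.cocycle_conj[OF \<phi> \<sigma> CB_CA[OF that]] that conj_CB[OF \<sigma> that]
    by (simp add: tr_apply res_apply)
  then show ?thesis
    unfolding cohomologous_def using tr_Z[OF \<sigma> res_Z[OF \<phi>]] res_Z[OF \<phi>] CA.cocycle_points[OF \<phi> \<sigma>] by blast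
qed

text \<open>This is why the action on classes depends only on the restriction of \<open>\<sigma>\<close> to \<open>B\<close>.\<close>
lemma tr_inner_coh:
  assumes \<kappa>: "\<kappa> \<in> carrier CB.\<Gamma>" and \<phi>: "\<phi> \<in> CB.Z"
  shows "(tr \<kappa> \<phi>, \<phi>) \<in> CB.coh"
proof -
  have "tr \<kappa> \<phi> \<tau> = inv\<^bsub>G\<^esub> (\<phi> \<kappa>) \<otimes>\<^bsub>G\<^esub> \<phi> \<tau> \<otimes>\<^bsub>G\<^esub> map \<tau> (\<phi> \<kappa>)" if "\<tau> \<in> carrier CB.\<Gamma>" for \<tau>
    using CB.cocycle_conj[OF \<phi> \<kappa> that] that CB_inv[OF \<kappa>] by (simp add: tr_apply CB_mult)
  then show ?thesis
    unfolding cohomologous_def using tr_Z[OF CB_CA[OF \<kappa>] \<phi>] \<phi> CB.cocycle_points[OF \<phi> \<kappa>] by blast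
qed

lemma tr_comp:
  assumes \<sigma>: "\<sigma> \<in> carrier CA.\<Gamma>" "\<sigma>' \<in> carrier CA.\<Gamma>" and \<phi>: "\<phi> \<in> CB.Z"
  shows "tr (\<sigma> \<otimes>\<^bsub>CA.\<Gamma>\<^esub> \<sigma>') \<phi> = tr \<sigma> (tr \<sigma>' \<phi>)"
proof (rule CB.cocycle_ext)
  fix \<tau> assume \<tau>: "\<tau> \<in> carrier CB.\<Gamma>"
  let ?c = "inv\<^bsub>CA.\<Gamma>\<^esub> (\<sigma> \<otimes>\<^bsub>CA.\<Gamma>\<^esub> \<sigma>') \<otimes>\<^bsub>CA.\<Gamma>\<^esub> \<tau> \<otimes>\<^bsub>CA.\<Gamma>\<^esub> (\<sigma> \<otimes>\<^bsub>CA.\<Gamma>\<^esub> \<sigma>')"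
  have c: "?c \<in> carrier CB.\<Gamma>"
    using \<sigma> \<tau> by (intro conj_CB) auto
  have "?c = inv\<^bsub>CA.\<Gamma>\<^esub> \<sigma>' \<otimes>\<^bsub>CA.\<Gamma>\<^esub> (inv\<^bsub>CA.\<Gamma>\<^esub> \<sigma> \<otimes>\<^bsub>CA.\<Gamma>\<^esub> \<tau> \<otimes>\<^bsub>CA.\<Gamma>\<^esub> \<sigma>) \<otimes>\<^bsub>CA.\<Gamma>\<^esub> \<sigma>'"
    using \<sigma> CB_CA[OF \<tau>] by (simp add: CA.Aut.inv_mult_group CA.Aut.m_assoc)
  then show "tr (\<sigma> \<otimes>\<^bsub>CA.\<Gamma>\<^esub> \<sigma>') \<phi> \<tau> = tr \<sigma> (tr \<sigma>' \<phi>) \<tau>"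
    using \<tau> conj_CB[OF \<sigma>(1) \<tau>] CA.act_comp[OF \<sigma> CB.points_set[OF CB.cocycle_points[OF \<phi> c]]]
    by (simp only: tr_apply)
qed (use assms tr_Z in auto)

lemma tr_one: "\<phi> \<in> CB.Z \<Longrightarrow> tr \<one>\<^bsub>CA.\<Gamma>\<^esub> \<phi> = \<phi>"
  by (intro CB.cocycle_ext tr_Z)
    (simp_all add: tr_apply CB_CA CA.act_id CB.points_set CB.cocycle_points)

section \<open>Descent of cocycles\<close>

text \<open>Think of \<open>H\<close> as the graph of \<open>h\<close> in \<open>\<phi>(\<sigma>) = h(a, \<sigma>(a))\<close>, and of \<open>\<theta>(x, y, e)\<close> as a family of sets of
  pairs \<open>(x, y)\<close> with parameter \<open>e\<close>.  The relation between \<open>e1\<close>, \<open>e2\<close> and \<open>z\<close> says that the value of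
  \<open>b1 h(a1, a2) b2^-1\<close> is \<open>z\<close> for all pairs \<open>(a1, b1)\<close> in the set of \<open>e1\<close> and all pairs \<open>(a2, b2)\<close> in
  the set of \<open>e2\<close>, and that there are such pairs.  The witness \<open>w\<close> is \<open>h(a1, a2)\<close>, and \<open>t\<close> is the
  common value of \<open>b1 w\<close> and \<open>z b2\<close>.\<close>
lemma definable_descent:
  assumes H: "definable \<L> M A (m + m + n) H" and \<theta>: "fm_wf \<L> (m + n + q) \<theta>"
  shows "definable_rel \<L> M A [q, q, n] (\<lambda>bs.
    (\<exists>a1\<in>tuples (univ M) m. \<exists>b1\<in>tuples (univ M) n. \<exists>a2\<in>tuples (univ M) m. \<exists>b2\<in>tuples (univ M) n.
       sat M (a1 @ b1 @ bs ! 0) \<theta> \<and> sat M (a2 @ b2 @ bs ! 1) \<theta>) \<and>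
    (\<forall>a1\<in>tuples (univ M) m. \<forall>b1\<in>tuples (univ M) n. \<forall>a2\<in>tuples (univ M) m. \<forall>b2\<in>tuples (univ M) n.
       sat M (a1 @ b1 @ bs ! 0) \<theta> \<and> sat M (a2 @ b2 @ bs ! 1) \<theta> \<longrightarrow>
       (\<exists>w\<in>tuples (univ M) n. \<exists>t\<in>tuples (univ M) n. a1 @ a2 @ w \<in> H \<and>
          (b1 \<in> carrier G \<and> w \<in> carrier G \<and> t = b1 \<otimes>\<^bsub>G\<^esub> w) \<and>
          (bs ! 2 \<in> carrier G \<and> b2 \<in> carrier G \<and> t = bs ! 2 \<otimes>\<^bsub>G\<^esub> b2))))"
proof -
  define mul where "mul = (\<lambda>bs. bs ! 0 \<in> carrier G \<and> bs ! 1 \<in> carrier G \<and> bs ! 2 = bs ! 0 \<otimes>\<^bsub>G\<^esub> bs ! 1)"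
  define graph where "graph = (\<lambda>bs. concat bs \<in> H)"
  define fib where "fib = (\<lambda>bs. sat M (concat bs) \<theta>)"
  let ?def = "definable_rel \<L> M A"
  have mul: "?def [n, n, n] mul"
    unfolding mul_def by (rule BA.definable_graph_mult)
  have graph: "?def [m, m, n] graph"
    unfolding graph_def using H by (intro definable_rel_of_set) (simp add: add.assoc)
  have fib: "?def [m, n, q] fib"
    unfolding definable_rel_def fib_def
    using \<theta> by (intro exI[of _ \<theta>] exI[of _ "[]"]) (simp add: add.assoc)
  \<comment> \<open>the order \<open>t, w, b2, a2, b1, a1, e1, e2, z\<close> is that of quantification, innermost first\<close>
  let ?ls = "[n, n, n, m, n, m, q, q, n]"
  have 1: "?def ?ls (\<lambda>bs. graph (map ((!) bs) [5, 3, 1]))"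
    by (rule definable_rel_reindex) (use graph in auto)
  have 2: "?def ?ls (\<lambda>bs. mul (map ((!) bs) [4, 1, 0]))"
    by (rule definable_rel_reindex) (use mul in auto)
  have 3: "?def ?ls (\<lambda>bs. mul (map ((!) bs) [8, 2, 0]))"
    by (rule definable_rel_reindex) (use mul in auto)
  have R: "?def [n, m, n, m, q, q, n] (\<lambda>bs. \<exists>w\<in>tuples (univ M) n. \<exists>t\<in>tuples (univ M) n.
      graph [bs ! 3, bs ! 1, w] \<and> mul [bs ! 2, w, t] \<and> mul [bs ! 6, bs ! 0, t])"
    using definable_rel_Ex[OF definable_rel_Ex[OF definable_rel_And[OF 1 definable_rel_And[OF 2 3]]]]
    by (rule definable_rel_cong) simp
  have 4: "?def [n, m, n, m, q, q, n] (\<lambda>bs. fib (map ((!) bs) [3, 2, 4]))"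
    by (rule definable_rel_reindex) (use fib in auto)
  have 5: "?def [n, m, n, m, q, q, n] (\<lambda>bs. fib (map ((!) bs) [1, 0, 5]))"
    by (rule definable_rel_reindex) (use fib in auto)
  note ex4 = definable_rel_Ex[OF definable_rel_Ex[OF definable_rel_Ex[OF definable_rel_Ex]]]
  show ?thesis
    using definable_rel_And[OF ex4[OF definable_rel_And[OF 4 5]]
        definable_rel_Not[OF ex4[OF definable_rel_And[OF definable_rel_And[OF 4 5] definable_rel_Not[OF R]]]]]
    by (rule definable_rel_cong) (simp add: graph_def mul_def fib_def, blast)
qed

text \<open>The heart of the matter.  The cocycle \<open>\<psi>(\<sigma>) = b \<phi>(\<sigma>) \<sigma>(b)^-1\<close>, cohomologous to \<open>\<phi>\<close>, is trivial on
  \<open>Aut(C/B)\<close>.  By the cocycle identity it is invariant under multiplication with elements of \<open>Aut(C/B)\<close>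
  from the right, and since this group is normal, its values are fixed by it.  So \<open>\<psi>\<close> is the inflation
  of a function \<open>\<chi>\<close> with values in \<open>G(B)\<close>.

  The point is that \<open>\<chi>\<close> is definable from a tuple in \<open>B\<close>, although \<open>\<psi>\<close> is given by \<open>b\<close>
  and by the tuple \<open>a\<close> in \<open>\<phi>(\<sigma>) = h(a, \<sigma>(a))\<close>, which lie in \<open>C\<close>.  Let \<open>\<theta>(x, d)\<close> isolate the type of \<open>(a, b)\<close> over \<open>B\<close>.  The solutions of \<open>\<theta>(x, d)\<close> are the \<open>\<tau>1(a, b)\<close>, and those of
  \<open>\<theta>(x, \<sigma>(d))\<close> are the \<open>\<sigma> \<tau>2(a, b)\<close>, with \<open>\<tau>1\<close> and \<open>\<tau>2\<close> in \<open>Aut(C/B)\<close>.  By the invariance of \<open>\<psi>\<close>, replacing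
  \<open>(a, b)\<close> and \<open>\<sigma>(a, b)\<close> by any such solutions in the formula for \<open>\<psi>(\<sigma>)\<close> does not change the value.
  Thus \<open>\<psi>(\<sigma>)\<close> is the common value over all pairs of solutions, which is a definable function of
  \<open>d\<close> and \<open>\<sigma>(d)\<close>.\<close>
lemma descend_cocycle:
  assumes \<phi>: "\<phi> \<in> CA.Z" and b: "b \<in> points G C"
    and triv: "\<And>\<tau>. \<tau> \<in> carrier CB.\<Gamma> \<Longrightarrow> \<phi> \<tau> = inv\<^bsub>G\<^esub> b \<otimes>\<^bsub>G\<^esub> map \<tau> b"
  obtains \<chi> where "\<chi> \<in> BA.Z" "(\<phi>, infl \<chi>) \<in> CA.coh"
proof -
  define \<psi> where "\<psi> \<sigma> = b \<otimes>\<^bsub>G\<^esub> \<phi> \<sigma> \<otimes>\<^bsub>G\<^esub> inv\<^bsub>G\<^esub> (map \<sigma> b)" for \<sigma>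
  note c = CA.points_carrier
  have \<psi>_C: "\<psi> \<sigma> \<in> points G C" if "\<sigma> \<in> carrier CA.\<Gamma>" for \<sigma>
    unfolding \<psi>_def using b CA.cocycle_points[OF \<phi> that] CA.act_closed[OF that b] by auto
  have \<psi>_eq: "\<psi> \<sigma> \<otimes>\<^bsub>G\<^esub> map \<sigma> b = b \<otimes>\<^bsub>G\<^esub> \<phi> \<sigma>" if "\<sigma> \<in> carrier CA.\<Gamma>" for \<sigma>
    unfolding \<psi>_def using c[OF b] c[OF CA.cocycle_points[OF \<phi> that]] c[OF CA.act_closed[OF that b]]
    by (simp add: BA.G.m_assoc)
  have \<psi>_mult: "\<psi> (\<sigma> \<otimes>\<^bsub>CA.\<Gamma>\<^esub> \<tau>) = \<psi> \<sigma> \<otimes>\<^bsub>G\<^esub> map \<sigma> (\<psi> \<tau>)"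
    if \<sigma>: "\<sigma> \<in> carrier CA.\<Gamma>" and \<tau>: "\<tau> \<in> carrier CA.\<Gamma>" for \<sigma> \<tau>
  proof -
    note p = CA.cocycle_points[OF \<phi> \<sigma>] CA.cocycle_points[OF \<phi> \<tau>] CA.act_closed[OF \<sigma> b] CA.act_closed[OF \<tau> b]
    note q = CA.act_closed[OF \<sigma> p(2)] CA.act_closed[OF \<sigma> p(4)]
    have "map \<sigma> (\<psi> \<tau>) = map \<sigma> b \<otimes>\<^bsub>G\<^esub> map \<sigma> (\<phi> \<tau>) \<otimes>\<^bsub>G\<^esub> inv\<^bsub>G\<^esub> (map \<sigma> (map \<tau> b))"
      unfolding \<psi>_def using b p
      by (simp only: CA.act_mult[OF \<sigma>] CA.points.m_closed CA.points.m_inv_closed CA.act_inv[OF \<sigma>])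
    then have "\<psi> \<sigma> \<otimes>\<^bsub>G\<^esub> map \<sigma> (\<psi> \<tau>) = \<psi> \<sigma> \<otimes>\<^bsub>G\<^esub> map \<sigma> b \<otimes>\<^bsub>G\<^esub> map \<sigma> (\<phi> \<tau>) \<otimes>\<^bsub>G\<^esub> inv\<^bsub>G\<^esub> (map \<sigma> (map \<tau> b))"
      using c[OF \<psi>_C[OF \<sigma>]] c[OF b] p[THEN c] q[THEN c] by (simp add: BA.G.m_assoc del: map_map)
    also have "\<dots> = \<psi> (\<sigma> \<otimes>\<^bsub>CA.\<Gamma>\<^esub> \<tau>)"
      unfolding \<psi>_eq[OF \<sigma>] using c[OF b] p[THEN c] q[THEN c]
      by (simp add: \<psi>_def CA.cocycle_mult[OF \<phi> \<sigma> \<tau>] CA.act_comp[OF \<sigma> \<tau> CA.points_set[OF b]] BA.G.m_assoc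
          del: map_map)
    finally show ?thesis ..
  qed
  have \<psi>_CB: "\<psi> \<tau> = \<one>\<^bsub>G\<^esub>" if "\<tau> \<in> carrier CB.\<Gamma>" for \<tau>
    unfolding \<psi>_def triv[OF that] using c[OF b] c[OF CB.act_closed[OF that b]]
    by (simp add: BA.G.m_assoc[symmetric])
  have \<psi>_right: "\<psi> (\<sigma> \<otimes>\<^bsub>CA.\<Gamma>\<^esub> \<tau>) = \<psi> \<sigma>" if \<sigma>: "\<sigma> \<in> carrier CA.\<Gamma>" and \<tau>: "\<tau> \<in> carrier CB.\<Gamma>" for \<sigma> \<tau>
    using \<psi>_mult[OF \<sigma> CB_CA[OF \<tau>]] \<psi>_CB[OF \<tau>] CA.act_one[OF \<sigma>] c[OF \<psi>_C[OF \<sigma>]] by simp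
  have \<psi>_left: "\<psi> (\<tau> \<otimes>\<^bsub>CA.\<Gamma>\<^esub> \<sigma>) = map \<tau> (\<psi> \<sigma>)" if \<sigma>: "\<sigma> \<in> carrier CA.\<Gamma>" and \<tau>: "\<tau> \<in> carrier CB.\<Gamma>" for \<sigma> \<tau>
    using \<psi>_mult[OF CB_CA[OF \<tau>] \<sigma>] \<psi>_CB[OF \<tau>] c[OF CA.act_closed[OF CB_CA[OF \<tau>] \<psi>_C[OF \<sigma>]]] by simp
  have \<psi>_fixed: "map \<tau> (\<psi> \<sigma>) = \<psi> \<sigma>" if \<sigma>: "\<sigma> \<in> carrier CA.\<Gamma>" and \<tau>: "\<tau> \<in> carrier CB.\<Gamma>" for \<sigma> \<tau>
  proof -
    have "\<tau> \<otimes>\<^bsub>CA.\<Gamma>\<^esub> \<sigma> = \<sigma> \<otimes>\<^bsub>CA.\<Gamma>\<^esub> (inv\<^bsub>CA.\<Gamma>\<^esub> \<sigma> \<otimes>\<^bsub>CA.\<Gamma>\<^esub> \<tau> \<otimes>\<^bsub>CA.\<Gamma>\<^esub> \<sigma>)"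
      using \<sigma> CB_CA[OF \<tau>] by (simp add: CA.Aut.m_assoc[symmetric])
    then show ?thesis
      using \<psi>_left[OF \<sigma> \<tau>] \<psi>_right[OF \<sigma> conj_CB[OF \<sigma> \<tau>]] by simp
  qed
  have \<psi>_B: "\<psi> \<sigma> \<in> points G B" if \<sigma>: "\<sigma> \<in> carrier CA.\<Gamma>" for \<sigma>
    using \<psi>_C[OF \<sigma>] \<psi>_fixed[OF \<sigma>] by (rule points_descend)

  define \<chi> where "\<chi> = (\<lambda>\<rho>\<in>carrier BA.\<Gamma>. \<psi> (SOME \<sigma>. \<sigma> \<in> carrier CA.\<Gamma> \<and> \<pi> \<sigma> = \<rho>))"
  have \<chi>: "\<chi> (\<pi> \<sigma>) = \<psi> \<sigma>" if \<sigma>: "\<sigma> \<in> carrier CA.\<Gamma>" for \<sigma>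
  proof -
    let ?s = "SOME \<sigma>'. \<sigma>' \<in> carrier CA.\<Gamma> \<and> \<pi> \<sigma>' = \<pi> \<sigma>"
    have s: "?s \<in> carrier CA.\<Gamma> \<and> \<pi> ?s = \<pi> \<sigma>"
      by (rule someI[of _ \<sigma>]) (use \<sigma> in blast)
    obtain \<kappa> where "\<kappa> \<in> carrier CB.\<Gamma>" "?s = \<sigma> \<otimes>\<^bsub>CA.\<Gamma>\<^esub> \<kappa>"
      using \<sigma> conjunct1[OF s] conjunct2[OF s, symmetric] by (rule restr_eqE)
    then have "\<psi> ?s = \<psi> \<sigma>"
      using \<psi>_right[OF \<sigma>] by metis
    then show ?thesis
      using restr_closed[OF \<sigma>] unfolding \<chi>_def by (simp only: restrict_apply if_True)
  qed

  obtain D h a where a: "set a \<subseteq> C" and D: "definable_fun \<L> M A (length a + length a) n D h"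
    and h: "\<And>\<sigma>. \<sigma> \<in> carrier CA.\<Gamma> \<Longrightarrow> a @ map \<sigma> a \<in> D \<and> \<phi> \<sigma> = h (a @ map \<sigma> a)"
    using \<phi> unfolding Z1_def by blast
  define H where "H = {xs @ h xs | xs. xs \<in> D}"
  have H: "definable \<L> M A (length a + length a + n) H"
    using D by (simp add: definable_fun_def H_def)
  have len_b: "length b = n" and ab_univ: "set (a @ b) \<subseteq> univ M" and ab_C: "set (a @ b) \<subseteq> C"
    using a ABC CA.points_set[OF b] subsetD[OF BA.carrier_G c[OF b]] by (auto simp: tuples_def)
  obtain d \<theta> where d: "set d \<subseteq> B" and \<theta>: "fm_wf \<L> (length (a @ b) + length d) \<theta>" "sat M ((a @ b) @ d) \<theta>"
    and iso: "\<And>ys. ys \<in> tuples (univ M) (length (a @ b)) \<Longrightarrow> sat M (ys @ d) \<theta> \<Longrightarrow>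
      \<exists>g\<in>fix_auts \<L> M B. map g (a @ b) = ys"
    by (rule isolating_formula[OF B(4,5) ab_univ]) (rule that)
  let ?m = "length a" and ?q = "length d"
  define P where "P = (\<lambda>bs.
    (\<exists>a1\<in>tuples (univ M) ?m. \<exists>b1\<in>tuples (univ M) n. \<exists>a2\<in>tuples (univ M) ?m. \<exists>b2\<in>tuples (univ M) n.
       sat M (a1 @ b1 @ bs ! 0) \<theta> \<and> sat M (a2 @ b2 @ bs ! 1) \<theta>) \<and>
    (\<forall>a1\<in>tuples (univ M) ?m. \<forall>b1\<in>tuples (univ M) n. \<forall>a2\<in>tuples (univ M) ?m. \<forall>b2\<in>tuples (univ M) n.
       sat M (a1 @ b1 @ bs ! 0) \<theta> \<and> sat M (a2 @ b2 @ bs ! 1) \<theta> \<longrightarrow>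
       (\<exists>w\<in>tuples (univ M) n. \<exists>t\<in>tuples (univ M) n. a1 @ a2 @ w \<in> H \<and>
          (b1 \<in> carrier G \<and> w \<in> carrier G \<and> t = b1 \<otimes>\<^bsub>G\<^esub> w) \<and>
          (bs ! 2 \<in> carrier G \<and> b2 \<in> carrier G \<and> t = bs ! 2 \<otimes>\<^bsub>G\<^esub> b2))))"
  have P_def_rel: "definable_rel \<L> M A [?q, ?q, n] P"
    unfolding P_def using \<theta>(1) len_b by (intro definable_descent[OF H]) simp
  have H_fun: "w = w'" if "a1 @ a2 @ w \<in> H" "a1 @ a2 @ w' \<in> H" "length a1 = ?m" "length a2 = ?m" for a1 a2 w w'
  proof -
    have *: "w = h (a1 @ a2)" if w: "a1 @ a2 @ w \<in> H" for w
    proof -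
      obtain xs where xs: "a1 @ a2 @ w = xs @ h xs" "xs \<in> D"
        using w by (auto simp: H_def)
      then have "length xs = length (a1 @ a2)"
        using D \<open>length a1 = ?m\<close> \<open>length a2 = ?m\<close> by (auto simp: definable_fun_def tuples_def)
      then show ?thesis
        using xs(1) append_eq_append_conv[of xs "a1 @ a2" "h xs" w] by auto
    qed
    show ?thesis
      using *[OF that(1)] *[OF that(2)] by simp
  qed
  have P_unique: "z = z'" if P: "P [e1, e2, z]" "P [e1, e2, z']" for e1 e2 z z'
  proof -
    obtain a1 b1 a2 b2 where fib: "a1 \<in> tuples (univ M) ?m" "b1 \<in> tuples (univ M) n"
      "a2 \<in> tuples (univ M) ?m" "b2 \<in> tuples (univ M) n"
      "sat M (a1 @ b1 @ e1) \<theta> \<and> sat M (a2 @ b2 @ e2) \<theta>"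
      using P(1) by (auto simp: P_def)
    obtain w where w: "a1 @ a2 @ w \<in> H" "b1 \<in> carrier G" "z \<in> carrier G" "b2 \<in> carrier G"
       "b1 \<otimes>\<^bsub>G\<^esub> w = z \<otimes>\<^bsub>G\<^esub> b2"
      using P(1) fib unfolding P_def by (force simp: numeral_2_eq_2)
    obtain w' where w': "a1 @ a2 @ w' \<in> H" "z' \<in> carrier G" "b1 \<otimes>\<^bsub>G\<^esub> w' = z' \<otimes>\<^bsub>G\<^esub> b2"
      using P(2) fib unfolding P_def by (force simp: numeral_2_eq_2)
    have "w = w'"
      using fib(1,3) by (intro H_fun[OF w(1) w'(1)]) (auto simp: tuples_def)
    then show ?thesis
      using w w' by (metis BA.G.right_cancel)
  qed
  \<comment> \<open>the common value over all pairs of solutions exists at \<open>(d, \<sigma>(d))\<close> and is \<open>\<psi>(\<sigma>)\<close>\<close>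
  have P_value: "P [d, map \<sigma> d, \<psi> \<sigma>]" if \<sigma>: "\<sigma> \<in> carrier CA.\<Gamma>" for \<sigma>
  proof -
    obtain g where g: "g \<in> fix_auts \<L> M A" "\<sigma> = restrict g C"
      using \<sigma> by (rule CA.Aut_lift)
    have map_g: "map \<sigma> x = map g x" if "set x \<subseteq> C" for x
      using that g(2) by auto
    have d_C: "set d \<subseteq> C"
      using d ABC by blast
    have g_aut: "automorphism \<L> M g"
      using g by (simp add: fix_auts_def)
    have bij: "bij_betw g (univ M) (univ M)"
      by (rule fix_auts_bij[OF g(1)])
    have a1: "a \<in> tuples (univ M) ?m" "b \<in> tuples (univ M) n"
      using ab_univ len_b by (auto simp: tuples_def)
    have sat_g: "sat M (map g x @ map g y @ map g d) \<theta> \<longleftrightarrow> sat M (x @ y @ d) \<theta>"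
      if "x \<in> tuples (univ M) ?m" "y \<in> tuples (univ M) n" for x y
    proof -
      have "sat M (map g (x @ y @ d)) \<theta> \<longleftrightarrow> sat M (x @ y @ d) \<theta>"
        using \<theta>(1) len_b d ABC that by (intro sat_automorphism[OF struct g_aut]) (auto simp: tuples_def add.assoc)
      then show ?thesis
        by simp
    qed
    have "sat M (a @ b @ d) \<theta> \<and> sat M (map g a @ map g b @ map \<sigma> d) \<theta>"
      using sat_g[OF a1] \<theta>(2) by (simp only: map_g[OF d_C] append_assoc)
    then have nonempty: "\<exists>a1\<in>tuples (univ M) ?m. \<exists>b1\<in>tuples (univ M) n.
        \<exists>a2\<in>tuples (univ M) ?m. \<exists>b2\<in>tuples (univ M) n.
       sat M (a1 @ b1 @ d) \<theta> \<and> sat M (a2 @ b2 @ map \<sigma> d) \<theta>"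
      using a1 map_tuples[OF bij a1(1)] map_tuples[OF bij a1(2)] by blast
    have "\<exists>w\<in>tuples (univ M) n. \<exists>t\<in>tuples (univ M) n. a1 @ a2 @ w \<in> H \<and>
          (b1 \<in> carrier G \<and> w \<in> carrier G \<and> t = b1 \<otimes>\<^bsub>G\<^esub> w) \<and>
          (\<psi> \<sigma> \<in> carrier G \<and> b2 \<in> carrier G \<and> t = \<psi> \<sigma> \<otimes>\<^bsub>G\<^esub> b2)"
      if tup: "a1 \<in> tuples (univ M) ?m" "b1 \<in> tuples (univ M) n" "a2 \<in> tuples (univ M) ?m" "b2 \<in> tuples (univ M) n"
        and sat: "sat M (a1 @ b1 @ d) \<theta>" "sat M (a2 @ b2 @ map \<sigma> d) \<theta>" for a1 b1 a2 b2
    proof -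
      have "a1 @ b1 \<in> tuples (univ M) (length (a @ b))"
        using tup len_b by (auto simp: tuples_def)
      then obtain g1 where g1: "g1 \<in> fix_auts \<L> M B" "map g1 (a @ b) = a1 @ b1"
        using iso[of "a1 @ b1"] sat(1) by auto
      let ?i = "inv_into (univ M) g"
      have i: "map ?i x \<in> tuples (univ M) k" "map g (map ?i x) = x" if "x \<in> tuples (univ M) k" for x k
        using map_tuples[OF bij_betw_inv_into[OF bij] that] that bij_betw_inv_into_right[OF bij]
        by (auto simp: tuples_def subset_iff intro!: map_idI)
      have "sat M (map ?i a2 @ map ?i b2 @ d) \<theta>"
        using sat(2) sat_g[OF i(1)[OF tup(3)] i(1)[OF tup(4)]]
        by (simp only: i(2)[OF tup(3)] i(2)[OF tup(4)] map_g[OF d_C])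
      moreover have "map ?i a2 @ map ?i b2 \<in> tuples (univ M) (length (a @ b))"
        using i(1)[OF tup(3)] i(1)[OF tup(4)] len_b by (auto simp: tuples_def)
      ultimately obtain g2 where g2: "g2 \<in> fix_auts \<L> M B" "map g2 (a @ b) = map ?i a2 @ map ?i b2"
        using iso[of "map ?i a2 @ map ?i b2"] by auto
      define \<tau>1 \<tau>2 where "\<tau>1 = restrict g1 C" and "\<tau>2 = restrict g2 C"
      have \<tau>: "\<tau>1 \<in> carrier CB.\<Gamma>" "\<tau>2 \<in> carrier CB.\<Gamma>"
        unfolding \<tau>1_def \<tau>2_def by (rule CB.restrict_in_Aut, rule g1 g2)+
      note \<tau>A = \<tau>[THEN CB_CA]
      have \<tau>1: "map \<tau>1 x = map g1 x" if "set x \<subseteq> C" for x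
        using that by (auto simp: \<tau>1_def)
      have \<tau>2: "map \<tau>2 x = map g2 x" if "set x \<subseteq> C" for x
        using that by (auto simp: \<tau>2_def)
      have a1b1: "a1 = map \<tau>1 a" "b1 = map \<tau>1 b"
        using \<tau>1[OF ab_C] g1(2) tup by (simp_all add: tuples_def del: map_eq_conv)
      have "map \<tau>2 a = map ?i a2" "map \<tau>2 b = map ?i b2"
        using \<tau>2[OF ab_C] g2(2) tup by (simp_all add: tuples_def del: map_eq_conv)
      moreover have "set (map \<tau>2 a) \<subseteq> C" "set (map \<tau>2 b) \<subseteq> C"
        using ab_C CA.Aut_closed[OF \<tau>A(2)] by auto
      ultimately have a2b2: "a2 = map \<sigma> (map \<tau>2 a)" "b2 = map \<sigma> (map \<tau>2 b)"
        using i(2)[OF tup(3)] i(2)[OF tup(4)] by (simp_all only: map_g)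
      \<comment> \<open>up to \<open>\<tau>1\<close>, the two solutions are \<open>(a, b)\<close> and \<open>\<nu>(a, b)\<close>\<close>
      define \<nu> where "\<nu> = inv\<^bsub>CA.\<Gamma>\<^esub> \<tau>1 \<otimes>\<^bsub>CA.\<Gamma>\<^esub> (\<sigma> \<otimes>\<^bsub>CA.\<Gamma>\<^esub> \<tau>2)"
      have \<nu>: "\<nu> \<in> carrier CA.\<Gamma>" "\<tau>1 \<otimes>\<^bsub>CA.\<Gamma>\<^esub> \<nu> = \<sigma> \<otimes>\<^bsub>CA.\<Gamma>\<^esub> \<tau>2"
        unfolding \<nu>_def using \<tau>A \<sigma> by (simp_all add: CA.Aut.m_assoc[symmetric])
      have \<nu>_act: "map \<tau>1 (map \<nu> x) = map \<sigma> (map \<tau>2 x)" if "set x \<subseteq> C" for x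
        using CA.act_comp[OF \<tau>A(1) \<nu>(1) that] CA.act_comp[OF \<sigma> \<tau>A(2) that] \<nu>(2) by simp
      have \<psi>_\<nu>: "map \<tau>1 (\<psi> \<nu>) = \<psi> \<sigma>"
        using \<psi>_left[OF \<nu>(1) \<tau>(1)] \<psi>_right[OF \<sigma> \<tau>(2)] \<nu>(2) by simp
      let ?w = "map \<tau>1 (\<phi> \<nu>)"
      note p\<nu> = CA.cocycle_points[OF \<phi> \<nu>(1)]
      have w: "?w \<in> points G C" "b1 \<in> points G C" "b2 \<in> points G C" "map \<nu> b \<in> points G C"
        unfolding a1b1 a2b2 using \<tau>A \<sigma> b p\<nu> \<nu> by (simp_all add: CA.act_closed del: map_map)
      have eq: "b1 \<otimes>\<^bsub>G\<^esub> ?w = \<psi> \<sigma> \<otimes>\<^bsub>G\<^esub> b2"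
      proof -
        have "b1 \<otimes>\<^bsub>G\<^esub> ?w = map \<tau>1 (b \<otimes>\<^bsub>G\<^esub> \<phi> \<nu>)"
          unfolding a1b1 by (rule CA.act_mult[OF \<tau>A(1) b p\<nu>, symmetric])
        also have "\<dots> = map \<tau>1 (\<psi> \<nu>) \<otimes>\<^bsub>G\<^esub> map \<tau>1 (map \<nu> b)"
          unfolding \<psi>_eq[OF \<nu>(1), symmetric] by (rule CA.act_mult[OF \<tau>A(1) \<psi>_C[OF \<nu>(1)] w(4)])
        finally show ?thesis
          by (simp only: \<psi>_\<nu> \<nu>_act[OF CA.points_set[OF b]] a2b2)
      qed
      have "a @ map \<nu> a @ \<phi> \<nu> \<in> H"
        using h[OF \<nu>(1)] unfolding H_def by (intro CollectI exI[of _ "a @ map \<nu> a"]) simp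
      moreover have \<nu>a: "set (map \<nu> a) \<subseteq> C"
        using a CA.Aut_closed[OF \<nu>(1)] by auto
      have "a @ map \<nu> a @ \<phi> \<nu> \<in> tuples (univ M) (length a + length a + n)"
        using a \<nu>a ABC c[OF p\<nu>] BA.carrier_G by (auto simp: tuples_def)
      ultimately have "map g1 (a @ map \<nu> a @ \<phi> \<nu>) \<in> H"
        using definable_invariant[OF struct _ _ H, of g1] g1(1) fix_auts_antimono[OF ABC(1)] ABC by blast
      moreover have "map g1 (a @ map \<nu> a @ \<phi> \<nu>) = a1 @ a2 @ ?w"
        using \<tau>1[OF a] \<tau>1[OF \<nu>a] \<tau>1[OF CA.points_set[OF p\<nu>]] \<nu>_act[OF a]
        by (simp only: map_append a1b1 a2b2)
      ultimately have "a1 @ a2 @ ?w \<in> H"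
        by simp
      moreover have "?w \<in> tuples (univ M) n" "b1 \<otimes>\<^bsub>G\<^esub> ?w \<in> tuples (univ M) n"
        using c[OF w(1)] c[OF w(2)] BA.carrier_G BA.G.m_closed by blast+
      ultimately show ?thesis
        using eq w[THEN c] c[OF \<psi>_C[OF \<sigma>]] by blast
    qed
    with nonempty show ?thesis
      unfolding P_def by (simp add: numeral_2_eq_2)
  qed

  have "\<chi> \<in> BA.Z"
  proof -
    have "\<chi> \<in> carrier BA.\<Gamma> \<rightarrow>\<^sub>E points G B"
    proof (rule PiE_I)
      fix \<rho> assume "\<rho> \<in> carrier BA.\<Gamma>"
      then obtain \<sigma> where "\<sigma> \<in> carrier CA.\<Gamma>" "\<rho> = \<pi> \<sigma>"
        by (rule restr_surj)
      then show "\<chi> \<rho> \<in> points G B"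
        using \<chi> \<psi>_B by simp
    qed (simp add: \<chi>_def)
    moreover have "\<chi> (\<rho> \<otimes>\<^bsub>BA.\<Gamma>\<^esub> \<rho>') = \<chi> \<rho> \<otimes>\<^bsub>G\<^esub> map \<rho> (\<chi> \<rho>')"
      if \<rho>: "\<rho> \<in> carrier BA.\<Gamma>" "\<rho>' \<in> carrier BA.\<Gamma>" for \<rho> \<rho>'
    proof -
      obtain \<sigma> where \<sigma>: "\<sigma> \<in> carrier CA.\<Gamma>" "\<rho> = \<pi> \<sigma>"
        using \<rho>(1) by (rule restr_surj)
      obtain \<sigma>' where \<sigma>': "\<sigma>' \<in> carrier CA.\<Gamma>" "\<rho>' = \<pi> \<sigma>'"
        using \<rho>(2) by (rule restr_surj)
      have "\<chi> (\<rho> \<otimes>\<^bsub>BA.\<Gamma>\<^esub> \<rho>') = \<psi> (\<sigma> \<otimes>\<^bsub>CA.\<Gamma>\<^esub> \<sigma>')"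
        unfolding \<sigma> \<sigma>' restr_mult[OF \<sigma>(1) \<sigma>'(1), symmetric] using \<sigma> \<sigma>' by (intro \<chi>) simp
      then show ?thesis
        unfolding \<psi>_mult[OF \<sigma>(1) \<sigma>'(1)] \<sigma>(2) \<sigma>'(2) \<chi>[OF \<sigma>(1)] \<chi>[OF \<sigma>'(1)]
        by (simp only: map_restr[OF BA.points_set[OF \<psi>_B[OF \<sigma>'(1)]]])
    qed
    moreover have "\<exists>D' h' a'. set a' \<subseteq> B \<and> definable_fun \<L> M A (length a' + length a') n D' h' \<and>
      (\<forall>\<rho>\<in>carrier BA.\<Gamma>. a' @ map \<rho> a' \<in> D' \<and> \<chi> \<rho> = h' (a' @ map \<rho> a'))"
    proof (intro exI conjI ballI)
      let ?h = "\<lambda>v. THE z. P [take ?q v, drop ?q v, z]"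
      let ?D = "{e1 @ e2 | e1 e2 z. [e1, e2, z] \<in> blocks (univ M) [?q, ?q, n] \<and> P [e1, e2, z]}"
      have h_eq: "?h (e1 @ e2) = z" if "length e1 = ?q" "P [e1, e2, z]" for e1 e2 z
        using that P_unique by (auto intro!: the_equality)
      show "set d \<subseteq> B"
        by (rule d)
      have blk: "length e1 = ?q \<and> e1 @ e2 \<in> tuples (univ M) (?q + ?q) \<and> z \<in> tuples (univ M) n"
        if "[e1, e2, z] \<in> blocks (univ M) [?q, ?q, n]" for e1 e2 z
        using that by (auto simp: blocks_Cons tuples_def)
      have graph: "{v @ ?h v | v. v \<in> ?D} = concat ` {bs \<in> blocks (univ M) [?q, ?q, n]. P bs}"
      proof (intro subset_antisym subsetI)
        fix x assume "x \<in> {v @ ?h v | v. v \<in> ?D}"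
        then obtain e1 e2 z where e: "[e1, e2, z] \<in> blocks (univ M) [?q, ?q, n]" "P [e1, e2, z]"
          "x = (e1 @ e2) @ ?h (e1 @ e2)"
          by blast
        then have "x = concat [e1, e2, z]"
          using h_eq[OF _ e(2)] blk[OF e(1)] by simp
        with e show "x \<in> concat ` {bs \<in> blocks (univ M) [?q, ?q, n]. P bs}"
          by blast
      next
        fix x assume "x \<in> concat ` {bs \<in> blocks (univ M) [?q, ?q, n]. P bs}"
        then obtain e1 e2 z where e: "[e1, e2, z] \<in> blocks (univ M) [?q, ?q, n]" "P [e1, e2, z]"
          "x = (e1 @ e2) @ z"
          by (auto simp: blocks_Cons)
        then have "x = (e1 @ e2) @ ?h (e1 @ e2)"
          using h_eq[OF _ e(2)] blk[OF e(1)] by simp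
        with e show "x \<in> {v @ ?h v | v. v \<in> ?D}"
          by blast
      qed
      have "definable \<L> M A (?q + ?q + n) {v @ ?h v | v. v \<in> ?D}"
        unfolding graph using definable_of_rel[OF P_def_rel] by (simp add: add.assoc)
      moreover have "?D \<subseteq> tuples (univ M) (?q + ?q)"
        using blk by blast
      moreover have "?h \<in> ?D \<rightarrow> tuples (univ M) n"
      proof
        fix v assume "v \<in> ?D"
        then obtain e1 e2 z where e: "[e1, e2, z] \<in> blocks (univ M) [?q, ?q, n]" "P [e1, e2, z]" "v = e1 @ e2"
          by blast
        then show "?h v \<in> tuples (univ M) n"
          using h_eq[OF _ e(2)] blk[OF e(1)] by simp
      qed
      ultimately show "definable_fun \<L> M A (?q + ?q) n ?D ?h"
        unfolding definable_fun_def by blast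
      fix \<rho> assume \<rho>: "\<rho> \<in> carrier BA.\<Gamma>"
      then obtain \<sigma> where \<sigma>: "\<sigma> \<in> carrier CA.\<Gamma>" "\<rho> = \<pi> \<sigma>"
        by (rule restr_surj)
      have P: "P [d, map \<rho> d, \<chi> \<rho>]"
        using P_value[OF \<sigma>(1)] unfolding \<sigma>(2) \<chi>[OF \<sigma>(1)] by (simp only: map_restr[OF d])
      have "set (map \<rho> d) \<subseteq> B"
        using d BA.Aut_closed[OF \<rho>] by auto
      then have "set (map \<rho> d) \<subseteq> univ M" "set d \<subseteq> univ M"
        using d BA.subsets(3) by (meson subset_trans)+
      moreover have "\<chi> \<rho> \<in> tuples (univ M) n"
        unfolding \<sigma>(2) \<chi>[OF \<sigma>(1)] using c[OF \<psi>_C[OF \<sigma>(1)]] BA.carrier_G by blast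
      ultimately have "[d, map \<rho> d, \<chi> \<rho>] \<in> blocks (univ M) [?q, ?q, n]"
        by (simp add: blocks_Cons tuples_def)
      with P show "d @ map \<rho> d \<in> ?D"
        by blast
      show "\<chi> \<rho> = ?h (d @ map \<rho> d)"
        by (rule h_eq[OF refl P, symmetric])
    qed
    ultimately show ?thesis
      unfolding Z1_def by blast
  qed
  moreover have "(\<phi>, infl \<chi>) \<in> CA.coh"
  proof -
    have "\<phi> \<sigma> = inv\<^bsub>G\<^esub> b \<otimes>\<^bsub>G\<^esub> infl \<chi> \<sigma> \<otimes>\<^bsub>G\<^esub> map \<sigma> b" if \<sigma>: "\<sigma> \<in> carrier CA.\<Gamma>" for \<sigma>
    proof -
      have car: "b \<in> carrier G" "\<phi> \<sigma> \<in> carrier G" "map \<sigma> b \<in> carrier G" "\<psi> \<sigma> \<in> carrier G"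
        using c[OF b] c[OF CA.cocycle_points[OF \<phi> \<sigma>]] c[OF CA.act_closed[OF \<sigma> b]] c[OF \<psi>_C[OF \<sigma>]] by auto
      have "inv\<^bsub>G\<^esub> b \<otimes>\<^bsub>G\<^esub> infl \<chi> \<sigma> \<otimes>\<^bsub>G\<^esub> map \<sigma> b = inv\<^bsub>G\<^esub> b \<otimes>\<^bsub>G\<^esub> (\<psi> \<sigma> \<otimes>\<^bsub>G\<^esub> map \<sigma> b)"
        unfolding infl_apply[OF \<sigma>] \<chi>[OF \<sigma>] using car by (simp add: BA.G.m_assoc)
      also have "\<dots> = \<phi> \<sigma>"
        unfolding \<psi>_eq[OF \<sigma>] using car by (simp add: BA.G.m_assoc[symmetric])
      finally show ?thesis ..
    qed
    then show ?thesis
      unfolding cohomologous_def using \<phi> infl_Z[OF \<open>\<chi> \<in> BA.Z\<close>] b by blast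
  qed
  ultimately show thesis
    by (rule that)
qed

section \<open>The exact sequence\<close>

lemma pi1_class: "\<phi> \<in> BA.Z \<Longrightarrow> pi1 \<L> M n G A B C (BA.coh `` {\<phi>}) = CA.coh `` {infl \<phi>}"
  unfolding pi1_def by (rule on_classes_eq[OF BA.coh_equiv CA.coh_equiv infl_coh])

lemma iota1_class: "\<phi> \<in> CA.Z \<Longrightarrow> iota1 \<L> M n G B C (CA.coh `` {\<phi>}) = CB.coh `` {res \<phi>}"
  unfolding iota1_def by (rule on_classes_eq[OF CA.coh_equiv CB.coh_equiv res_coh])

lemma H1_E:
  assumes "X \<in> H1 \<L> M n G E K"
  obtains \<phi> where "\<phi> \<in> Z1 \<L> M n G E K" "X = cohomologous \<L> M n G E K `` {\<phi>}"
  using assms unfolding H1_def by (rule quotientE)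

lemma H1_I: "\<phi> \<in> Z1 \<L> M n G E K \<Longrightarrow> cohomologous \<L> M n G E K `` {\<phi>} \<in> H1 \<L> M n G E K"
  unfolding H1_def by (rule quotientI)

lemma infl_trivial: "infl (trivial_cocycle \<L> M G B A) = trivial_cocycle \<L> M G C A"
  using restr_closed
  by (intro CA.cocycle_ext infl_Z BA.trivial_cocycle_Z CA.trivial_cocycle_Z)
    (simp add: infl_apply trivial_cocycle_def)

lemma res_trivial: "res (trivial_cocycle \<L> M G C A) = trivial_cocycle \<L> M G C B"
  using CB_CA
  by (intro CB.cocycle_ext res_Z CA.trivial_cocycle_Z CB.trivial_cocycle_Z)
    (simp add: res_apply trivial_cocycle_def)

lemma res_infl:
  assumes "\<phi> \<in> BA.Z"
  shows "res (infl \<phi>) = trivial_cocycle \<L> M G C B"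
proof (rule CB.cocycle_ext)
  fix \<tau> assume \<tau>: "\<tau> \<in> carrier CB.\<Gamma>"
  have "\<pi> \<tau> = \<one>\<^bsub>BA.\<Gamma>\<^esub>"
    using restr_eq_one[OF CB_CA[OF \<tau>]] \<tau> by blast
  then show "res (infl \<phi>) \<tau> = trivial_cocycle \<L> M G C B \<tau>"
    using \<tau> by (simp add: res_apply infl_apply[OF CB_CA] trivial_cocycle_def BA.cocycle_one[OF assms])
qed (use assms infl_Z res_Z CB.trivial_cocycle_Z in auto)

abbreviation "act \<equiv> H1_action \<L> M n G A B C"
abbreviation "H1CB \<equiv> H1 \<L> M n G C B"

lemma act_class:
  assumes \<sigma>: "\<sigma> \<in> carrier CA.\<Gamma>" and \<phi>: "\<phi> \<in> CB.Z"
  shows "act (\<pi> \<sigma>) (CB.coh `` {\<phi>}) = CB.coh `` {tr \<sigma> \<phi>}"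
proof -
  have "on_classes \<L> M n G C B (tr \<sigma>') (CB.coh `` {\<phi>}) = CB.coh `` {tr \<sigma> \<phi>}"
    if \<sigma>': "\<sigma>' \<in> carrier CA.\<Gamma>" "\<pi> \<sigma>' = \<pi> \<sigma>" for \<sigma>'
  proof -
    obtain \<kappa> where \<kappa>: "\<kappa> \<in> carrier CB.\<Gamma>" "\<sigma>' = \<sigma> \<otimes>\<^bsub>CA.\<Gamma>\<^esub> \<kappa>"
      using \<sigma> \<sigma>'(1) \<sigma>'(2)[symmetric] by (rule restr_eqE)
    have "on_classes \<L> M n G C B (tr \<sigma>') (CB.coh `` {\<phi>}) = CB.coh `` {tr \<sigma>' \<phi>}"
      by (rule on_classes_eq[OF CB.coh_equiv CB.coh_equiv tr_coh[OF \<sigma>'(1)] \<phi>])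
    also have "tr \<sigma>' \<phi> = tr \<sigma> (tr \<kappa> \<phi>)"
      unfolding \<kappa>(2) by (rule tr_comp[OF \<sigma> CB_CA[OF \<kappa>(1)] \<phi>])
    also have "CB.coh `` {\<dots>} = CB.coh `` {tr \<sigma> \<phi>}"
      by (rule equiv_class_eq[OF CB.coh_equiv tr_coh[OF \<sigma> tr_inner_coh[OF \<kappa>(1) \<phi>]]])
    finally show ?thesis .
  qed
  then have "(\<Union>\<sigma>'\<in>{\<sigma>' \<in> carrier CA.\<Gamma>. \<pi> \<sigma>' = \<pi> \<sigma>}. on_classes \<L> M n G C B (tr \<sigma>') (CB.coh `` {\<phi>}))
      = CB.coh `` {tr \<sigma> \<phi>}"
    using \<sigma> by (intro UN_constant_eq[of \<sigma>]) auto
  then show ?thesis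
    using H1_I[OF \<phi>] by (simp add: H1_action_def)
qed

lemma act_closed:
  assumes "\<rho> \<in> carrier BA.\<Gamma>" "X \<in> H1CB"
  shows "act \<rho> X \<in> H1CB"
proof -
  obtain \<sigma> where \<sigma>: "\<sigma> \<in> carrier CA.\<Gamma>" "\<rho> = \<pi> \<sigma>"
    using assms(1) by (rule restr_surj)
  obtain \<phi> where \<phi>: "\<phi> \<in> CB.Z" "X = CB.coh `` {\<phi>}"
    using assms(2) by (rule H1_E)
  show ?thesis
    unfolding \<sigma>(2) \<phi>(2) act_class[OF \<sigma>(1) \<phi>(1)] by (rule H1_I[OF tr_Z[OF \<sigma>(1) \<phi>(1)]])
qed

lemma act_mult:
  assumes "\<rho> \<in> carrier BA.\<Gamma>" "\<rho>' \<in> carrier BA.\<Gamma>" "X \<in> H1CB"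
  shows "act (\<rho> \<otimes>\<^bsub>BA.\<Gamma>\<^esub> \<rho>') X = act \<rho> (act \<rho>' X)"
proof -
  obtain \<sigma> where \<sigma>: "\<sigma> \<in> carrier CA.\<Gamma>" "\<rho> = \<pi> \<sigma>"
    using assms(1) by (rule restr_surj)
  obtain \<sigma>' where \<sigma>': "\<sigma>' \<in> carrier CA.\<Gamma>" "\<rho>' = \<pi> \<sigma>'"
    using assms(2) by (rule restr_surj)
  obtain \<phi> where \<phi>: "\<phi> \<in> CB.Z" "X = CB.coh `` {\<phi>}"
    using assms(3) by (rule H1_E)
  show ?thesis
    unfolding \<sigma>(2) \<sigma>'(2) \<phi>(2) restr_mult[OF \<sigma>(1) \<sigma>'(1), symmetric]
      act_class[OF CA.Aut.m_closed[OF \<sigma>(1) \<sigma>'(1)] \<phi>(1)] act_class[OF \<sigma>'(1) \<phi>(1)]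
      act_class[OF \<sigma>(1) tr_Z[OF \<sigma>'(1) \<phi>(1)]] tr_comp[OF \<sigma>(1) \<sigma>'(1) \<phi>(1)] ..
qed

lemma act_one: "X \<in> H1CB \<Longrightarrow> act \<one>\<^bsub>BA.\<Gamma>\<^esub> X = X"
proof -
  assume "X \<in> H1CB"
  then obtain \<phi> where \<phi>: "\<phi> \<in> CB.Z" "X = CB.coh `` {\<phi>}"
    by (rule H1_E)
  have "\<pi> \<one>\<^bsub>CA.\<Gamma>\<^esub> = \<one>\<^bsub>BA.\<Gamma>\<^esub>"
    using restr_eq_one[OF CA.Aut.one_closed] CB.Aut.one_closed by (simp only: CB_one)
  with act_class[OF CA.Aut.one_closed \<phi>(1)] show ?thesis
    unfolding \<phi>(2) tr_one[OF \<phi>(1)] by simp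
qed

lemma act_group_action: "group_action BA.\<Gamma> H1CB act"
proof -
  have Bij: "act \<rho> \<in> Bij H1CB" if \<rho>: "\<rho> \<in> carrier BA.\<Gamma>" for \<rho>
  proof -
    let ?i = "inv\<^bsub>BA.\<Gamma>\<^esub> \<rho>"
    have i: "?i \<in> carrier BA.\<Gamma>"
      using \<rho> by simp
    have "bij_betw (act \<rho>) H1CB H1CB"
    proof (rule bij_betw_byWitness[where f' = "act ?i"])
      show "\<forall>X\<in>H1CB. act ?i (act \<rho> X) = X"
        using act_mult[OF i \<rho>] act_one \<rho> by simp
      show "\<forall>X\<in>H1CB. act \<rho> (act ?i X) = X"
        using act_mult[OF \<rho> i] act_one \<rho> by simp
    qed (use act_closed[OF \<rho>] act_closed[OF i] in auto)
    then show ?thesis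
      by (simp add: Bij_def H1_action_def)
  qed
  have "act (\<rho> \<otimes>\<^bsub>BA.\<Gamma>\<^esub> \<rho>') = act \<rho> \<otimes>\<^bsub>BijGroup H1CB\<^esub> act \<rho>'"
    if \<rho>: "\<rho> \<in> carrier BA.\<Gamma>" "\<rho>' \<in> carrier BA.\<Gamma>" for \<rho> \<rho>'
  proof (rule extensionalityI[of _ H1CB])
    show "act (\<rho> \<otimes>\<^bsub>BA.\<Gamma>\<^esub> \<rho>') \<in> extensional H1CB"
      using \<rho> by (intro Bij_imp_extensional Bij BA.Aut.m_closed)
    show "act \<rho> \<otimes>\<^bsub>BijGroup H1CB\<^esub> act \<rho>' \<in> extensional H1CB"
      using Bij \<rho> by (simp add: BijGroup_def)
    fix X assume "X \<in> H1CB"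
    then show "act (\<rho> \<otimes>\<^bsub>BA.\<Gamma>\<^esub> \<rho>') X = (act \<rho> \<otimes>\<^bsub>BijGroup H1CB\<^esub> act \<rho>') X"
      using act_mult[OF \<rho>] Bij \<rho> by (simp add: BijGroup_def compose_eq)
  qed
  with Bij have "act \<in> hom BA.\<Gamma> (BijGroup H1CB)"
    by (intro homI) (simp_all add: BijGroup_def)
  then show ?thesis
    by (simp add: group_action_def group_hom_def group_hom_axioms_def group_BijGroup BA.Aut.group_axioms)
qed

lemma iota1_fixed:
  assumes "X \<in> H1 \<L> M n G C A"
  shows "iota1 \<L> M n G B C X \<in> H1_fixed \<L> M n G A B C"
proof -
  obtain \<phi> where \<phi>: "\<phi> \<in> CA.Z" "X = CA.coh `` {\<phi>}"
    using assms by (rule H1_E)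
  have "act \<rho> (CB.coh `` {res \<phi>}) = CB.coh `` {res \<phi>}" if \<rho>: "\<rho> \<in> carrier BA.\<Gamma>" for \<rho>
  proof -
    obtain \<sigma> where \<sigma>: "\<sigma> \<in> carrier CA.\<Gamma>" "\<rho> = \<pi> \<sigma>"
      using \<rho> by (rule restr_surj)
    show ?thesis
      unfolding \<sigma>(2) act_class[OF \<sigma>(1) res_Z[OF \<phi>(1)]]
      by (rule equiv_class_eq[OF CB.coh_equiv tr_res_coh[OF \<sigma>(1) \<phi>(1)]])
  qed
  then show ?thesis
    unfolding \<phi>(2) iota1_class[OF \<phi>(1)] H1_fixed_def using H1_I[OF res_Z[OF \<phi>(1)]] by simp
qed

text \<open>Evaluated at \<open>Aut(C/B)\<close>, where both inflations are trivial, the equation says that \<open>b\<close> is fixed and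
  hence lies in \<open>G(B)\<close>.\<close>
lemma infl_coh_reflect:
  assumes \<phi>: "\<phi> \<in> BA.Z" and \<psi>: "\<psi> \<in> BA.Z" and coh: "(infl \<phi>, infl \<psi>) \<in> CA.coh"
  shows "(\<phi>, \<psi>) \<in> BA.coh"
proof -
  obtain b where b: "b \<in> points G C" and eq: "\<And>\<sigma>. \<sigma> \<in> carrier CA.\<Gamma> \<Longrightarrow>
      \<phi> (\<pi> \<sigma>) = inv\<^bsub>G\<^esub> b \<otimes>\<^bsub>G\<^esub> \<psi> (\<pi> \<sigma>) \<otimes>\<^bsub>G\<^esub> map \<sigma> b"
    using coh by (auto simp: cohomologous_def infl_apply)
  have "b \<in> points G B"
  proof (rule points_descend[OF b])
    fix \<tau> assume \<tau>: "\<tau> \<in> carrier CB.\<Gamma>"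
    have "\<pi> \<tau> = \<one>\<^bsub>BA.\<Gamma>\<^esub>"
      using restr_eq_one[OF CB_CA[OF \<tau>]] \<tau> by blast
    then have "\<one>\<^bsub>G\<^esub> = inv\<^bsub>G\<^esub> b \<otimes>\<^bsub>G\<^esub> map \<tau> b"
      using eq[OF CB_CA[OF \<tau>]] CB.points_carrier[OF b]
      by (simp add: BA.cocycle_one[OF \<phi>] BA.cocycle_one[OF \<psi>])
    then show "map \<tau> b = b"
      using CB.points_carrier[OF b] CB.points_carrier[OF CB.act_closed[OF \<tau> b]]
      by (metis BA.G.inv_closed BA.G.inv_equality BA.G.inv_inv BA.G.inv_comm)
  qed
  moreover have "\<phi> \<rho> = inv\<^bsub>G\<^esub> b \<otimes>\<^bsub>G\<^esub> \<psi> \<rho> \<otimes>\<^bsub>G\<^esub> map \<rho> b" if \<rho>: "\<rho> \<in> carrier BA.\<Gamma>" for \<rho>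
  proof -
    obtain \<sigma> where \<sigma>: "\<sigma> \<in> carrier CA.\<Gamma>" "\<rho> = \<pi> \<sigma>"
      using \<rho> by (rule restr_surj)
    show ?thesis
      using eq[OF \<sigma>(1)] unfolding \<sigma>(2) by (simp only: map_restr[OF BA.points_set[OF calculation]])
  qed
  ultimately show ?thesis
    unfolding cohomologous_def using \<phi> \<psi> by blast
qed

lemma inj_pi1: "inj_on (pi1 \<L> M n G A B C) (H1 \<L> M n G B A)"
proof (rule inj_onI)
  fix X Y assume X: "X \<in> H1 \<L> M n G B A" and Y: "Y \<in> H1 \<L> M n G B A"
    and eq: "pi1 \<L> M n G A B C X = pi1 \<L> M n G A B C Y"
  obtain \<phi> where \<phi>: "\<phi> \<in> BA.Z" "X = BA.coh `` {\<phi>}"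
    using X by (rule H1_E)
  obtain \<psi> where \<psi>: "\<psi> \<in> BA.Z" "Y = BA.coh `` {\<psi>}"
    using Y by (rule H1_E)
  have "(infl \<phi>, infl \<psi>) \<in> CA.coh"
    using eq unfolding \<phi>(2) \<psi>(2) pi1_class[OF \<phi>(1)] pi1_class[OF \<psi>(1)]
    using CA.coh_equiv infl_Z[OF \<psi>(1)] by (rule eq_equiv_class)
  then have "(\<phi>, \<psi>) \<in> BA.coh"
    by (rule infl_coh_reflect[OF \<phi>(1) \<psi>(1)])
  then show "X = Y"
    unfolding \<phi>(2) \<psi>(2) by (rule equiv_class_eq[OF BA.coh_equiv])
qed

lemma exactness:
  "pi1 \<L> M n G A B C ` H1 \<L> M n G B A = {X \<in> H1 \<L> M n G C A. iota1 \<L> M n G B C X = H1_base \<L> M n G C B}"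
proof (intro subset_antisym subsetI)
  fix X assume "X \<in> pi1 \<L> M n G A B C ` H1 \<L> M n G B A"
  then obtain Y where Y: "Y \<in> H1 \<L> M n G B A" "X = pi1 \<L> M n G A B C Y"
    by blast
  from Y(1) obtain \<phi> where \<phi>: "\<phi> \<in> BA.Z" "Y = BA.coh `` {\<phi>}"
    by (rule H1_E)
  have X: "X = CA.coh `` {infl \<phi>}"
    unfolding Y(2) \<phi>(2) by (rule pi1_class[OF \<phi>(1)])
  then show "X \<in> {X \<in> H1 \<L> M n G C A. iota1 \<L> M n G B C X = H1_base \<L> M n G C B}"
    using H1_I[OF infl_Z[OF \<phi>(1)]] iota1_class[OF infl_Z[OF \<phi>(1)]] res_infl[OF \<phi>(1)]
    by (simp add: H1_base_def)
next
  fix X assume "X \<in> {X \<in> H1 \<L> M n G C A. iota1 \<L> M n G B C X = H1_base \<L> M n G C B}"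
  then have "X \<in> H1 \<L> M n G C A" and ker: "iota1 \<L> M n G B C X = H1_base \<L> M n G C B"
    by auto
  then obtain \<phi> where \<phi>: "\<phi> \<in> CA.Z" "X = CA.coh `` {\<phi>}"
    by (meson H1_E)
  have "(res \<phi>, trivial_cocycle \<L> M G C B) \<in> CB.coh"
    using ker unfolding \<phi>(2) iota1_class[OF \<phi>(1)] H1_base_def
    using CB.coh_equiv CB.trivial_cocycle_Z by (rule eq_equiv_class)
  then obtain b where b: "b \<in> points G C" and triv: "\<And>\<tau>. \<tau> \<in> carrier CB.\<Gamma> \<Longrightarrow>
      \<phi> \<tau> = inv\<^bsub>G\<^esub> b \<otimes>\<^bsub>G\<^esub> \<one>\<^bsub>G\<^esub> \<otimes>\<^bsub>G\<^esub> map \<tau> b"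
    by (auto simp: cohomologous_def res_apply trivial_cocycle_def)
  have "\<phi> \<tau> = inv\<^bsub>G\<^esub> b \<otimes>\<^bsub>G\<^esub> map \<tau> b" if "\<tau> \<in> carrier CB.\<Gamma>" for \<tau>
    using triv[OF that] CB.points_carrier[OF b] by simp
  then obtain \<chi> where \<chi>: "\<chi> \<in> BA.Z" "(\<phi>, infl \<chi>) \<in> CA.coh"
    using descend_cocycle[OF \<phi>(1) b] by blast
  have "X = pi1 \<L> M n G A B C (BA.coh `` {\<chi>})"
    unfolding \<phi>(2) pi1_class[OF \<chi>(1)] by (rule equiv_class_eq[OF CA.coh_equiv \<chi>(2)])
  then show "X \<in> pi1 \<L> M n G A B C ` H1 \<L> M n G B A"
    using H1_I[OF \<chi>(1)] by (rule image_eqI)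
qed

end

theorem theorem4p3:
  fixes \<L> :: "('f, 'p) lang"
    and T :: "('f, 'p) fm set"
    and M :: "('f, 'p, 'a) struct"
    and G :: "'a list monoid"
    and n :: nat
    and A B C :: "'a set"
  assumes T: "complete_theory \<L> T" "elim_imaginaries \<L> T"
    and M: "is_model \<L> M T"
    and A: "A \<subseteq> univ M" "atomic_over \<L> M A" "strongly_omega_homogeneous_over \<L> M A"
    and G: "definable_group \<L> M A n G"
    and ABC: "A \<subseteq> B" "B \<subseteq> C" "C \<subseteq> univ M"
    and B: "normal_extension \<L> M A B" "B = dcl \<L> M B" "perms_extend \<L> M B A"
      "atomic_over \<L> M B" "strongly_omega_homogeneous_over \<L> M B"
    and C: "normal_extension \<L> M A C" "C = dcl \<L> M C" "perms_extend \<L> M C A"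
      "atomic_over \<L> M C" "strongly_omega_homogeneous_over \<L> M C"
  shows
    \<comment> \<open>the short exact sequence of groups; the library lists it from right to left\<close>
    "short_exact_sequence (Aut_grp \<L> M B A) (Aut_grp \<L> M C A) (Aut_grp \<L> M C B)
        (\<lambda>\<sigma>. restrict \<sigma> B) (\<lambda>\<sigma>. \<sigma>)
     \<and>
     \<comment> \<open>being cohomologous is an equivalence relation\<close>
     (\<forall>(E, K)\<in>{(B, A), (C, A), (C, B)}. equiv (Z1 \<L> M n G E K) (cohomologous \<L> M n G E K)
        \<and> trivial_cocycle \<L> M G E K \<in> Z1 \<L> M n G E K)
     \<and>
     \<comment> \<open>the transform action is well defined on classes, and factors through \<open>Aut(B/A)\<close>\<close>
     (\<forall>\<sigma>\<in>carrier (Aut_grp \<L> M C A). \<forall>\<phi>\<in>Z1 \<L> M n G C B.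
        transform \<L> M A B C \<sigma> \<phi> \<in> Z1 \<L> M n G C B \<and>
        H1_action \<L> M n G A B C (restrict \<sigma> B) (cohomologous \<L> M n G C B `` {\<phi>})
          = cohomologous \<L> M n G C B `` {transform \<L> M A B C \<sigma> \<phi>})
     \<and>
     group_action (Aut_grp \<L> M B A) (H1 \<L> M n G C B) (H1_action \<L> M n G A B C)
     \<and>
     \<comment> \<open>\<open>\<pi>\<^sup>1\<close> is well defined and pointed\<close>
     precomp_restr \<L> M A B C \<in> Z1 \<L> M n G B A \<rightarrow> Z1 \<L> M n G C A
     \<and>
     (\<forall>\<phi>\<in>Z1 \<L> M n G B A. pi1 \<L> M n G A B C (cohomologous \<L> M n G B A `` {\<phi>})
        = cohomologous \<L> M n G C A `` {precomp_restr \<L> M A B C \<phi>})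
     \<and>
     pi1 \<L> M n G A B C \<in> H1 \<L> M n G B A \<rightarrow> H1 \<L> M n G C A
     \<and>
     pi1 \<L> M n G A B C (H1_base \<L> M n G B A) = H1_base \<L> M n G C A
     \<and>
     \<comment> \<open>\<open>\<iota>\<^sup>1\<close> is well defined and pointed, with values in the fixed points\<close>
     precomp_incl \<L> M B C \<in> Z1 \<L> M n G C A \<rightarrow> Z1 \<L> M n G C B
     \<and>
     (\<forall>\<phi>\<in>Z1 \<L> M n G C A. iota1 \<L> M n G B C (cohomologous \<L> M n G C A `` {\<phi>})
        = cohomologous \<L> M n G C B `` {precomp_incl \<L> M B C \<phi>})
     \<and>
     iota1 \<L> M n G B C \<in> H1 \<L> M n G C A \<rightarrow> H1_fixed \<L> M n G A B C
     \<and>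
     iota1 \<L> M n G B C (H1_base \<L> M n G C A) = H1_base \<L> M n G C B
     \<and>
     \<comment> \<open>exactness\<close>
     inj_on (pi1 \<L> M n G A B C) (H1 \<L> M n G B A)
     \<and>
     pi1 \<L> M n G A B C ` H1 \<L> M n G B A
       = {X \<in> H1 \<L> M n G C A. iota1 \<L> M n G B C X = H1_base \<L> M n G C B}"
proof -
  interpret galois_tower \<L> M n G A B C
    using M G ABC B C by unfold_locales (simp_all add: is_model_def)
  have pi1: "pi1 \<L> M n G A B C \<in> H1 \<L> M n G B A \<rightarrow> H1 \<L> M n G C A"
  proof
    fix X assume "X \<in> H1 \<L> M n G B A"
    then obtain \<phi> where "\<phi> \<in> BA.Z" "X = BA.coh `` {\<phi>}"
      by (rule H1_E)
    then show "pi1 \<L> M n G A B C X \<in> H1 \<L> M n G C A"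
      using pi1_class H1_I infl_Z by metis
  qed
  have base: "pi1 \<L> M n G A B C (H1_base \<L> M n G B A) = H1_base \<L> M n G C A"
    "iota1 \<L> M n G B C (H1_base \<L> M n G C A) = H1_base \<L> M n G C B"
    unfolding H1_base_def pi1_class[OF BA.trivial_cocycle_Z] iota1_class[OF CA.trivial_cocycle_Z]
      infl_trivial res_trivial by (rule refl)+
  have equivs: "\<forall>(E, K)\<in>{(B, A), (C, A), (C, B)}. equiv (Z1 \<L> M n G E K) (cohomologous \<L> M n G E K)
      \<and> trivial_cocycle \<L> M G E K \<in> Z1 \<L> M n G E K"
    by (simp add: BA.coh_equiv CA.coh_equiv CB.coh_equiv
        BA.trivial_cocycle_Z CA.trivial_cocycle_Z CB.trivial_cocycle_Z)
  have action: "\<forall>\<sigma>\<in>carrier CA.\<Gamma>. \<forall>\<phi>\<in>CB.Z. tr \<sigma> \<phi> \<in> CB.Z \<and>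
      act (\<pi> \<sigma>) (CB.coh `` {\<phi>}) = CB.coh `` {tr \<sigma> \<phi>}"
    by (intro ballI conjI tr_Z act_class)
  have classes: "\<forall>\<phi>\<in>BA.Z. pi1 \<L> M n G A B C (BA.coh `` {\<phi>}) = CA.coh `` {infl \<phi>}"
    "\<forall>\<phi>\<in>CA.Z. iota1 \<L> M n G B C (CA.coh `` {\<phi>}) = CB.coh `` {res \<phi>}"
    by (simp_all add: pi1_class iota1_class)
  have maps: "infl \<in> BA.Z \<rightarrow> CA.Z" "res \<in> CA.Z \<rightarrow> CB.Z"
    "iota1 \<L> M n G B C \<in> H1 \<L> M n G C A \<rightarrow> H1_fixed \<L> M n G A B C"
    by (simp_all add: infl_Z res_Z iota1_fixed)
  show ?thesis
    by (intro conjI exact_Aut equivs action act_group_action maps classes pi1 base inj_pi1 exactness)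
qed

end
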